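(* The functor $k:\mathcal{PSMF}\rightarrow\mathrm{Igr}_+$ (reduced K-theory of pre-special hyperfields) is left adjoint to the functor $\Gamma:\mathrm{Igr}_+\rightarrow\mathcal{PSMF}$. The unit of the adjunction is the natural transformation $\phi:1_{\mathcal{PSMF}}\rightarrow\Gamma\circ k$ defined for $F\in\mathcal{PSMF}$ by $\phi_F=e_{k(F)}\circ\rho_F$ (with $\phi_F(0)=0$).
   Context: Inductive graded rings. An inductive graded ring (Igr) is a structure $R=((R_n)_{n\ge0},(h_n)_{n\ge0},(\ast_{nm})_{n,m\geq 0})$ where: (i) $R_0\cong\mathbb F_2$; (ii) each $R_n$ is an abelian group $(R_n,+,0)$ of exponent 2 with a distinguished element $\top_n$; (iii) $h_n:R_n\to R_{n+1}$ is a group homomorphism with $h_n(\top_n)=\top_{n+1}$; (iv) for $n\ge1$, $h_n(x)=\top_1\ast_{1n}x$; (v) the binary operations $\ast_{nm}:R_n\times R_m\to R_{n+m}$ induce a commutative ring structure on $\bigoplus_{n\ge0}R_n$ with $1=\top_0$; (vi) writing $h^t_s=h_{t-1}\circ\dots\circ h_s$ for $s<t$ and $h_s^s=\mathrm{Id}$, for $p\ge n$, $q\ge m$, $x\in R_n$, $y\in R_m$ one has $h^p_n(x)\ast h^q_m(y)=h^{p+q}_{n+m}(x\ast y)$. A morphism $f:R\to S$ is a family of group homomorphisms $f_n:R_n\to S_n$ with $f_n(\top_n)=\top_n$ such that $\bigoplus f_n$ is a morphism of commutative rings with unity. $\mathrm{Igr}$ is the resulting category. $\mathrm{Igr}_+$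 is the full subcategory of those $R$ such that: for $n\ge 2$ every element of $R_n$ is a finite sum of products $a_1\ast\dots\ast a_n$ with all $a_i\in R_1$; and $(\top_1+a)\ast_{11}a=0$ in $R_2$ for all $a\in R_1$. Hyperfields. A commutative multigroup $(F,+,-,0)$ has a multivalued operation $+:F\times F\to\mathcal P(F)\setminus\{\emptyset\}$ that is commutative and associative, with $x+0=\{x\}$, and such that $z\in x+y$ implies $x\in z+(-y)$ and $y\in z+(-x)$. A multiring is $(F,+,\cdot,-,0,1)$ with $(F,+,-,0)$ a commutative multigroup, $(F,\cdot,1)$ a monoid, $a0=0$ for all $a$, and $c\in a+b$ implies $cd\in ad+bd$ and $dc\in da+db$. A hyperfield (multifield) is a commutative multiring with $1\ne0$ in which every nonzero element is invertible. Write $\dot F=F\setminus\{0\}$ and $a-b=a+(-b)$. A morphism of hyperfields is a map preserving $0,1,-,\cdot$ with $f(a+b)\subseteq f(a)+f(b)$. A pre-special hyperfield is a hyperfield $F$ such that $1-1=F$ and, for all $a\in\dot F$, $a^2=1$ and $(1-a)(1-a)\subseteq 1-a$. $\mathcal{PSMF}$ is the category of pre-special hyperfields and hyperfield morphisms. The functor $k$. For $F\in\mathcal{PSMF}$, $K_0F=\mathbb Z$, $K_1F$ is the multiplicative group $\dot F$ written additively, with canonical isomorphism $\rho=\rho_F:\dot F\to K_1F$, $\rho(ab)=\rho(a)+\rho(b)$; and for $n\ge2$, $K_nF$ is the quotient of $K_1F\otimes_{\mathbb Z}\dots\otimes_{\mathbb Z}K_1F$ ($n$ times) by the subgroup generated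 by all $\rho(a_1)\otimes\dots\otimes\rho(a_n)$ such that $a_{i+1}\in1-a_i$ for some $1\le i\le n-1$. Put $k_nF=K_nF/2K_nF$; $k(F)=(k_nF)_{n\geq 0}$ is an object of $\mathrm{Igr}_+$ with the product induced by $\otimes$, $\top_n$ the class of $\rho(-1)\otimes\dots\otimes\rho(-1)$ ($\top_0=1$), and $h_n$ given by multiplication by $\rho(-1)$. Since $a^2=1$ in $\dot F$, $k_1F=K_1F$. A morphism $\varphi:F\to L$ induces $k(\varphi)$, given on generators by $\rho(a_1)\cdots\rho(a_n)\mapsto\rho(\varphi(a_1))\cdots\rho(\varphi(a_n))$ and by the identity in degree $0$. The functor $\Gamma$. For $R\in\mathrm{Igr}_+$ fix an isomorphism $e_R:(R_1,+,0,\top_1)\to(G(R),\cdot,1,-1)$ onto a multiplicatively written group, i.e. $e_R(a+b)=e_R(a)e_R(b)$ and $e_R(\top_1)=-1$, and let $l_R=e_R^{-1}$. Write $l_R(a)l_R(b)$ for $l_R(a)\ast_{11}l_R(b)\in R_2$. Put $\Gamma(R)=G(R)\cup\{0\}$ with $-a=(-1)\cdot a$, $a\cdot 0=0\cdot a=0$, $a+0=0+a=\{a\}$, $a+(-a)=\Gamma(R)$ for $a\neq 0$, and, for $a,b\ne0$ with $a\ne-b$, $a+b=\{c\in\Gamma(R):$ there exists $d\in G(R)$ with $ab=cd$ in $G(R)$ and $l_R(a)l_R(b)=l_R(c)l_R(d)$ in $R_2\}$. With this structure $\Gamma(R)$ is regarded as an object of $\mathcal{PSMF}$. For $f:R\to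 S$ in $\mathrm{Igr}_+$, $\Gamma(f)(0)=0$ and $\Gamma(f)(x)=e_S(f_1(l_R(x)))$ for $x\in G(R)$.
   Formalization: Γ(R) need not have associative hyperaddition, so it need not lie in PSMF; the formal theorem asserts all other pre-special hyperfield axioms for Γ(R) and the full adjunction for every R in Igr₊, with Hom(F,Γ(R)) the maps satisfying the morphism conditions. *)

theory Defs
  imports
    "HOL-Algebra.Free_Abelian_Groups"
    "HOL-Algebra.QuotRing"
    "HOL-Number_Theory.Residues"
begin

section \<open>Hyperfields\<close>

text \<open>The multiplicative part of a multiring is the underlying \<open>monoid\<close> record of HOL-Algebra; the
  hyperaddition is set-valued.\<close>

record 'a hyper = "'a monoid" +
  hzero :: 'a
  hneg :: "'a \<Rightarrow> 'a"
  hadd :: "'a \<Rightarrow> 'a \<Rightarrow> 'a set"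

text \<open>Associativity of the hyperaddition is split off from the other axioms of a commutative
  multigroup; see the remark at \<open>pre_special_up_to_assoc\<close> below.\<close>

locale comm_multigroup_no_assoc =
  fixes F :: "('a, 'b) hyper_scheme" (structure)
  assumes zero_closed: "hzero F \<in> carrier F"
    and neg_closed: "x \<in> carrier F \<Longrightarrow> hneg F x \<in> carrier F"
    and add_closed: "\<lbrakk>x \<in> carrier F; y \<in> carrier F\<rbrakk> \<Longrightarrow> hadd F x y \<subseteq> carrier F"
    and add_nonempty: "\<lbrakk>x \<in> carrier F; y \<in> carrier F\<rbrakk> \<Longrightarrow> hadd F x y \<noteq> {}"
    and add_comm: "\<lbrakk>x \<in> carrier F; y \<in> carrier F\<rbrakk> \<Longrightarrow> hadd F x y = hadd F y x"
    and add_zero: "x \<in> carrier F \<Longrightarrow> hadd F x (hzero F) = {x}"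
    and add_rev: "\<lbrakk>x \<in> carrier F; y \<in> carrier F; z \<in> hadd F x y\<rbrakk>
      \<Longrightarrow> x \<in> hadd F z (hneg F y) \<and> y \<in> hadd F z (hneg F x)"

locale comm_multigroup = comm_multigroup_no_assoc +
  assumes add_assoc: "\<lbrakk>x \<in> carrier F; y \<in> carrier F; z \<in> carrier F\<rbrakk>
      \<Longrightarrow> (\<Union>w\<in>hadd F x y. hadd F w z) = (\<Union>w\<in>hadd F y z. hadd F x w)"

locale multiring = comm_multigroup F + monoid F for F :: "('a, 'b) hyper_scheme" (structure) +
  assumes mult_zero: "a \<in> carrier F \<Longrightarrow> a \<otimes> hzero F = hzero F"
    and distrib: "\<lbrakk>a \<in> carrier F; b \<in> carrier F; d \<in> carrier F; c \<in> hadd F a b\<rbrakk>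
      \<Longrightarrow> c \<otimes> d \<in> hadd F (a \<otimes> d) (b \<otimes> d) \<and> d \<otimes> c \<in> hadd F (d \<otimes> a) (d \<otimes> b)"

locale hyperfield = multiring F + comm_monoid F for F :: "('a, 'b) hyper_scheme" (structure) +
  assumes one_not_zero: "\<one> \<noteq> hzero F"
    and invertible: "\<lbrakk>a \<in> carrier F; a \<noteq> hzero F\<rbrakk> \<Longrightarrow> a \<in> Units F"

definition hdiff :: "('a, 'b) hyper_scheme \<Rightarrow> 'a \<Rightarrow> 'a \<Rightarrow> 'a set" where
  "hdiff F a b = hadd F a (hneg F b)"

locale pre_special_hyperfield = hyperfield +
  assumes one_diff_one: "hdiff F \<one> \<one> = carrier F"
    and square_one: "\<lbrakk>a \<in> carrier F; a \<noteq> hzero F\<rbrakk> \<Longrightarrow> a \<otimes> a = \<one>"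
    and diff_mult_closed: "\<lbrakk>a \<in> carrier F; a \<noteq> hzero F\<rbrakk>
      \<Longrightarrow> hdiff F \<one> a <#> hdiff F \<one> a \<subseteq> hdiff F \<one> a"

text \<open>All axioms of a pre-special hyperfield other than associativity of the hyperaddition. For an
  arbitrary \<open>R\<close> in \<open>Igr\<^sub>+\<close> the hyperaddition of \<open>\<Gamma>(R)\<close> satisfies all of these, but it need not be
  associative. An example is the graded ring with \<open>R\<^sub>1\<close> of \<open>\<bbbF>\<^sub>2\<close>-basis \<open>t = \<top>\<^sub>1, a, b, c, z\<close>, where \<open>R\<close> is
  the symmetric algebra of \<open>R\<^sub>1\<close> modulo \<open>x\<^sup>2 + tx\<close> for all \<open>x \<in> R\<^sub>1\<close>, \<open>(b + z)a\<close> and \<open>z(t + b + c)\<close>: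
  there \<open>e(c)\<close> lies in \<open>(1 + e(t + a)) + e(t + b)\<close> but not in \<open>1 + (e(t + a) + e(t + b))\<close>.\<close>

definition pre_special_up_to_assoc :: "('a, 'b) hyper_scheme \<Rightarrow> bool" where
  "pre_special_up_to_assoc F \<longleftrightarrow>
     comm_multigroup_no_assoc F \<and> comm_monoid F \<and> multiring_axioms F \<and> hyperfield_axioms F \<and>
     pre_special_hyperfield_axioms F"

lemma pre_special_hyperfield_iff:
  "pre_special_hyperfield F \<longleftrightarrow> pre_special_up_to_assoc F \<and> comm_multigroup_axioms F"
  unfolding pre_special_up_to_assoc_def pre_special_hyperfield_def hyperfield_def multiring_def
    comm_multigroup_def comm_monoid_def by blast

text \<open>Morphisms are extensional functions (undefined off the carrier), so that equality of
  morphisms is equality in HOL; \<open>compose\<close> and \<open>restrict\<close> then give composition and identities.\<close>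

definition hom_psmf ::
    "('a, 'c) hyper_scheme \<Rightarrow> ('b, 'd) hyper_scheme \<Rightarrow> ('a \<Rightarrow> 'b) set" where
  "hom_psmf F L = {f \<in> carrier F \<rightarrow>\<^sub>E carrier L.
     f (hzero F) = hzero L \<and> f \<one>\<^bsub>F\<^esub> = \<one>\<^bsub>L\<^esub> \<and>
     (\<forall>x\<in>carrier F. f (hneg F x) = hneg L (f x)) \<and>
     (\<forall>x\<in>carrier F. \<forall>y\<in>carrier F. f (x \<otimes>\<^bsub>F\<^esub> y) = f x \<otimes>\<^bsub>L\<^esub> f y) \<and>
     (\<forall>x\<in>carrier F. \<forall>y\<in>carrier F. f ` hadd F x y \<subseteq> hadd L (f x) (f y))}"

definition id_psmf :: "('a, 'c) hyper_scheme \<Rightarrow> 'a \<Rightarrow> 'a" where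
  "id_psmf F = restrict id (carrier F)"


section \<open>Inductive graded rings\<close>

text \<open>The groups \<open>R\<^sub>n\<close> are \<open>monoid\<close> records as usual in HOL-Algebra, so their additive notation
  \<open>+\<close>, \<open>0\<close> appears here as \<open>\<otimes>\<close>, \<open>\<one>\<close>. The products are \<open>imult R n m : R\<^sub>n \<times> R\<^sub>m \<rightarrow> R\<^sub>n\<^sub>+\<^sub>m\<close>.\<close>

record 'a igr =
  igrp :: "nat \<Rightarrow> 'a monoid"
  itop :: "nat \<Rightarrow> 'a"
  ih :: "nat \<Rightarrow> 'a \<Rightarrow> 'a"
  imult :: "nat \<Rightarrow> nat \<Rightarrow> 'a \<Rightarrow> 'a \<Rightarrow> 'a"

definition igr_ring :: "'a igr \<Rightarrow> (nat \<Rightarrow> 'a) ring" where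
  "igr_ring R =
    \<lparr>carrier = carrier (sum_group UNIV (igrp R)),
     monoid.mult = \<lambda>x y n. finprod (igrp R n) (\<lambda>i. imult R i (n - i) (x i) (y (n - i))) {..n},
     one = (\<lambda>n. if n = 0 then itop R 0 else \<one>\<^bsub>igrp R n\<^esub>),
     zero = \<one>\<^bsub>sum_group UNIV (igrp R)\<^esub>,
     add = (\<lambda>x y. x \<otimes>\<^bsub>sum_group UNIV (igrp R)\<^esub> y)\<rparr>"

definition igr_ring0 :: "'a igr \<Rightarrow> 'a ring" where
  "igr_ring0 R =
    \<lparr>carrier = carrier (igrp R 0), monoid.mult = imult R 0 0, one = itop R 0,
     zero = \<one>\<^bsub>igrp R 0\<^esub>, add = (\<lambda>x y. x \<otimes>\<^bsub>igrp R 0\<^esub> y)\<rparr>"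

text \<open>\<open>ih_iter R s d\<close> is \<open>h\<^sub>s\<close> followed by \<open>h\<^sub>s\<^sub>+\<^sub>1, \<dots>\<close>, with \<open>d\<close> factors; thus the map written
  \<open>h\<^sup>t\<^sub>s\<close> in mathematics is \<open>ih_iter R s (t - s)\<close>.\<close>

primrec ih_iter :: "'a igr \<Rightarrow> nat \<Rightarrow> nat \<Rightarrow> 'a \<Rightarrow> 'a" where
  "ih_iter R s 0 x = x"
| "ih_iter R s (Suc d) x = ih R (s + d) (ih_iter R s d x)"

locale igr =
  fixes R :: "'a igr"
  assumes R0: "igr_ring0 R \<simeq> residue_ring 2"
    and grp: "comm_group (igrp R n)"
    and exponent_two: "x \<in> carrier (igrp R n) \<Longrightarrow> x \<otimes>\<^bsub>igrp R n\<^esub> x = \<one>\<^bsub>igrp R n\<^esub>"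
    and top_closed: "itop R n \<in> carrier (igrp R n)"
    and h_hom: "ih R n \<in> hom (igrp R n) (igrp R (n + 1))"
    and h_top: "ih R n (itop R n) = itop R (n + 1)"
    and h_eq: "\<lbrakk>1 \<le> n; x \<in> carrier (igrp R n)\<rbrakk> \<Longrightarrow> ih R n x = imult R 1 n (itop R 1) x"
    and mult_closed: "\<lbrakk>x \<in> carrier (igrp R n); y \<in> carrier (igrp R m)\<rbrakk>
      \<Longrightarrow> imult R n m x y \<in> carrier (igrp R (n + m))"
    and ring: "cring (igr_ring R)"
    and h_mult: "\<lbrakk>n \<le> p; m \<le> q; x \<in> carrier (igrp R n); y \<in> carrier (igrp R m)\<rbrakk>
      \<Longrightarrow> imult R p q (ih_iter R n (p - n) x) (ih_iter R m (q - m) y)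
          = ih_iter R (n + m) (p + q - (n + m)) (imult R n m x y)"

text \<open>The product \<open>a\<^sub>1 * \<dots> * a\<^sub>n\<close> of elements of \<open>R\<^sub>1\<close>.\<close>

primrec iprod :: "'a igr \<Rightarrow> 'a list \<Rightarrow> 'a" where
  "iprod R [] = itop R 0"
| "iprod R (a # as) = imult R 1 (length as) a (iprod R as)"

locale igr_plus = igr +
  assumes generated: "\<lbrakk>2 \<le> n; x \<in> carrier (igrp R n)\<rbrakk> \<Longrightarrow>
      \<exists>(m::nat) c. (\<forall>i<m. length (c i) = n \<and> set (c i) \<subseteq> carrier (igrp R 1)) \<and>
        x = finprod (igrp R n) (\<lambda>i. iprod R (c i)) {..<m}"
    and top_plus: "a \<in> carrier (igrp R 1) \<Longrightarrow>
      imult R 1 1 (itop R 1 \<otimes>\<^bsub>igrp R 1\<^esub> a) a = \<one>\<^bsub>igrp R 2\<^esub>"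

definition hom_igr :: "'a igr \<Rightarrow> 'b igr \<Rightarrow> (nat \<Rightarrow> 'a \<Rightarrow> 'b) set" where
  "hom_igr R S = {f.
     (\<forall>n. f n \<in> hom (igrp R n) (igrp S n) \<inter> extensional (carrier (igrp R n)) \<and>
          f n (itop R n) = itop S n) \<and>
     (\<lambda>x n. f n (x n)) \<in> ring_hom (igr_ring R) (igr_ring S)}"

definition id_igr :: "'a igr \<Rightarrow> nat \<Rightarrow> 'a \<Rightarrow> 'a" where
  "id_igr R = (\<lambda>n. restrict id (carrier (igrp R n)))"

definition comp_igr ::
    "'a igr \<Rightarrow> (nat \<Rightarrow> 'b \<Rightarrow> 'c) \<Rightarrow> (nat \<Rightarrow> 'a \<Rightarrow> 'b) \<Rightarrow> nat \<Rightarrow> 'a \<Rightarrow> 'c" where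
  "comp_igr R g f = (\<lambda>n. compose (carrier (igrp R n)) (g n) (f n))"


section \<open>The functor \<open>k\<close>\<close>

text \<open>The \<open>n\<close>-fold tensor power over \<open>\<int>\<close> of an abelian group \<open>A\<close> (written multiplicatively): the
  free abelian group on the \<open>n\<close>-tuples modulo multilinearity. It is \<open>\<int>\<close> for \<open>n = 0\<close> and \<open>A\<close> for
  \<open>n = 1\<close>.\<close>

definition tuples :: "('a, 'b) monoid_scheme \<Rightarrow> nat \<Rightarrow> 'a list set" where
  "tuples A n = {as. length as = n \<and> set as \<subseteq> carrier A}"

definition multilinear_relators :: "('a, 'b) monoid_scheme \<Rightarrow> nat \<Rightarrow> ('a list \<Rightarrow>\<^sub>0 int) set" where
  "multilinear_relators A n =
    {frag_of (us @ [x \<otimes>\<^bsub>A\<^esub> y] @ vs) - frag_of (us @ [x] @ vs) - frag_of (us @ [y] @ vs) | us x y vs.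
       us @ [x] @ vs \<in> tuples A n \<and> us @ [y] @ vs \<in> tuples A n}"

definition multilinear_subgroup :: "('a, 'b) monoid_scheme \<Rightarrow> nat \<Rightarrow> ('a list \<Rightarrow>\<^sub>0 int) set" where
  "multilinear_subgroup A n =
     generate (free_Abelian_group (tuples A n)) (multilinear_relators A n)"

definition tensor_power :: "('a, 'b) monoid_scheme \<Rightarrow> nat \<Rightarrow> ('a list \<Rightarrow>\<^sub>0 int) set monoid" where
  "tensor_power A n = free_Abelian_group (tuples A n) Mod multilinear_subgroup A n"

definition tensor_class ::
    "('a, 'b) monoid_scheme \<Rightarrow> nat \<Rightarrow> ('a list \<Rightarrow>\<^sub>0 int) \<Rightarrow> ('a list \<Rightarrow>\<^sub>0 int) set" where
  "tensor_class A n x = multilinear_subgroup A n #>\<^bsub>free_Abelian_group (tuples A n)\<^esub> x"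

definition nonzero_group :: "'a hyper \<Rightarrow> 'a hyper" where
  "nonzero_group F = F\<lparr>carrier := carrier F - {hzero F}\<rparr>"

definition steinberg_subgroup :: "'a hyper \<Rightarrow> nat \<Rightarrow> ('a list \<Rightarrow>\<^sub>0 int) set set" where
  "steinberg_subgroup F n = generate (tensor_power (nonzero_group F) n)
     {tensor_class (nonzero_group F) n (frag_of as) | as.
        as \<in> tuples (nonzero_group F) n \<and>
        (\<exists>i. Suc i < n \<and> as ! Suc i \<in> hdiff F \<one>\<^bsub>F\<^esub> (as ! i))}"

text \<open>For \<open>n = 0, 1\<close> the Steinberg subgroup is trivial, so that \<open>K\<^sub>0F = \<int>\<close> and \<open>K\<^sub>1F\<close> is the
  multiplicative group of \<open>F\<close>.\<close>

definition milnor_K :: "'a hyper \<Rightarrow> nat \<Rightarrow> ('a list \<Rightarrow>\<^sub>0 int) set set monoid" where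
  "milnor_K F n = tensor_power (nonzero_group F) n Mod steinberg_subgroup F n"

definition twice_milnor_K :: "'a hyper \<Rightarrow> nat \<Rightarrow> ('a list \<Rightarrow>\<^sub>0 int) set set set" where
  "twice_milnor_K F n = {x \<otimes>\<^bsub>milnor_K F n\<^esub> x | x. x \<in> carrier (milnor_K F n)}"

type_synonym 'a kelt = "('a list \<Rightarrow>\<^sub>0 int) set set set"

definition reduced_K :: "'a hyper \<Rightarrow> nat \<Rightarrow> 'a kelt monoid" where
  "reduced_K F n = milnor_K F n Mod twice_milnor_K F n"

text \<open>\<open>k_class F n\<close> is the projection from formal sums of tuples onto \<open>k\<^sub>nF\<close>; on a tuple it
  gives \<open>\<rho>(a\<^sub>1) \<dots> \<rho>(a\<^sub>n)\<close>. Maps out of \<open>k\<^sub>nF\<close> are defined below through an arbitrary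
  representative \<open>k_rep\<close>.\<close>

definition k_class :: "'a hyper \<Rightarrow> nat \<Rightarrow> ('a list \<Rightarrow>\<^sub>0 int) \<Rightarrow> 'a kelt" where
  "k_class F n x = twice_milnor_K F n #>\<^bsub>milnor_K F n\<^esub>
     (steinberg_subgroup F n #>\<^bsub>tensor_power (nonzero_group F) n\<^esub>
        tensor_class (nonzero_group F) n x)"

definition k_rep :: "'a hyper \<Rightarrow> nat \<Rightarrow> 'a kelt \<Rightarrow> ('a list \<Rightarrow>\<^sub>0 int)" where
  "k_rep F n X =
     (SOME x. x \<in> carrier (free_Abelian_group (tuples (nonzero_group F) n)) \<and> k_class F n x = X)"

definition rho :: "'a hyper \<Rightarrow> 'a \<Rightarrow> 'a kelt" where
  "rho F a = k_class F 1 (frag_of [a])"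

definition frag_concat :: "('a list \<Rightarrow>\<^sub>0 int) \<Rightarrow> ('a list \<Rightarrow>\<^sub>0 int) \<Rightarrow> ('a list \<Rightarrow>\<^sub>0 int)" where
  "frag_concat x y = frag_extend (\<lambda>as. frag_extend (\<lambda>bs. frag_of (as @ bs)) y) x"

definition k_mult :: "'a hyper \<Rightarrow> nat \<Rightarrow> nat \<Rightarrow> 'a kelt \<Rightarrow> 'a kelt \<Rightarrow> 'a kelt" where
  "k_mult F n m X Y = k_class F (n + m) (frag_concat (k_rep F n X) (k_rep F m Y))"

definition k_obj :: "'a hyper \<Rightarrow> 'a kelt igr" where
  "k_obj F =
    \<lparr>igrp = reduced_K F,
     itop = (\<lambda>n. k_class F n (frag_of (replicate n (hneg F \<one>\<^bsub>F\<^esub>)))),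
     ih = (\<lambda>n. k_mult F 1 n (rho F (hneg F \<one>\<^bsub>F\<^esub>))),
     imult = k_mult F\<rparr>"

definition k_map :: "'a hyper \<Rightarrow> 'b hyper \<Rightarrow> ('a \<Rightarrow> 'b) \<Rightarrow> nat \<Rightarrow> 'a kelt \<Rightarrow> 'b kelt" where
  "k_map F L f = (\<lambda>n. \<lambda>X\<in>carrier (reduced_K F n).
     k_class L n (frag_extend (\<lambda>as. frag_of (map f as)) (k_rep F n X)))"


section \<open>The functor \<open>\<Gamma>\<close>\<close>

text \<open>The isomorphism \<open>e\<^sub>R\<close> onto a multiplicatively written copy \<open>G(R)\<close> of \<open>R\<^sub>1\<close>, with inverse
  \<open>l\<^sub>R\<close>, is fixed to be the constructor \<open>e_of\<close>, with selector \<open>l_of\<close>; \<open>GZero\<close> is the adjoined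
  zero.\<close>

datatype 'a gamma = GZero | e_of (l_of: 'a)

definition G_set :: "'a igr \<Rightarrow> 'a gamma set" where
  "G_set R = e_of ` carrier (igrp R 1)"

definition G_mult :: "'a igr \<Rightarrow> 'a gamma \<Rightarrow> 'a gamma \<Rightarrow> 'a gamma" where
  "G_mult R a b =
     (if a = GZero \<or> b = GZero then GZero else e_of (l_of a \<otimes>\<^bsub>igrp R 1\<^esub> l_of b))"

definition G_neg :: "'a igr \<Rightarrow> 'a gamma \<Rightarrow> 'a gamma" where
  "G_neg R a = G_mult R (e_of (itop R 1)) a"

definition G_add :: "'a igr \<Rightarrow> 'a gamma \<Rightarrow> 'a gamma \<Rightarrow> 'a gamma set" where
  "G_add R a b =
     (if a = GZero then {b} else if b = GZero then {a}
      else if a = G_neg R b then insert GZero (G_set R)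
      else {c \<in> G_set R. \<exists>d\<in>G_set R. G_mult R a b = G_mult R c d \<and>
              imult R 1 1 (l_of a) (l_of b) = imult R 1 1 (l_of c) (l_of d)})"

definition Gamma :: "'a igr \<Rightarrow> 'a gamma hyper" where
  "Gamma R =
    \<lparr>carrier = insert GZero (G_set R),
     monoid.mult = G_mult R,
     one = e_of \<one>\<^bsub>igrp R 1\<^esub>,
     hzero = GZero,
     hneg = G_neg R,
     hadd = G_add R\<rparr>"

definition Gamma_map ::
    "'a igr \<Rightarrow> (nat \<Rightarrow> 'a \<Rightarrow> 'b) \<Rightarrow> 'a gamma \<Rightarrow> 'b gamma" where
  "Gamma_map R f =
     (\<lambda>x\<in>carrier (Gamma R). case x of GZero \<Rightarrow> GZero | e_of a \<Rightarrow> e_of (f 1 a))"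


section \<open>The unit and the transposition of morphisms\<close>

definition phi :: "'a hyper \<Rightarrow> 'a \<Rightarrow> 'a kelt gamma" where
  "phi F = (\<lambda>x\<in>carrier F. if x = hzero F then GZero else e_of (rho F x))"

text \<open>The transpose \<open>\<Gamma>(g) \<circ> \<phi>\<^sub>F : F \<rightarrow> \<Gamma>(R)\<close> of \<open>g : k(F) \<rightarrow> R\<close>.\<close>

definition transpose_mor :: "'a hyper \<Rightarrow> (nat \<Rightarrow> 'a kelt \<Rightarrow> 'b) \<Rightarrow> 'a \<Rightarrow> 'b gamma" where
  "transpose_mor F g = compose (carrier F) (Gamma_map (k_obj F) g) (phi F)"

end

theory Submission
  imports Defs
begin

text \<open>
  A morphism out of \<open>k(F)\<close> is determined by its values on the generators \<open>\<rho>(a)\<close> of degree 1, and it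
  exists for prescribed values as soon as these are additive, send \<open>\<rho>(-1)\<close> to \<open>\<top>\<^sub>1\<close>, and make the product
  for \<open>a\<close> and \<open>b\<close> vanish whenever \<open>b \<in> 1 - a\<close>: this is the presentation of \<open>k(F)\<close> by generators and
  relations. On the other side, in \<open>\<Gamma>(R)\<close> one has \<open>e(y) \<in> 1 - e(x)\<close> exactly when the product of \<open>x\<close> and \<open>y\<close>
  is zero in \<open>R\<^sub>2\<close>. So a hyperfield morphism \<open>F \<rightarrow> \<Gamma>(R)\<close> prescribes values of the required kind, and
  conversely such values give a morphism. This is the adjunction, and its unit is \<open>a \<mapsto> e(\<rho>(a))\<close>.

  Several points carry the work.

  First, an object of \<open>Igr\<close> is given by its direct sum being a commutative ring, whereas all arguments use
  homogeneous elements. The locale \<open>graded_products\<close> states the ring axioms degree by degree;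
  \<open>igr_ring_cring\<close> and \<open>igr.graded_products\<close> show the equivalence, and \<open>hom_igr_iff\<close> does the same for
  morphisms. Passing from the ring to its homogeneous parts requires that products with zero vanish in
  each bidegree separately, which the ring alone does not give and which is obtained from the compatibility
  of the maps \<open>h\<close> with products.

  Second, \<open>k\<^sub>nF\<close> is a threefold quotient of a free group. The facts \<open>symbol_mult\<close>, \<open>symbol_steinberg\<close>,
  \<open>k_exponent_two\<close>, \<open>k_universal\<close> and \<open>k_induct\<close> replace that construction by a presentation in terms of the
  symbols \<open>{a\<^sub>1, \<dots>, a\<^sub>n}\<close>. Commutativity of \<open>k(F)\<close> (\<open>k_mult_comm\<close>) comes from Milnor's computation: expand
  \<open>{ab, -ab} = 0\<close> using \<open>{a, -a} = 0\<close>, which holds since \<open>-a \<in> 1 - a\<close> in a pre-special hyperfield.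

  Third, in \<open>\<Gamma>(R)\<close> the sum \<open>e(a) + e(b)\<close> contains \<open>e(c)\<close> exactly when \<open>ab = c(a + b + \<top>\<^sub>1)\<close> in \<open>R\<^sub>2\<close>
  (\<open>e_of_in_G_add_iff\<close>). This one equation covers the case \<open>e(a) = -e(b)\<close> as well. With it, the
  axioms in \<open>pre_special_up_to_assoc\<close>, the functoriality of \<open>\<Gamma>\<close> and the morphism property of the unit become
  identities between products in characteristic 2. For the unit one rewrites \<open>z \<in> x + y\<close> as \<open>zx \<in> 1 - (-xy)\<close>, so that
  the Steinberg relation gives \<open>(\<top>\<^sub>1 + \<rho>(x) + \<rho>(y)) (\<rho>(z) + \<rho>(x)) = 0\<close>.

  The morphism \<open>k(F) \<rightarrow> R\<close> with given transpose \<open>u : F \<rightarrow> \<Gamma>(R)\<close> is constructed in \<open>lift_exists\<close> and is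
  unique by \<open>hom_igr_eqI\<close>. The same two facts give functoriality of \<open>k\<close>: the map \<open>k(u)\<close> is the morphism with
  transpose \<open>\<phi>\<^sub>L \<circ> u\<close>, and equalities between morphisms out of \<open>k(F)\<close> need to be checked on the elements \<open>\<rho>(a)\<close> only.
\<close>

section \<open>Graded products\<close>

lemma (in comm_monoid) finprod_eq_single:
  assumes "finite A" "i \<in> A" "f i \<in> carrier G" "\<And>j. j \<in> A \<Longrightarrow> j \<noteq> i \<Longrightarrow> f j = \<one>"
  shows "finprod G f A = f i"
proof -
  have "finprod G f A = finprod G (\<lambda>j. if i = j then f i else \<one>) A"
    using assms by (intro finprod_cong') auto
  then show ?thesis using assms finprod_singleton[of i A "\<lambda>_. f i"] by simp
qed

text \<open>Both sides run over the pairs \<open>(i, j)\<close> with \<open>i + j \<le> n\<close>, on the left grouped by their sum.\<close>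

lemma (in comm_monoid) finprod_triangle:
  fixes f :: "nat \<Rightarrow> nat \<Rightarrow> 'a"
  assumes "\<And>i j. i + j \<le> n \<Longrightarrow> f i j \<in> carrier G"
  shows "finprod G (\<lambda>m. finprod G (\<lambda>i. f i (m - i)) {..m}) {..n}
    = finprod G (\<lambda>i. finprod G (f i) {..n - i}) {..n}"
  using assms
proof (induction n)
  case 0
  then show ?case by (simp add: Pi_def)
next
  case (Suc n)
  have f: "f i j \<in> carrier G" if "i + j \<le> Suc n" for i j
    using that by (rule Suc.prems)
  have "finprod G (\<lambda>i. finprod G (f i) {..Suc n - i}) {..Suc n}
    = f (Suc n) 0 \<otimes> finprod G (\<lambda>i. f i (Suc n - i) \<otimes> finprod G (f i) {..n - i}) {..n}"
  proof -
    have "finprod G (\<lambda>i. finprod G (f i) {..Suc n - i}) {..n}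
      = finprod G (\<lambda>i. f i (Suc n - i) \<otimes> finprod G (f i) {..n - i}) {..n}"
      by (rule finprod_cong') (auto simp: Suc_diff_le f Pi_def)
    then show ?thesis by (simp add: f Pi_def)
  qed
  also have "\<dots> = f (Suc n) 0 \<otimes> (finprod G (\<lambda>i. f i (Suc n - i)) {..n}
      \<otimes> finprod G (\<lambda>i. finprod G (f i) {..n - i}) {..n})"
    by (subst finprod_multf) (auto simp: f Pi_def)
  also have "\<dots> = finprod G (\<lambda>i. f i (Suc n - i)) {..Suc n}
      \<otimes> finprod G (\<lambda>i. finprod G (f i) {..n - i}) {..n}"
    by (simp add: f Pi_def m_assoc)
  also have "\<dots> = finprod G (\<lambda>m. finprod G (\<lambda>i. f i (m - i)) {..m}) {..Suc n}"
    using Suc.IH by (simp add: f Pi_def)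
  finally show ?case by simp
qed

text \<open>The homogeneous form of the statement that the direct sum is a commutative ring. Additivity is required in the
  second factor only; in the first factor it follows by commutativity.\<close>

locale graded_products =
  fixes R :: "'a igr"
  assumes grp: "comm_group (igrp R n)"
    and one_closed: "itop R 0 \<in> carrier (igrp R 0)"
    and mult_hom: "x \<in> carrier (igrp R n) \<Longrightarrow> imult R n m x \<in> hom (igrp R m) (igrp R (n + m))"
    and mult_assoc: "\<lbrakk>x \<in> carrier (igrp R n); y \<in> carrier (igrp R m); z \<in> carrier (igrp R p)\<rbrakk>
      \<Longrightarrow> imult R (n + m) p (imult R n m x y) z = imult R n (m + p) x (imult R m p y z)"
    and mult_comm: "\<lbrakk>x \<in> carrier (igrp R n); y \<in> carrier (igrp R m)\<rbrakk>
      \<Longrightarrow> imult R n m x y = imult R m n y x"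
    and mult_one: "x \<in> carrier (igrp R n) \<Longrightarrow> imult R 0 n (itop R 0) x = x"
begin

lemma is_group [simp]: "group (igrp R n)"
  and is_comm_monoid [simp]: "comm_monoid (igrp R n)"
  and is_monoid [simp]: "monoid (igrp R n)"
  using grp[of n] by (auto simp: comm_group_def group.is_monoid)

lemma one_in [simp]: "\<one>\<^bsub>igrp R n\<^esub> \<in> carrier (igrp R n)"
  by (simp add: monoid.one_closed)

lemma add_in [simp]: "\<lbrakk>x \<in> carrier (igrp R n); y \<in> carrier (igrp R n)\<rbrakk>
    \<Longrightarrow> x \<otimes>\<^bsub>igrp R n\<^esub> y \<in> carrier (igrp R n)"
  by (simp add: monoid.m_closed)

lemma mult_in [simp]: "\<lbrakk>x \<in> carrier (igrp R n); y \<in> carrier (igrp R m)\<rbrakk>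
    \<Longrightarrow> imult R n m x y \<in> carrier (igrp R (n + m))"
  using mult_hom[of x n m] by (auto simp: hom_def)

lemma distrib_left:
  assumes "x \<in> carrier (igrp R n)" "y \<in> carrier (igrp R m)" "z \<in> carrier (igrp R m)"
  shows "imult R n m x (y \<otimes>\<^bsub>igrp R m\<^esub> z) = imult R n m x y \<otimes>\<^bsub>igrp R (n + m)\<^esub> imult R n m x z"
  using mult_hom[of x n m] assms by (auto simp: hom_def)

lemma distrib_right:
  assumes "x \<in> carrier (igrp R n)" "y \<in> carrier (igrp R n)" "z \<in> carrier (igrp R m)"
  shows "imult R n m (x \<otimes>\<^bsub>igrp R n\<^esub> y) z = imult R n m x z \<otimes>\<^bsub>igrp R (n + m)\<^esub> imult R n m y z"
  using distrib_left[of z m x n y] assms by (simp add: mult_comm[of _ n z m] add.commute)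

lemma mult_hom_left:
  "z \<in> carrier (igrp R m) \<Longrightarrow> (\<lambda>x. imult R n m x z) \<in> hom (igrp R n) (igrp R (n + m))"
  by (auto simp: hom_def distrib_right)

lemma mult_zero [simp]: "x \<in> carrier (igrp R n) \<Longrightarrow> imult R n m x \<one>\<^bsub>igrp R m\<^esub> = \<one>\<^bsub>igrp R (n + m)\<^esub>"
  using hom_one[OF mult_hom[of x n m]] by simp

lemma zero_mult [simp]: "x \<in> carrier (igrp R m) \<Longrightarrow> imult R n m \<one>\<^bsub>igrp R n\<^esub> x = \<one>\<^bsub>igrp R (n + m)\<^esub>"
  by (simp add: mult_comm[of _ n x m] add.commute)

lemma mult_one_right [simp]: "x \<in> carrier (igrp R n) \<Longrightarrow> imult R n 0 x (itop R 0) = x"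
  by (simp add: mult_comm[of x n] mult_one one_closed)

lemma carrier_ring: "x \<in> carrier (igr_ring R) \<longleftrightarrow>
    (\<forall>n. x n \<in> carrier (igrp R n)) \<and> finite {n. x n \<noteq> \<one>\<^bsub>igrp R n\<^esub>}"
  by (simp add: igr_ring_def carrier_sum_group PiE_iff)

lemma mult_finprod:
  assumes "finite A" "x \<in> carrier (igrp R n)" "f \<in> A \<rightarrow> carrier (igrp R m)"
  shows "imult R n m x (finprod (igrp R m) f A) = finprod (igrp R (n + m)) (\<lambda>i. imult R n m x (f i)) A"
  using assms
proof (induction A rule: finite_induct)
  case empty
  interpret M: comm_monoid "igrp R m" by simp
  interpret N: comm_monoid "igrp R (n + m)" by simp
  show ?case using empty by simp
next
  case (insert a A)
  interpret M: comm_monoid "igrp R m" by simp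
  interpret N: comm_monoid "igrp R (n + m)" by simp
  show ?case using insert by (simp add: Pi_def distrib_left)
qed

lemma finprod_mult:
  assumes "finite A" "x \<in> carrier (igrp R n)" "f \<in> A \<rightarrow> carrier (igrp R m)"
  shows "imult R m n (finprod (igrp R m) f A) x = finprod (igrp R (m + n)) (\<lambda>i. imult R m n (f i) x) A"
proof -
  interpret M: comm_monoid "igrp R m" by simp
  interpret N: comm_monoid "igrp R (m + n)" by simp
  have "imult R m n (finprod (igrp R m) f A) x = imult R n m x (finprod (igrp R m) f A)"
    using assms by (intro mult_comm) auto
  also have "\<dots> = finprod (igrp R (m + n)) (\<lambda>i. imult R n m x (f i)) A"
    using mult_finprod[OF assms] by (simp add: add.commute)
  also have "\<dots> = finprod (igrp R (m + n)) (\<lambda>i. imult R m n (f i) x) A"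
    using assms by (intro N.finprod_cong') (auto simp: mult_comm[of x n] Pi_def)
  finally show ?thesis .
qed

text \<open>Degree \<open>n\<close> of the associative law: multiplied out, the two sides are the two ways to sum the triple
  products over the triangle of \<open>finprod_triangle\<close>.\<close>

lemma conv_assoc:
  assumes R: "\<And>i. a i \<in> carrier (igrp R i)" "\<And>i. b i \<in> carrier (igrp R i)" "\<And>i. c i \<in> carrier (igrp R i)"
  shows "finprod (igrp R n) (\<lambda>m. imult R m (n - m)
       (finprod (igrp R m) (\<lambda>i. imult R i (m - i) (a i) (b (m - i))) {..m}) (c (n - m))) {..n}
    = finprod (igrp R n) (\<lambda>i. imult R i (n - i) (a i)
       (finprod (igrp R (n - i)) (\<lambda>j. imult R j (n - i - j) (b j) (c (n - i - j))) {..n - i})) {..n}"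
    (is "finprod _ ?L _ = finprod _ ?R _")
proof -
  interpret N: comm_monoid "igrp R n" by simp
  have C: "imult R i j x y \<in> carrier (igrp R m)"
    if "i + j = m" "x \<in> carrier (igrp R i)" "y \<in> carrier (igrp R j)" for x y i j m
    using that mult_in by blast
  let ?t = "\<lambda>i j. imult R i (n - i) (a i) (imult R j (n - i - j) (b j) (c (n - i - j)))"
  have t: "?t i j \<in> carrier (igrp R n)" if "i + j \<le> n" for i j
    using that R by (intro C) auto
  have L: "?L m = finprod (igrp R n) (\<lambda>i. ?t i (m - i)) {..m}" if "m \<le> n" for m
  proof -
    have "?L m = finprod (igrp R (m + (n - m)))
        (\<lambda>i. imult R m (n - m) (imult R i (m - i) (a i) (b (m - i))) (c (n - m))) {..m}"
      using R by (intro finprod_mult) (auto intro!: C)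
    also have "\<dots> = finprod (igrp R n)
        (\<lambda>i. imult R m (n - m) (imult R i (m - i) (a i) (b (m - i))) (c (n - m))) {..m}"
      using that by simp
    also have "\<dots> = finprod (igrp R n) (\<lambda>i. ?t i (m - i)) {..m}"
    proof (rule N.finprod_cong')
      fix i assume "i \<in> {..m}"
      then show "imult R m (n - m) (imult R i (m - i) (a i) (b (m - i))) (c (n - m)) = ?t i (m - i)"
        using that mult_assoc[OF R(1)[of i] R(2)[of "m - i"] R(3)[of "n - m"]] by simp
    next
      show "(\<lambda>i. ?t i (m - i)) \<in> {..m} \<rightarrow> carrier (igrp R n)"
        using that by (intro funcsetI t) simp
    qed simp
    finally show ?thesis .
  qed
  have R: "?R i = finprod (igrp R n) (?t i) {..n - i}" if "i \<le> n" for i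
  proof -
    have "?R i = finprod (igrp R (i + (n - i))) (?t i) {..n - i}"
      using R by (intro mult_finprod) (auto intro!: C)
    then show ?thesis using that by simp
  qed
  have "finprod (igrp R n) ?L {..n} = finprod (igrp R n) (\<lambda>m. finprod (igrp R n) (\<lambda>i. ?t i (m - i)) {..m}) {..n}"
    by (rule N.finprod_cong') (auto simp: L simp del: diff_diff_left intro!: N.finprod_closed t)
  also have "\<dots> = finprod (igrp R n) (\<lambda>i. finprod (igrp R n) (?t i) {..n - i}) {..n}"
    by (rule N.finprod_triangle) (rule t)
  also have "\<dots> = finprod (igrp R n) ?R {..n}"
  proof (rule N.finprod_cong')
    have "finprod (igrp R n) (?t i) {..n - i} \<in> carrier (igrp R n)" if "i \<le> n" for i
      by (intro N.finprod_closed funcsetI t) (use that in auto)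
    then show "?R \<in> {..n} \<rightarrow> carrier (igrp R n)" by (simp add: R Pi_iff del: diff_diff_left)
  qed (simp_all add: R del: diff_diff_left)
  finally show ?thesis .
qed

lemma igr_ring_cring: "cring (igr_ring R)"
proof -
  interpret S: group "sum_group UNIV (igrp R)" by simp
  interpret N: comm_monoid "igrp R n" for n by simp
  have C: "imult R i j x y \<in> carrier (igrp R m)"
    if "i + j = m" "x \<in> carrier (igrp R i)" "y \<in> carrier (igrp R j)" for x y i j m
    using that mult_in by blast
  have carrier: "carrier (igr_ring R) = carrier (sum_group UNIV (igrp R))"
    and plus: "x \<oplus>\<^bsub>igr_ring R\<^esub> y = x \<otimes>\<^bsub>sum_group UNIV (igrp R)\<^esub> y"
    and zero: "\<zero>\<^bsub>igr_ring R\<^esub> = \<one>\<^bsub>sum_group UNIV (igrp R)\<^esub>"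
    and times: "x \<otimes>\<^bsub>igr_ring R\<^esub> y
      = (\<lambda>n. finprod (igrp R n) (\<lambda>i. imult R i (n - i) (x i) (y (n - i))) {..n})"
    and one: "\<one>\<^bsub>igr_ring R\<^esub> = (\<lambda>n. if n = 0 then itop R 0 else \<one>\<^bsub>igrp R n\<^esub>)" for x y
    by (simp_all add: igr_ring_def)
  have closed: "x \<otimes>\<^bsub>igr_ring R\<^esub> y \<in> carrier (igr_ring R)"
    if x: "x \<in> carrier (igr_ring R)" and y: "y \<in> carrier (igr_ring R)" for x y
  proof -
    let ?X = "{n. x n \<noteq> \<one>\<^bsub>igrp R n\<^esub>}" and ?Y = "{n. y n \<noteq> \<one>\<^bsub>igrp R n\<^esub>}"
    have "(x \<otimes>\<^bsub>igr_ring R\<^esub> y) n = \<one>\<^bsub>igrp R n\<^esub>" if "n \<notin> (\<lambda>(i, j). i + j) ` (?X \<times> ?Y)" for n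
      unfolding times
    proof (rule N.finprod_one_eqI)
      fix i assume "i \<in> {..n}"
      then have "i \<notin> ?X \<or> n - i \<notin> ?Y" using that by force
      then show "imult R i (n - i) (x i) (y (n - i)) = \<one>\<^bsub>igrp R n\<^esub>"
        using x y \<open>i \<in> {..n}\<close> by (auto simp: carrier_ring)
    qed
    then have "{n. (x \<otimes>\<^bsub>igr_ring R\<^esub> y) n \<noteq> \<one>\<^bsub>igrp R n\<^esub>} \<subseteq> (\<lambda>(i, j). i + j) ` (?X \<times> ?Y)" by blast
    moreover have "finite ((\<lambda>(i, j). i + j) ` (?X \<times> ?Y))" using x y by (simp add: carrier_ring)
    ultimately show ?thesis
      using x y by (auto simp: carrier_ring times intro!: N.finprod_closed C dest: finite_subset)
  qed
  show ?thesis
  proof (rule cringI)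
    show "abelian_group (igr_ring R)"
    proof (rule abelian_groupI)
      fix x y assume "x \<in> carrier (igr_ring R)" "y \<in> carrier (igr_ring R)"
      then show "x \<oplus>\<^bsub>igr_ring R\<^esub> y = y \<oplus>\<^bsub>igr_ring R\<^esub> x"
        by (auto simp: plus carrier_ring intro!: restrict_ext N.m_comm)
    next
      fix x assume "x \<in> carrier (igr_ring R)"
      then show "\<exists>y\<in>carrier (igr_ring R). y \<oplus>\<^bsub>igr_ring R\<^esub> x = \<zero>\<^bsub>igr_ring R\<^esub>"
        using S.l_inv S.inv_closed unfolding carrier plus zero by blast
    qed (simp_all only: carrier plus zero S.m_closed S.m_assoc S.one_closed S.l_one)
    show "comm_monoid (igr_ring R)"
    proof (rule comm_monoidI)
      fix x y assume x: "x \<in> carrier (igr_ring R)" and y: "y \<in> carrier (igr_ring R)"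
      show "x \<otimes>\<^bsub>igr_ring R\<^esub> y \<in> carrier (igr_ring R)" using closed x y .
      show "x \<otimes>\<^bsub>igr_ring R\<^esub> y = y \<otimes>\<^bsub>igr_ring R\<^esub> x"
      proof
        fix n :: nat
        have im: "(\<lambda>i. n - i) ` {..n} = {..n}"
        proof (intro equalityI subsetI)
          fix i assume "i \<in> {..n}"
          then show "i \<in> (\<lambda>i. n - i) ` {..n}" by (intro image_eqI[of _ _ "n - i"]) auto
        qed auto
        have "finprod (igrp R n) (\<lambda>i. imult R i (n - i) (x i) (y (n - i))) {..n}
          = finprod (igrp R n) (\<lambda>i. imult R i (n - i) (x i) (y (n - i))) ((\<lambda>i. n - i) ` {..n})"
          by (simp only: im)
        also have "\<dots> = finprod (igrp R n) (\<lambda>i. imult R (n - i) (n - (n - i)) (x (n - i)) (y (n - (n - i)))) {..n}"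
          using x y by (intro N.finprod_reindex) (auto simp: carrier_ring inj_on_def intro!: C)
        also have "\<dots> = finprod (igrp R n) (\<lambda>i. imult R i (n - i) (y i) (x (n - i))) {..n}"
          using x y by (intro N.finprod_cong') (auto simp: carrier_ring mult_comm[of "x _"] intro!: C)
        finally show "(x \<otimes>\<^bsub>igr_ring R\<^esub> y) n = (y \<otimes>\<^bsub>igr_ring R\<^esub> x) n" by (simp add: times)
      qed
    next
      show "\<one>\<^bsub>igr_ring R\<^esub> \<in> carrier (igr_ring R)" by (simp add: carrier_ring one one_closed)
    next
      fix x y z
      assume "x \<in> carrier (igr_ring R)" "y \<in> carrier (igr_ring R)" "z \<in> carrier (igr_ring R)"
      then show "x \<otimes>\<^bsub>igr_ring R\<^esub> y \<otimes>\<^bsub>igr_ring R\<^esub> z = x \<otimes>\<^bsub>igr_ring R\<^esub> (y \<otimes>\<^bsub>igr_ring R\<^esub> z)"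
        unfolding times using conv_assoc[of x y z] by (simp add: carrier_ring)
    next
      fix x assume x: "x \<in> carrier (igr_ring R)"
      show "\<one>\<^bsub>igr_ring R\<^esub> \<otimes>\<^bsub>igr_ring R\<^esub> x = x"
      proof
        fix n
        show "(\<one>\<^bsub>igr_ring R\<^esub> \<otimes>\<^bsub>igr_ring R\<^esub> x) n = x n"
          unfolding times one using x
          by (subst N.finprod_eq_single[of _ 0]) (auto simp: carrier_ring mult_one)
      qed
    qed
    fix x y z
    assume "x \<in> carrier (igr_ring R)" "y \<in> carrier (igr_ring R)" "z \<in> carrier (igr_ring R)"
    then have xyz: "x i \<in> carrier (igrp R i)" "y i \<in> carrier (igrp R i)" "z i \<in> carrier (igrp R i)" for i
      by (auto simp: carrier_ring)
    show "(x \<oplus>\<^bsub>igr_ring R\<^esub> y) \<otimes>\<^bsub>igr_ring R\<^esub> z = x \<otimes>\<^bsub>igr_ring R\<^esub> z \<oplus>\<^bsub>igr_ring R\<^esub> y \<otimes>\<^bsub>igr_ring R\<^esub> z"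
    proof
      fix n
      have "finprod (igrp R n) (\<lambda>i. imult R i (n - i) (x i \<otimes>\<^bsub>igrp R i\<^esub> y i) (z (n - i))) {..n}
        = finprod (igrp R n) (\<lambda>i. imult R i (n - i) (x i) (z (n - i)) \<otimes>\<^bsub>igrp R n\<^esub> imult R i (n - i) (y i) (z (n - i))) {..n}"
        using xyz by (intro N.finprod_cong') (auto simp: distrib_right intro!: C)
      also have "\<dots> = finprod (igrp R n) (\<lambda>i. imult R i (n - i) (x i) (z (n - i))) {..n}
          \<otimes>\<^bsub>igrp R n\<^esub> finprod (igrp R n) (\<lambda>i. imult R i (n - i) (y i) (z (n - i))) {..n}"
        using xyz by (intro N.finprod_multf) (auto intro!: C)
      finally show "((x \<oplus>\<^bsub>igr_ring R\<^esub> y) \<otimes>\<^bsub>igr_ring R\<^esub> z) n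
          = (x \<otimes>\<^bsub>igr_ring R\<^esub> z \<oplus>\<^bsub>igr_ring R\<^esub> y \<otimes>\<^bsub>igr_ring R\<^esub> z) n"
        by (simp add: plus times)
    qed
  qed
qed

lemma iprod_in: "set as \<subseteq> carrier (igrp R 1) \<Longrightarrow> iprod R as \<in> carrier (igrp R (length as))"
proof (induction as)
  case (Cons a as)
  then show ?case using mult_in[of a 1 "iprod R as" "length as"] by simp
qed (simp add: one_closed)

lemma iprod_append:
  assumes "set as \<subseteq> carrier (igrp R 1)" "set bs \<subseteq> carrier (igrp R 1)"
  shows "iprod R (as @ bs) = imult R (length as) (length bs) (iprod R as) (iprod R bs)"
  using assms
proof (induction as)
  case Nil
  then show ?case using mult_one[OF iprod_in] by simp
next
  case (Cons a as)
  then show ?case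
    using mult_assoc[of a 1 "iprod R as" "length as" "iprod R bs" "length bs"] iprod_in[of as] iprod_in[of bs] by simp
qed

text \<open>The next two facts say that words in degree 1 are multilinear, and vanish once two
  adjacent letters have product zero; these are the relations of the reduced K-groups.\<close>

lemma iprod_add:
  assumes "set us \<subseteq> carrier (igrp R 1)" "set vs \<subseteq> carrier (igrp R 1)"
    and "x \<in> carrier (igrp R 1)" "y \<in> carrier (igrp R 1)" "n = length us + 1 + length vs"
  shows "iprod R (us @ (x \<otimes>\<^bsub>igrp R 1\<^esub> y) # vs)
    = iprod R (us @ x # vs) \<otimes>\<^bsub>igrp R n\<^esub> iprod R (us @ y # vs)"
proof -
  have x: "imult R 1 (length vs) z (iprod R vs) \<in> carrier (igrp R (1 + length vs))"
    if "z \<in> carrier (igrp R 1)" for z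
    using that mult_in iprod_in[OF assms(2)] by blast
  have "iprod R ((x \<otimes>\<^bsub>igrp R 1\<^esub> y) # vs)
      = imult R 1 (length vs) x (iprod R vs) \<otimes>\<^bsub>igrp R (1 + length vs)\<^esub> imult R 1 (length vs) y (iprod R vs)"
    using assms distrib_right[of x 1 y "iprod R vs" "length vs"] iprod_in[of vs] by simp
  then show ?thesis
    using assms iprod_append[of us "z # vs" for z] iprod_in[of us] x
      distrib_left[of "iprod R us" "length us" "imult R 1 (length vs) x (iprod R vs)" "1 + length vs"
        "imult R 1 (length vs) y (iprod R vs)"]
    by (simp add: add.assoc)
qed

lemma iprod_eq_zero:
  assumes "set us \<subseteq> carrier (igrp R 1)" "set vs \<subseteq> carrier (igrp R 1)"
    and "x \<in> carrier (igrp R 1)" "y \<in> carrier (igrp R 1)" "imult R 1 1 x y = \<one>\<^bsub>igrp R 2\<^esub>"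
    and "n = length us + 2 + length vs"
  shows "iprod R (us @ x # y # vs) = \<one>\<^bsub>igrp R n\<^esub>"
proof -
  have "iprod R [x, y] = \<one>\<^bsub>igrp R 2\<^esub>" using assms by simp
  then have "iprod R ([x, y] @ vs) = \<one>\<^bsub>igrp R (2 + length vs)\<^esub>"
    using iprod_append[of "[x, y]" vs] assms zero_mult[of "iprod R vs" "length vs" 2] iprod_in[of vs]
    by (simp add: numeral_2_eq_2)
  then show ?thesis
    using iprod_append[of us "[x, y] @ vs"] iprod_in[of us] mult_zero[of "iprod R us" "length us" "2 + length vs"] assms
    by (simp add: numeral_2_eq_2 add.assoc)
qed

end

text \<open>The element of the direct sum concentrated in degree \<open>n\<close>.\<close>

definition homog :: "'a igr \<Rightarrow> nat \<Rightarrow> 'a \<Rightarrow> nat \<Rightarrow> 'a" where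
  "homog R n x = (\<lambda>i. if i = n then x else \<one>\<^bsub>igrp R i\<^esub>)"

lemma homog_same [simp]: "homog R n x n = x"
  by (simp add: homog_def)

lemma homog_in:
  assumes "\<And>n. group (igrp R n)" "x \<in> carrier (igrp R n)"
  shows "homog R n x \<in> carrier (igr_ring R)"
proof -
  have "{i. homog R n x i \<noteq> \<one>\<^bsub>igrp R i\<^esub>} \<subseteq> {n}" by (auto simp: homog_def)
  then have "finite {i. homog R n x i \<noteq> \<one>\<^bsub>igrp R i\<^esub>}" by (rule finite_subset) simp
  then show ?thesis
    using assms by (auto simp: igr_ring_def carrier_sum_group homog_def group.is_monoid monoid.one_closed)
qed

text \<open>The product in the direct sum is a convolution, so it contains summands with a zero factor. They have
  to be known to vanish before the product of homogeneous elements is homogeneous; this is why absorption by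
  zero appears as a hypothesis, to be supplied in two different situations.\<close>

lemma homog_mult_of_zero_absorbing:
  assumes grp: "\<And>n. comm_monoid (igrp R n)"
    and closed: "\<And>n m x y. \<lbrakk>x \<in> carrier (igrp R n); y \<in> carrier (igrp R m)\<rbrakk>
      \<Longrightarrow> imult R n m x y \<in> carrier (igrp R (n + m))"
    and zero_left: "\<And>n m y. y \<in> carrier (igrp R m) \<Longrightarrow> imult R n m \<one>\<^bsub>igrp R n\<^esub> y = \<one>\<^bsub>igrp R (n + m)\<^esub>"
    and zero_right: "\<And>n m x. x \<in> carrier (igrp R n) \<Longrightarrow> imult R n m x \<one>\<^bsub>igrp R m\<^esub> = \<one>\<^bsub>igrp R (n + m)\<^esub>"
    and x: "x \<in> carrier (igrp R n)" and y: "y \<in> carrier (igrp R m)"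
  shows "homog R n x \<otimes>\<^bsub>igr_ring R\<^esub> homog R m y = homog R (n + m) (imult R n m x y)"
proof
  fix k
  interpret N: comm_monoid "igrp R k" for k by (rule grp)
  let ?f = "\<lambda>i. imult R i (k - i) (homog R n x i) (homog R m y (k - i))"
  have f: "?f i = \<one>\<^bsub>igrp R k\<^esub>" if "i \<le> k" "i \<noteq> n \<or> k \<noteq> n + m" for i
    using that x y zero_left[of _ "k - i" i] zero_right[of _ i "k - i"] by (auto simp: homog_def)
  have "finprod (igrp R k) ?f {..k} = homog R (n + m) (imult R n m x y) k"
  proof (cases "k = n + m")
    case True
    with f have "finprod (igrp R k) ?f {..k} = ?f n"
      using closed[OF x y] by (intro N.finprod_eq_single) auto
    with True show ?thesis by simp
  next
    case False
    with f show ?thesis by (subst N.finprod_one_eqI) (auto simp: homog_def)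
  qed
  then show "(homog R n x \<otimes>\<^bsub>igr_ring R\<^esub> homog R m y) k = homog R (n + m) (imult R n m x y) k"
    by (simp add: igr_ring_def)
qed

lemma (in graded_products) homog_mult:
  assumes "x \<in> carrier (igrp R n)" "y \<in> carrier (igrp R m)"
  shows "homog R n x \<otimes>\<^bsub>igr_ring R\<^esub> homog R m y = homog R (n + m) (imult R n m x y)"
  using assms by (intro homog_mult_of_zero_absorbing) auto

lemma (in igr) ih_iter_zero: "ih_iter R n d \<one>\<^bsub>igrp R n\<^esub> = \<one>\<^bsub>igrp R (n + d)\<^esub>"
proof (induction d)
  case (Suc d)
  have "group (igrp R k)" for k using grp by (simp add: comm_group_def)
  then show ?case using Suc hom_one[OF h_hom[of "n + d"]] by simp
qed simp

text \<open>The point is that zero absorbs in each bidegree. The ring law \<open>0 \<cdot> 0 = 0\<close> in degree 0 gives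
  \<open>0 * 0 = 0\<close> there, and the maps \<open>h\<close> transport this to all bidegrees. Then in \<open>0 \<cdot> y = 0\<close>, for \<open>y\<close>
  homogeneous, only one summand can be nonzero. All other laws are read off from the ring via \<open>homog\<close>.\<close>

lemma (in igr) graded_products: "graded_products R"
proof -
  interpret C: cring "igr_ring R" by (rule ring)
  interpret N: comm_group "igrp R n" for n by (rule grp)
  note in_ring = homog_in[OF N.is_group]
  have plus: "x \<oplus>\<^bsub>igr_ring R\<^esub> y = (\<lambda>n. x n \<otimes>\<^bsub>igrp R n\<^esub> y n)"
    and zero: "\<zero>\<^bsub>igr_ring R\<^esub> = (\<lambda>n. \<one>\<^bsub>igrp R n\<^esub>)"
    and times: "(x \<otimes>\<^bsub>igr_ring R\<^esub> y) n = finprod (igrp R n) (\<lambda>i. imult R i (n - i) (x i) (y (n - i))) {..n}"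
    and one: "\<one>\<^bsub>igr_ring R\<^esub> = homog R 0 (itop R 0)" for x y n
    by (auto simp: igr_ring_def homog_def)
  have "imult R 0 0 \<one>\<^bsub>igrp R 0\<^esub> \<one>\<^bsub>igrp R 0\<^esub> = \<one>\<^bsub>igrp R 0\<^esub>"
    using fun_cong[OF C.l_null[OF C.zero_closed], of 0] mult_closed[of _ 0 _ 0] by (simp add: times zero)
  then have zz: "imult R p q \<one>\<^bsub>igrp R p\<^esub> \<one>\<^bsub>igrp R q\<^esub> = \<one>\<^bsub>igrp R (p + q)\<^esub>" for p q
    using h_mult[of 0 p 0 q "\<one>\<^bsub>igrp R 0\<^esub>" "\<one>\<^bsub>igrp R 0\<^esub>"] ih_iter_zero[of 0] by simp
  have zero_left: "imult R n m \<one>\<^bsub>igrp R n\<^esub> y = \<one>\<^bsub>igrp R (n + m)\<^esub>" if "y \<in> carrier (igrp R m)" for n m y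
  proof -
    have "\<one>\<^bsub>igrp R (n + m)\<^esub> = (\<zero>\<^bsub>igr_ring R\<^esub> \<otimes>\<^bsub>igr_ring R\<^esub> homog R m y) (n + m)"
      using C.l_null[OF in_ring[OF that]] by (simp add: zero)
    also have "\<dots> = imult R n m \<one>\<^bsub>igrp R n\<^esub> y"
      unfolding times zero using mult_closed[of "\<one>\<^bsub>igrp R n\<^esub>" n y m] that zz[of _ "n + m - _"]
      by (subst N.finprod_eq_single[of _ n]) (auto simp: homog_def)
    finally show ?thesis by simp
  qed
  have zero_right: "imult R n m x \<one>\<^bsub>igrp R m\<^esub> = \<one>\<^bsub>igrp R (n + m)\<^esub>" if "x \<in> carrier (igrp R n)" for n m x
  proof -
    have "\<one>\<^bsub>igrp R (n + m)\<^esub> = (homog R n x \<otimes>\<^bsub>igr_ring R\<^esub> \<zero>\<^bsub>igr_ring R\<^esub>) (n + m)"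
      using C.r_null[OF in_ring[OF that]] by (simp add: zero)
    also have "\<dots> = imult R n m x \<one>\<^bsub>igrp R m\<^esub>"
      unfolding times zero using mult_closed[of x n "\<one>\<^bsub>igrp R m\<^esub>" m] that zz[of _ "n + m - _"]
      by (subst N.finprod_eq_single[of _ n]) (auto simp: homog_def)
    finally show ?thesis by simp
  qed
  have hm: "homog R n x \<otimes>\<^bsub>igr_ring R\<^esub> homog R m y = homog R (n + m) (imult R n m x y)"
    if "x \<in> carrier (igrp R n)" "y \<in> carrier (igrp R m)" for n m x y
    using that by (intro homog_mult_of_zero_absorbing N.comm_monoid_axioms mult_closed zero_left zero_right)
  have add: "homog R n x \<oplus>\<^bsub>igr_ring R\<^esub> homog R n y = homog R n (x \<otimes>\<^bsub>igrp R n\<^esub> y)" for n x y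
    by (auto simp: plus homog_def)
  have inj: "x = y" if "homog R n x = homog R n y" for n x y
    using fun_cong[OF that, of n] by simp
  show ?thesis
  proof
    fix n m p x y z
    assume x: "x \<in> carrier (igrp R n)"
    show "imult R n m x \<in> hom (igrp R m) (igrp R (n + m))"
    proof (rule homI)
      fix y z assume yz: "y \<in> carrier (igrp R m)" "z \<in> carrier (igrp R m)"
      show "imult R n m x (y \<otimes>\<^bsub>igrp R m\<^esub> z) = imult R n m x y \<otimes>\<^bsub>igrp R (n + m)\<^esub> imult R n m x z"
        using C.r_distr[OF in_ring[OF yz(1)] in_ring[OF yz(2)] in_ring[OF x]] x yz
        by (intro inj[of "n + m"]) (simp add: add hm)
    qed (rule mult_closed[OF x])
    show "imult R 0 n (itop R 0) x = x"
      using C.l_one[OF in_ring[OF x]] x hm[OF top_closed x] by (intro inj[of n]) (simp add: one)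
    assume y: "y \<in> carrier (igrp R m)"
    show "imult R n m x y = imult R m n y x"
      using C.m_comm[OF in_ring[OF x] in_ring[OF y]] x y
      by (intro inj[of "n + m"]) (simp add: hm add.commute)
    assume z: "z \<in> carrier (igrp R p)"
    show "imult R (n + m) p (imult R n m x y) z = imult R n (m + p) x (imult R m p y z)"
      using C.m_assoc[OF in_ring[OF x] in_ring[OF y] in_ring[OF z]] x y z
      by (intro inj[of "n + m + p"]) (simp add: hm mult_closed add.assoc)
  qed (rule grp top_closed)+
qed

lemma hom_finprod:
  assumes "comm_monoid G" "comm_group H" "group G" "h \<in> hom G H" "finite A" "f \<in> A \<rightarrow> carrier G"
  shows "h (finprod G f A) = finprod H (\<lambda>i. h (f i)) A"
proof -
  interpret G: comm_monoid G by fact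
  interpret H: comm_group H by fact
  note hc = hom_in_carrier[OF assms(4)]
  show ?thesis
    using assms(5,6)
  proof (induction A rule: finite_induct)
    case empty
    then show ?case using hom_one[OF assms(4,3)] by simp
  next
    case (insert a A)
    then have "h (finprod G f (insert a A)) = h (f a) \<otimes>\<^bsub>H\<^esub> h (finprod G f A)"
      using hom_mult[OF assms(4)] by (simp add: Pi_def)
    then show ?case using insert hc by (auto simp: Pi_def)
  qed
qed

text \<open>A family of additive maps is multiplicative on the direct sum if and only if it is multiplicative on
  homogeneous elements, since the convolution product is a sum of homogeneous products.\<close>

lemma hom_igr_iff:
  assumes "graded_products R" "graded_products S"
  shows "f \<in> hom_igr R S \<longleftrightarrow>
    (\<forall>n. f n \<in> hom (igrp R n) (igrp S n) \<inter> extensional (carrier (igrp R n)) \<and> f n (itop R n) = itop S n) \<and>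
    (\<forall>n m. \<forall>x\<in>carrier (igrp R n). \<forall>y\<in>carrier (igrp R m).
        f (n + m) (imult R n m x y) = imult S n m (f n x) (f m y))" (is "_ \<longleftrightarrow> ?D \<and> ?M")
proof -
  interpret R: graded_products R by fact
  interpret S: graded_products S by fact
  have "(\<lambda>x n. f n (x n)) \<in> ring_hom (igr_ring R) (igr_ring S) \<longleftrightarrow> ?M" if D: ?D
  proof -
    have f: "f n \<in> hom (igrp R n) (igrp S n)" for n using D by blast
    note f1 = hom_one[OF f R.is_group S.is_group]
    have fin: "f n x \<in> carrier (igrp S n)" if "x \<in> carrier (igrp R n)" for n x
      using f that by (auto simp: hom_def)
    show ?thesis
    proof
      assume ring: "(\<lambda>x n. f n (x n)) \<in> ring_hom (igr_ring R) (igr_ring S)"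
      show ?M
      proof (intro allI ballI)
        fix n m x y assume x: "x \<in> carrier (igrp R n)" and y: "y \<in> carrier (igrp R m)"
        have fh: "(\<lambda>i. f i (homog R n x i)) = homog S n (f n x)" for n x
          by (auto simp: homog_def f1)
        have "(\<lambda>i. f i ((homog R n x \<otimes>\<^bsub>igr_ring R\<^esub> homog R m y) i))
          = (\<lambda>i. f i (homog R n x i)) \<otimes>\<^bsub>igr_ring S\<^esub> (\<lambda>i. f i (homog R m y i))"
          using ring_hom_mult[OF ring homog_in[OF R.is_group x] homog_in[OF R.is_group y]] .
        then have "homog S (n + m) (f (n + m) (imult R n m x y)) = homog S (n + m) (imult S n m (f n x) (f m y))"
          using x y by (simp add: fh R.homog_mult S.homog_mult fin)
        then show "f (n + m) (imult R n m x y) = imult S n m (f n x) (f m y)"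
          by (metis homog_same)
      qed
    next
      assume M: ?M
      show "(\<lambda>x n. f n (x n)) \<in> ring_hom (igr_ring R) (igr_ring S)"
      proof (rule ring_hom_memI)
        fix x assume x: "x \<in> carrier (igr_ring R)"
        have "{n. f n (x n) \<noteq> \<one>\<^bsub>igrp S n\<^esub>} \<subseteq> {n. x n \<noteq> \<one>\<^bsub>igrp R n\<^esub>}" using f1 by auto
        then show "(\<lambda>n. f n (x n)) \<in> carrier (igr_ring S)"
          using x fin by (auto simp: R.carrier_ring S.carrier_ring dest: finite_subset)
        fix y assume y: "y \<in> carrier (igr_ring R)"
        show "(\<lambda>n. f n ((x \<oplus>\<^bsub>igr_ring R\<^esub> y) n)) = (\<lambda>n. f n (x n)) \<oplus>\<^bsub>igr_ring S\<^esub> (\<lambda>n. f n (y n))"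
          using x y f by (auto simp: igr_ring_def[of R] igr_ring_def[of S] carrier_sum_group PiE_iff hom_mult)
        show "(\<lambda>n. f n ((x \<otimes>\<^bsub>igr_ring R\<^esub> y) n)) = (\<lambda>n. f n (x n)) \<otimes>\<^bsub>igr_ring S\<^esub> (\<lambda>n. f n (y n))"
        proof
          fix n
          interpret Sn: comm_monoid "igrp S n" by simp
          have mem: "(\<lambda>i. imult R i (n - i) (x i) (y (n - i))) \<in> {..n} \<rightarrow> carrier (igrp R n)"
          proof
            fix i assume "i \<in> {..n}"
            then show "imult R i (n - i) (x i) (y (n - i)) \<in> carrier (igrp R n)"
              using x y R.mult_in[of "x i" i "y (n - i)" "n - i"] by (simp add: R.carrier_ring)
          qed
          have "f n (finprod (igrp R n) (\<lambda>i. imult R i (n - i) (x i) (y (n - i))) {..n})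
            = finprod (igrp S n) (\<lambda>i. f n (imult R i (n - i) (x i) (y (n - i)))) {..n}"
            using mem by (intro hom_finprod f S.grp) auto
          also have "\<dots> = finprod (igrp S n) (\<lambda>i. imult S i (n - i) (f i (x i)) (f (n - i) (y (n - i)))) {..n}"
          proof (rule Sn.finprod_cong')
            show eq: "f n (imult R i (n - i) (x i) (y (n - i))) = imult S i (n - i) (f i (x i)) (f (n - i) (y (n - i)))"
              if "i \<in> {..n}" for i
              using that x y M[rule_format, of "x i" i "y (n - i)" "n - i"] by (simp add: R.carrier_ring)
            show "(\<lambda>i. imult S i (n - i) (f i (x i)) (f (n - i) (y (n - i)))) \<in> {..n} \<rightarrow> carrier (igrp S n)"
              using mem eq fin by (simp add: Pi_iff flip: eq)
          qed simp
          finally show "f n ((x \<otimes>\<^bsub>igr_ring R\<^esub> y) n) = ((\<lambda>n. f n (x n)) \<otimes>\<^bsub>igr_ring S\<^esub> (\<lambda>n. f n (y n))) n"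
            by (simp add: igr_ring_def)
        qed
      next
        show "(\<lambda>n. f n (\<one>\<^bsub>igr_ring R\<^esub> n)) = \<one>\<^bsub>igr_ring S\<^esub>"
          using D f1 by (auto simp: igr_ring_def)
      qed
    qed
  qed
  then show ?thesis unfolding hom_igr_def by blast
qed

section \<open>Signs in a pre-special hyperfield\<close>

locale psmf = pre_special_hyperfield F for F :: "'a hyper" (structure)
begin

abbreviation nz :: "'a set" where "nz \<equiv> carrier F - {hzero F}"
abbreviation k :: "nat \<Rightarrow> 'a kelt monoid" where "k \<equiv> reduced_K F"

text \<open>If \<open>ab = 0\<close>, then \<open>b = a(ab) = 0\<close>, because \<open>a\<close> is its own inverse.\<close>

lemma nz_mult [simp]:
  assumes "a \<in> nz" "b \<in> nz" shows "a \<otimes> b \<in> nz"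
proof -
  have "a \<otimes> (a \<otimes> b) = b" using assms square_one[of a] m_assoc[of a a b] by auto
  then have "a \<otimes> b \<noteq> hzero F" using mult_zero[of a] assms by auto
  then show ?thesis using assms by simp
qed

lemma one_nz [simp]: "\<one> \<in> nz" using one_not_zero by simp

lemma zero_in_add_iff:
  assumes "x \<in> carrier F" "y \<in> carrier F"
  shows "hzero F \<in> hadd F x y \<longleftrightarrow> y = hneg F x"
proof
  assume "hzero F \<in> hadd F x y"
  then have "y \<in> hadd F (hzero F) (hneg F x)" using add_rev assms by blast
  then show "y = hneg F x"
    using assms add_comm[of "hzero F" "hneg F x"] add_zero[of "hneg F x"] neg_closed zero_closed by simp
next
  assume "y = hneg F x"
  then show "hzero F \<in> hadd F x y"
    using add_rev[of x "hzero F" x] add_zero[of x] zero_closed assms by simp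
qed

lemma neg_eq: "x \<in> carrier F \<Longrightarrow> hneg F x = hneg F \<one> \<otimes> x"
proof -
  assume x: "x \<in> carrier F"
  have "hzero F \<in> hadd F \<one> (hneg F \<one>)" using zero_in_add_iff neg_closed by simp
  then have "hzero F \<otimes> x \<in> hadd F (\<one> \<otimes> x) (hneg F \<one> \<otimes> x)"
    using distrib[of \<one> "hneg F \<one>" x] x neg_closed by simp
  moreover have "hzero F \<otimes> x = hzero F" using mult_zero[OF x] m_comm zero_closed x by simp
  ultimately show ?thesis using zero_in_add_iff[of x "hneg F \<one> \<otimes> x"] x neg_closed by simp
qed

lemma neg_neg [simp]: "x \<in> carrier F \<Longrightarrow> hneg F (hneg F x) = x"
  using zero_in_add_iff[of x "hneg F x"] zero_in_add_iff[of "hneg F x" x] add_comm[of x "hneg F x"] neg_closed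
  by simp

lemma neg_zero [simp]: "hneg F (hzero F) = hzero F"
  using mult_zero[of "hneg F \<one>"] neg_eq[of "hzero F"] neg_closed zero_closed by simp

lemma neg_nz [simp]:
  assumes "x \<in> nz" shows "hneg F x \<in> nz"
proof -
  have "hneg F x \<noteq> hzero F"
  proof
    assume "hneg F x = hzero F"
    then have "hneg F (hneg F x) = hzero F" by simp
    then show False using assms by simp
  qed
  then show ?thesis using neg_closed assms by simp
qed

lemma neg_mult: "\<lbrakk>x \<in> carrier F; y \<in> carrier F\<rbrakk> \<Longrightarrow> hneg F (x \<otimes> y) = hneg F x \<otimes> y"
  using neg_eq[of "x \<otimes> y"] neg_eq[of x] neg_closed[of \<one>] m_assoc[of "hneg F \<one>" x y] by simp

text \<open>Multiplying \<open>a \<in> 1 - 1\<close> by \<open>a\<close> gives \<open>1 \<in> a - a\<close>, and reversing this sum gives the claim. It is the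
  only place where the axiom \<open>1 - 1 = F\<close> enters, and it makes \<open>{a, -a}\<close> a Steinberg relation.\<close>

lemma neg_in_one_minus:
  assumes "x \<in> nz" shows "hneg F x \<in> hdiff F \<one> x"
proof -
  have "x \<in> hadd F \<one> (hneg F \<one>)" using one_diff_one assms by (simp add: hdiff_def)
  then have "x \<otimes> x \<in> hadd F (\<one> \<otimes> x) (hneg F \<one> \<otimes> x)"
    using distrib[of \<one> "hneg F \<one>" x x] assms neg_closed by simp
  then have "\<one> \<in> hadd F x (hneg F x)"
    using assms square_one[of x] neg_eq[of x] by simp
  then show ?thesis
    using add_rev[of x "hneg F x" \<one>] assms neg_closed by (simp add: hdiff_def)
qed

end

section \<open>Generators and relations for the reduced K-groups\<close>

lemma free_hom_eqI:
  assumes "group H" "h \<in> hom (free_Abelian_group S) H" "h' \<in> hom (free_Abelian_group S) H"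
    and "\<And>s. s \<in> S \<Longrightarrow> h (frag_of s) = h' (frag_of s)" "Poly_Mapping.keys x \<subseteq> S"
  shows "h x = h' x"
proof -
  interpret h: group_hom "free_Abelian_group S" H h
    using assms by (simp add: group_hom_def group_hom_axioms_def)
  interpret h': group_hom "free_Abelian_group S" H h'
    using assms by (simp add: group_hom_def group_hom_axioms_def)
  show ?thesis
    using assms(5)
  proof (induction x rule: free_Abelian_group_induct[consumes 1, case_names zero diff of])
    case zero
    show ?case using h.hom_one h'.hom_one by simp
  next
    case (diff x y)
    then have "x - y = x \<otimes>\<^bsub>free_Abelian_group S\<^esub> inv\<^bsub>free_Abelian_group S\<^esub> y" by simp
    then show ?case
      using diff h.hom_mult[of x "inv\<^bsub>free_Abelian_group S\<^esub> y"] h'.hom_mult[of x "inv\<^bsub>free_Abelian_group S\<^esub> y"]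
        h.hom_inv[of y] h'.hom_inv[of y] by simp
  qed (use assms(4) in auto)
qed

lemma frag_extend_hom:
  assumes "\<And>s. s \<in> S \<Longrightarrow> Poly_Mapping.keys (f s) \<subseteq> T"
  shows "frag_extend f \<in> hom (free_Abelian_group S) (free_Abelian_group T)"
proof (rule homI)
  fix x assume "x \<in> carrier (free_Abelian_group S)"
  then show "frag_extend f x \<in> carrier (free_Abelian_group T)"
    using assms keys_frag_extend[of f x] by fastforce
qed (simp add: frag_extend_add)

lemma (in comm_group) Mod_props:
  assumes "subgroup N G"
  shows "comm_group (G Mod N)" "(#>) N \<in> hom G (G Mod N)"
    "carrier (G Mod N) = (#>) N ` carrier G" "\<And>x. x \<in> N \<Longrightarrow> N #> x = \<one>\<^bsub>G Mod N\<^esub>"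
proof -
  show "comm_group (G Mod N)" by (rule abelian_FactGroup[OF assms])
  show "(#>) N \<in> hom G (G Mod N)" by (rule normal.r_coset_hom_Mod[OF subgroup_imp_normal[OF assms]])
  show "carrier (G Mod N) = (#>) N ` carrier G" by (rule carrier_FactGroup)
  show "N #> x = \<one>\<^bsub>G Mod N\<^esub>" if "x \<in> N" for x
    using subgroup.rcos_const[OF assms is_group that] by simp
qed

text \<open>A quotient by a generated subgroup is a presentation: only the generators have to be checked when
  a homomorphism is factored through it.\<close>

lemma (in comm_group) Mod_generate_universal:
  assumes "X \<subseteq> carrier G" "group H" "h \<in> hom G H" "\<And>x. x \<in> X \<Longrightarrow> h x = \<one>\<^bsub>H\<^esub>"
  obtains g where "g \<in> hom (G Mod generate G X) H" "\<And>x. x \<in> carrier G \<Longrightarrow> g (generate G X #> x) = h x"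
proof -
  interpret h: group_hom G H h
    using assms is_group by (simp add: group_hom_def group_hom_axioms_def)
  have "generate G X \<subseteq> kernel G H h"
    using assms by (intro generate_subgroup_incl h.subgroup_kernel) (auto simp: kernel_def)
  then show thesis
    using h.FactGroup_universal_kernel[OF subgroup_imp_normal[OF generate_is_subgroup[OF assms(1)]]] that
    by blast
qed

text \<open>The symbol \<open>{a\<^sub>1, \<dots>, a\<^sub>n} = \<rho>(a\<^sub>1) \<cdots> \<rho>(a\<^sub>n)\<close>, with its degree read off from the list.\<close>

definition symbol :: "'a hyper \<Rightarrow> 'a list \<Rightarrow> 'a kelt" where
  "symbol F as = k_class F (length as) (frag_of as)"

context psmf
begin

lemma tuples_iff: "as \<in> tuples (nonzero_group F) n \<longleftrightarrow> length as = n \<and> set as \<subseteq> nz"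
  by (simp add: tuples_def nonzero_group_def)

abbreviation Free :: "nat \<Rightarrow> ('a list \<Rightarrow>\<^sub>0 int) monoid" where
  "Free n \<equiv> free_Abelian_group (tuples (nonzero_group F) n)"

abbreviation steinberg_tuples :: "nat \<Rightarrow> 'a list set" where
  "steinberg_tuples n \<equiv> {as. as \<in> tuples (nonzero_group F) n \<and>
        (\<exists>i. Suc i < n \<and> as ! Suc i \<in> hdiff F \<one> (as ! i))}"

lemma multilinear_relators_closed: "multilinear_relators (nonzero_group F) n \<subseteq> carrier (Free n)"
proof
  fix r assume "r \<in> multilinear_relators (nonzero_group F) n"
  then obtain us x y vs where r: "r = frag_of (us @ [x \<otimes> y] @ vs) - frag_of (us @ [x] @ vs) - frag_of (us @ [y] @ vs)"
    and t: "us @ [x] @ vs \<in> tuples (nonzero_group F) n" "us @ [y] @ vs \<in> tuples (nonzero_group F) n"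
    by (auto simp: multilinear_relators_def nonzero_group_def)
  then have "us @ [x \<otimes> y] @ vs \<in> tuples (nonzero_group F) n"
    using nz_mult[of x y] by (auto simp: tuples_iff)
  then have "frag_of (us @ [x \<otimes> y] @ vs) \<in> carrier (Free n)" "frag_of (us @ [x] @ vs) \<in> carrier (Free n)"
     "frag_of (us @ [y] @ vs) \<in> carrier (Free n)"
    using t by simp_all
  then show "r \<in> carrier (Free n)"
    using keys_diff[of "frag_of (us @ [x \<otimes> y] @ vs) - frag_of (us @ [x] @ vs)" "frag_of (us @ [y] @ vs)"]
       keys_diff[of "frag_of (us @ [x \<otimes> y] @ vs)" "frag_of (us @ [x] @ vs)"]
    unfolding r by (simp only: carrier_free_Abelian_group_iff) blast
qed

lemma tensor_props:
  shows "comm_group (tensor_power (nonzero_group F) n)"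
    "tensor_class (nonzero_group F) n \<in> hom (Free n) (tensor_power (nonzero_group F) n)"
    "carrier (tensor_power (nonzero_group F) n) = tensor_class (nonzero_group F) n ` carrier (Free n)"
    "\<And>x. x \<in> multilinear_relators (nonzero_group F) n \<Longrightarrow>
       tensor_class (nonzero_group F) n x = \<one>\<^bsub>tensor_power (nonzero_group F) n\<^esub>"
proof -
  interpret Fr: comm_group "Free n" by (rule abelian_free_Abelian_group)
  have S: "subgroup (multilinear_subgroup (nonzero_group F) n) (Free n)"
    unfolding multilinear_subgroup_def by (rule Fr.generate_is_subgroup[OF multilinear_relators_closed])
  have c: "tensor_class (nonzero_group F) n = (#>\<^bsub>Free n\<^esub>) (multilinear_subgroup (nonzero_group F) n)"
    by (simp add: tensor_class_def fun_eq_iff)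
  show "comm_group (tensor_power (nonzero_group F) n)"
    "tensor_class (nonzero_group F) n \<in> hom (Free n) (tensor_power (nonzero_group F) n)"
    "carrier (tensor_power (nonzero_group F) n) = tensor_class (nonzero_group F) n ` carrier (Free n)"
    unfolding c tensor_power_def using Fr.Mod_props[OF S] by blast+
  show "tensor_class (nonzero_group F) n x = \<one>\<^bsub>tensor_power (nonzero_group F) n\<^esub>"
    if "x \<in> multilinear_relators (nonzero_group F) n" for x
    unfolding c tensor_power_def
    by (rule Fr.Mod_props(4)[OF S]) (use that in \<open>auto simp: multilinear_subgroup_def intro: generate.incl\<close>)
qed

lemma steinberg_subgroup_eq: "steinberg_subgroup F n = generate (tensor_power (nonzero_group F) n)
    ((\<lambda>as. tensor_class (nonzero_group F) n (frag_of as)) ` steinberg_tuples n)"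
  unfolding steinberg_subgroup_def by (rule arg_cong[of _ _ "generate _"]) blast

lemma steinberg_closed: "(\<lambda>as. tensor_class (nonzero_group F) n (frag_of as)) ` steinberg_tuples n
    \<subseteq> carrier (tensor_power (nonzero_group F) n)"
  using tensor_props(3)[of n] by auto

lemma milnor_props:
  shows "comm_group (milnor_K F n)"
    "(#>\<^bsub>tensor_power (nonzero_group F) n\<^esub>) (steinberg_subgroup F n) \<in> hom (tensor_power (nonzero_group F) n) (milnor_K F n)"
    "carrier (milnor_K F n) = (#>\<^bsub>tensor_power (nonzero_group F) n\<^esub>) (steinberg_subgroup F n) ` carrier (tensor_power (nonzero_group F) n)"
    "\<And>x. x \<in> steinberg_subgroup F n \<Longrightarrow>
       steinberg_subgroup F n #>\<^bsub>tensor_power (nonzero_group F) n\<^esub> x = \<one>\<^bsub>milnor_K F n\<^esub>"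
proof -
  interpret T: comm_group "tensor_power (nonzero_group F) n" by (rule tensor_props)
  have "subgroup (steinberg_subgroup F n) (tensor_power (nonzero_group F) n)"
    unfolding steinberg_subgroup_eq by (rule T.generate_is_subgroup[OF steinberg_closed])
  note * = T.Mod_props[OF this]
  show "comm_group (milnor_K F n)"
    "(#>\<^bsub>tensor_power (nonzero_group F) n\<^esub>) (steinberg_subgroup F n) \<in> hom (tensor_power (nonzero_group F) n) (milnor_K F n)"
    "carrier (milnor_K F n) = (#>\<^bsub>tensor_power (nonzero_group F) n\<^esub>) (steinberg_subgroup F n) ` carrier (tensor_power (nonzero_group F) n)"
    "\<And>x. x \<in> steinberg_subgroup F n \<Longrightarrow>
       steinberg_subgroup F n #>\<^bsub>tensor_power (nonzero_group F) n\<^esub> x = \<one>\<^bsub>milnor_K F n\<^esub>"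
    unfolding milnor_K_def using * by blast+
qed

lemma reduced_props:
  shows "comm_group (k n)"
    "(#>\<^bsub>milnor_K F n\<^esub>) (twice_milnor_K F n) \<in> hom (milnor_K F n) (k n)"
    "carrier (k n) = (#>\<^bsub>milnor_K F n\<^esub>) (twice_milnor_K F n) ` carrier (milnor_K F n)"
    "\<And>x. x \<in> twice_milnor_K F n \<Longrightarrow> twice_milnor_K F n #>\<^bsub>milnor_K F n\<^esub> x = \<one>\<^bsub>k n\<^esub>"
    and twice_subgroup: "subgroup (twice_milnor_K F n) (milnor_K F n)"
proof -
  interpret M: comm_group "milnor_K F n" by (rule milnor_props)
  show S: "subgroup (twice_milnor_K F n) (milnor_K F n)"
  proof (rule M.subgroupI)
    show "twice_milnor_K F n \<subseteq> carrier (milnor_K F n)" by (auto simp: twice_milnor_K_def)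
    show "twice_milnor_K F n \<noteq> {}" using M.one_closed by (auto simp: twice_milnor_K_def)
    fix a b assume "a \<in> twice_milnor_K F n" "b \<in> twice_milnor_K F n"
    then obtain x y where xy: "x \<in> carrier (milnor_K F n)" "y \<in> carrier (milnor_K F n)"
      "a = x \<otimes>\<^bsub>milnor_K F n\<^esub> x" "b = y \<otimes>\<^bsub>milnor_K F n\<^esub> y" by (auto simp: twice_milnor_K_def)
    then have "a \<otimes>\<^bsub>milnor_K F n\<^esub> b = (x \<otimes>\<^bsub>milnor_K F n\<^esub> y) \<otimes>\<^bsub>milnor_K F n\<^esub> (x \<otimes>\<^bsub>milnor_K F n\<^esub> y)"
      by (simp add: M.m_ac)
    then show "a \<otimes>\<^bsub>milnor_K F n\<^esub> b \<in> twice_milnor_K F n"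
      using xy unfolding twice_milnor_K_def by blast
    have "inv\<^bsub>milnor_K F n\<^esub> a = inv\<^bsub>milnor_K F n\<^esub> x \<otimes>\<^bsub>milnor_K F n\<^esub> inv\<^bsub>milnor_K F n\<^esub> x"
      using xy by (simp add: M.inv_mult)
    then show "inv\<^bsub>milnor_K F n\<^esub> a \<in> twice_milnor_K F n"
      using xy M.inv_closed unfolding twice_milnor_K_def by blast
  qed
  note * = M.Mod_props[OF S]
  show "comm_group (k n)"
    "(#>\<^bsub>milnor_K F n\<^esub>) (twice_milnor_K F n) \<in> hom (milnor_K F n) (k n)"
    "carrier (k n) = (#>\<^bsub>milnor_K F n\<^esub>) (twice_milnor_K F n) ` carrier (milnor_K F n)"
    "\<And>x. x \<in> twice_milnor_K F n \<Longrightarrow> twice_milnor_K F n #>\<^bsub>milnor_K F n\<^esub> x = \<one>\<^bsub>k n\<^esub>"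
    unfolding reduced_K_def using * by blast+
qed

lemma k_group [simp]: "group (k n)" and k_comm_group: "comm_group (k n)"
  using reduced_props(1)[of n] by (auto simp: comm_group_def)

lemma k_class_comp: "k_class F n = (#>\<^bsub>milnor_K F n\<^esub>) (twice_milnor_K F n) \<circ>
     ((#>\<^bsub>tensor_power (nonzero_group F) n\<^esub>) (steinberg_subgroup F n) \<circ> tensor_class (nonzero_group F) n)"
  by (simp add: k_class_def fun_eq_iff)

lemma k_class_hom: "k_class F n \<in> hom (Free n) (k n)"
  unfolding k_class_comp
  by (rule hom_compose[OF hom_compose[OF tensor_props(2) milnor_props(2)] reduced_props(2)])

lemma k_class_surj: "carrier (k n) = k_class F n ` carrier (Free n)"
  unfolding k_class_comp image_comp[symmetric]
  by (simp only: reduced_props(3) milnor_props(3) tensor_props(3))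

text \<open>The maps out of \<open>k\<^sub>nF\<close> are defined through chosen representatives; this and \<open>k_class_hom\<close>
  are all that is used about the choice.\<close>

lemma k_rep:
  assumes "X \<in> carrier (k n)"
  shows "k_rep F n X \<in> carrier (Free n)" "k_class F n (k_rep F n X) = X"
proof -
  have "X \<in> k_class F n ` carrier (Free n)" using assms by (simp only: k_class_surj)
  then have "\<exists>x. x \<in> carrier (Free n) \<and> k_class F n x = X" by (simp only: image_iff Bex_def eq_commute)
  note rep = someI_ex[OF this, folded k_rep_def]
  show "k_rep F n X \<in> carrier (Free n)" by (rule rep[THEN conjunct1])
  show "k_class F n (k_rep F n X) = X" by (rule rep[THEN conjunct2])
qed

lemma k_class_diff:
  assumes "x \<in> carrier (Free n)" "y \<in> carrier (Free n)"
  shows "k_class F n (x - y) = k_class F n x \<otimes>\<^bsub>k n\<^esub> inv\<^bsub>k n\<^esub> k_class F n y"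
proof -
  interpret c: group_hom "Free n" "k n" "k_class F n"
    by (simp add: group_hom_def group_hom_axioms_def k_class_hom)
  have "k_class F n (x \<otimes>\<^bsub>Free n\<^esub> inv\<^bsub>Free n\<^esub> y) = k_class F n x \<otimes>\<^bsub>k n\<^esub> inv\<^bsub>k n\<^esub> k_class F n y"
    by (simp only: c.hom_mult c.hom_inv c.G.inv_closed assms)
  moreover have "x \<otimes>\<^bsub>Free n\<^esub> inv\<^bsub>Free n\<^esub> y = x - y" using assms by simp
  ultimately show ?thesis by simp
qed

lemma k_exponent_two:
  assumes "X \<in> carrier (k n)" shows "X \<otimes>\<^bsub>k n\<^esub> X = \<one>\<^bsub>k n\<^esub>"
proof -
  obtain x where x: "x \<in> carrier (milnor_K F n)" "X = twice_milnor_K F n #>\<^bsub>milnor_K F n\<^esub> x"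
    using assms reduced_props(3) by blast
  then have "X \<otimes>\<^bsub>k n\<^esub> X = twice_milnor_K F n #>\<^bsub>milnor_K F n\<^esub> (x \<otimes>\<^bsub>milnor_K F n\<^esub> x)"
    using hom_mult[OF reduced_props(2)] by simp
  moreover have "x \<otimes>\<^bsub>milnor_K F n\<^esub> x \<in> twice_milnor_K F n"
    using x(1) by (auto simp: twice_milnor_K_def)
  ultimately show ?thesis by (simp add: reduced_props(4))
qed

lemma k_inv [simp]: "X \<in> carrier (k n) \<Longrightarrow> inv\<^bsub>k n\<^esub> X = X"
  using k_exponent_two by (simp add: group.inv_equality)

lemma symbol_in [simp]: "\<lbrakk>set as \<subseteq> nz; length as = n\<rbrakk> \<Longrightarrow> symbol F as \<in> carrier (k n)"
  using hom_in_carrier[OF k_class_hom, of "frag_of as" n] by (simp add: symbol_def tuples_iff)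

text \<open>Symbols are multilinear and satisfy the Steinberg relation. Each fact follows one of the first two
  quotient maps, under which its relator dies.\<close>

lemma symbol_mult:
  assumes "set us \<subseteq> nz" "set vs \<subseteq> nz" "x \<in> nz" "y \<in> nz" "n = length us + 1 + length vs"
  shows "symbol F (us @ (x \<otimes> y) # vs) = symbol F (us @ x # vs) \<otimes>\<^bsub>k n\<^esub> symbol F (us @ y # vs)"
proof -
  let ?r = "frag_of (us @ [x \<otimes> y] @ vs) - frag_of (us @ [x] @ vs) - frag_of (us @ [y] @ vs)"
  interpret K: comm_group "k n" by (rule k_comm_group)
  have t: "us @ [x] @ vs \<in> tuples (nonzero_group F) n" "us @ [y] @ vs \<in> tuples (nonzero_group F) n"
    "us @ [x \<otimes> y] @ vs \<in> tuples (nonzero_group F) n"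
    using assms nz_mult[of x y] by (auto simp: tuples_iff)
  then have r: "?r \<in> multilinear_relators (nonzero_group F) n"
    unfolding multilinear_relators_def by (auto simp: nonzero_group_def)
  have tc: "tensor_class (nonzero_group F) n ?r = \<one>\<^bsub>tensor_power (nonzero_group F) n\<^esub>"
    using tensor_props(4)[OF r] .
  have mg: "group (milnor_K F n)" "group (tensor_power (nonzero_group F) n)"
    using milnor_props(1)[of n] tensor_props(1)[of n] by (auto simp: comm_group_def)
  have "k_class F n ?r = \<one>\<^bsub>k n\<^esub>"
    unfolding k_class_def tc hom_one[OF milnor_props(2) mg(2,1)] hom_one[OF reduced_props(2) mg(1) k_group] ..
  moreover have "frag_of (us @ [x \<otimes> y] @ vs) - frag_of (us @ [x] @ vs) \<in> carrier (Free n)"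
    using t keys_diff[of "frag_of (us @ [x \<otimes> y] @ vs)" "frag_of (us @ [x] @ vs)"] by auto
  ultimately have "symbol F (us @ (x \<otimes> y) # vs) \<otimes>\<^bsub>k n\<^esub> inv\<^bsub>k n\<^esub> symbol F (us @ x # vs)
      \<otimes>\<^bsub>k n\<^esub> inv\<^bsub>k n\<^esub> symbol F (us @ y # vs) = \<one>\<^bsub>k n\<^esub>"
    using t by (simp add: k_class_diff symbol_def tuples_iff)
  moreover have sym: "symbol F (us @ (x \<otimes> y) # vs) \<in> carrier (k n)"
      "symbol F (us @ x # vs) \<in> carrier (k n)" "symbol F (us @ y # vs) \<in> carrier (k n)"
    using t by (simp_all add: tuples_iff)
  ultimately have "inv\<^bsub>k n\<^esub> (symbol F (us @ x # vs) \<otimes>\<^bsub>k n\<^esub> symbol F (us @ y # vs)) = symbol F (us @ (x \<otimes> y) # vs)"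
    by (intro K.inv_equality) (simp_all add: K.m_assoc)
  then show ?thesis using sym by simp
qed

lemma symbol_steinberg:
  assumes "set as \<subseteq> nz" "Suc i < n" "length as = n" "as ! Suc i \<in> hdiff F \<one> (as ! i)"
  shows "symbol F as = \<one>\<^bsub>k n\<^esub>"
proof -
  have "tensor_class (nonzero_group F) n (frag_of as) \<in> steinberg_subgroup F n"
    unfolding steinberg_subgroup_eq using assms
    by (intro generate.incl) (auto simp: tuples_iff)
  then have "symbol F as = twice_milnor_K F n #>\<^bsub>milnor_K F n\<^esub> \<one>\<^bsub>milnor_K F n\<^esub>"
    using assms by (simp add: symbol_def k_class_def milnor_props(4))
  moreover have "group (milnor_K F n)" using milnor_props(1)[of n] by (simp add: comm_group_def)
  ultimately show ?thesis using hom_one[OF reduced_props(2)] by simp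
qed

text \<open>The universal property of \<open>k\<^sub>nF\<close>: these relations suffice. The homomorphism is
  extended from the tuples to the free group and then factored through the three quotients in turn.\<close>

lemma k_universal:
  assumes H: "comm_group H" "\<And>x. x \<in> carrier H \<Longrightarrow> x \<otimes>\<^bsub>H\<^esub> x = \<one>\<^bsub>H\<^esub>"
    and f: "\<And>as. \<lbrakk>set as \<subseteq> nz; length as = n\<rbrakk> \<Longrightarrow> f as \<in> carrier H"
    and multilinear: "\<And>us x y vs. \<lbrakk>set us \<subseteq> nz; set vs \<subseteq> nz; x \<in> nz; y \<in> nz; length us + 1 + length vs = n\<rbrakk>
      \<Longrightarrow> f (us @ (x \<otimes> y) # vs) = f (us @ x # vs) \<otimes>\<^bsub>H\<^esub> f (us @ y # vs)"
    and steinberg: "\<And>as i. \<lbrakk>set as \<subseteq> nz; length as = n; Suc i < n; as ! Suc i \<in> hdiff F \<one> (as ! i)\<rbrakk>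
      \<Longrightarrow> f as = \<one>\<^bsub>H\<^esub>"
  obtains g where "g \<in> hom (k n) H" "\<And>as. \<lbrakk>set as \<subseteq> nz; length as = n\<rbrakk> \<Longrightarrow> g (symbol F as) = f as"
proof -
  interpret H: comm_group H by fact
  interpret Fr: comm_group "Free n" by (rule abelian_free_Abelian_group)
  interpret T: comm_group "tensor_power (nonzero_group F) n" by (rule tensor_props)
  interpret M: comm_group "milnor_K F n" by (rule milnor_props)
  obtain h where h: "h \<in> hom (Free n) H" and hf: "\<And>as. as \<in> tuples (nonzero_group F) n \<Longrightarrow> h (frag_of as) = f as"
  proof (rule H.free_Abelian_group_universal[of f "tuples (nonzero_group F) n"])
    show "f ` tuples (nonzero_group F) n \<subseteq> carrier H" using f by (auto simp: tuples_iff)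
  qed blast
  interpret h: group_hom "Free n" H h
    by (simp add: group_hom_def group_hom_axioms_def h H.is_group)
  have "h r = \<one>\<^bsub>H\<^esub>" if r_in: "r \<in> multilinear_relators (nonzero_group F) n" for r
  proof -
    obtain us x y vs where r: "r = frag_of (us @ [x \<otimes> y] @ vs) - frag_of (us @ [x] @ vs) - frag_of (us @ [y] @ vs)"
      and t: "us @ [x] @ vs \<in> tuples (nonzero_group F) n" "us @ [y] @ vs \<in> tuples (nonzero_group F) n"
      using r_in by (auto simp: multilinear_relators_def nonzero_group_def)
    let ?z = "frag_of (us @ [x \<otimes> y] @ vs)" and ?x = "frag_of (us @ [x] @ vs)" and ?y = "frag_of (us @ [y] @ vs)"
    have t': "us @ [x \<otimes> y] @ vs \<in> tuples (nonzero_group F) n"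
      using t nz_mult[of x y] by (auto simp: tuples_iff)
    have c: "?z \<in> carrier (Free n)" "?x \<in> carrier (Free n)" "?y \<in> carrier (Free n)"
      using t t' by simp_all
    have "?z = ?x \<otimes>\<^bsub>Free n\<^esub> ?y \<otimes>\<^bsub>Free n\<^esub> r" using r by simp
    moreover have rc: "r \<in> carrier (Free n)" using r_in multilinear_relators_closed by blast
    ultimately have "h ?z = h ?x \<otimes>\<^bsub>H\<^esub> h ?y \<otimes>\<^bsub>H\<^esub> h r"
      using c rc by (simp only: h.hom_mult Fr.m_closed)
    moreover have "h ?z = h ?x \<otimes>\<^bsub>H\<^esub> h ?y"
      using hf[OF t'] hf[OF t(1)] hf[OF t(2)] multilinear[of us vs x y] t by (simp add: tuples_iff)
    ultimately show "h r = \<one>\<^bsub>H\<^esub>"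
      using H.l_cancel_one'[OF H.m_closed[OF h.hom_closed[OF c(2)] h.hom_closed[OF c(3)]] h.hom_closed[OF rc]]
      by (simp only:)
  qed
  then obtain g1 where g1: "g1 \<in> hom (tensor_power (nonzero_group F) n) H"
      "\<And>x. x \<in> carrier (Free n) \<Longrightarrow> g1 (tensor_class (nonzero_group F) n x) = h x"
    using Fr.Mod_generate_universal[OF multilinear_relators_closed H.is_group h]
    unfolding tensor_power_def multilinear_subgroup_def tensor_class_def by blast
  have "g1 x = \<one>\<^bsub>H\<^esub>" if "x \<in> (\<lambda>as. tensor_class (nonzero_group F) n (frag_of as)) ` steinberg_tuples n" for x
    using that steinberg by (auto simp: g1 hf) (auto simp: tuples_iff)
  then obtain g2 where g2: "g2 \<in> hom (milnor_K F n) H"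
      "\<And>x. x \<in> carrier (tensor_power (nonzero_group F) n)
         \<Longrightarrow> g2 (steinberg_subgroup F n #>\<^bsub>tensor_power (nonzero_group F) n\<^esub> x) = g1 x"
    using T.Mod_generate_universal[OF steinberg_closed H.is_group g1(1)]
    unfolding milnor_K_def steinberg_subgroup_eq by blast
  interpret g2: group_hom "milnor_K F n" H g2
    by (simp add: group_hom_def group_hom_axioms_def g2 H.is_group M.is_group)
  have "twice_milnor_K F n \<subseteq> kernel (milnor_K F n) H g2"
    using H(2) by (auto simp: twice_milnor_K_def kernel_def)
  then obtain g where g: "g \<in> hom (k n) H"
      "\<And>x. x \<in> carrier (milnor_K F n) \<Longrightarrow> g (twice_milnor_K F n #>\<^bsub>milnor_K F n\<^esub> x) = g2 x"
    using g2.FactGroup_universal_kernel[OF M.subgroup_imp_normal[OF twice_subgroup]]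
    unfolding reduced_K_def by blast
  show thesis
  proof
    show "g \<in> hom (k n) H" by fact
    fix as assume as: "set as \<subseteq> nz" "length as = n"
    then have "frag_of as \<in> carrier (Free n)" by (simp add: tuples_iff)
    moreover note hom_in_carrier[OF tensor_props(2) this]
    moreover note hom_in_carrier[OF milnor_props(2) this]
    ultimately show "g (symbol F as) = f as"
      using as by (simp add: symbol_def k_class_def g g1 g2 hf tuples_iff)
  qed
qed

lemma k_hom_eqI:
  assumes "group H" "h \<in> hom (k n) H" "h' \<in> hom (k n) H" "X \<in> carrier (k n)"
    and eq: "\<And>as. \<lbrakk>set as \<subseteq> nz; length as = n\<rbrakk> \<Longrightarrow> h (symbol F as) = h' (symbol F as)"
  shows "h X = h' X"
proof -
  have "(h \<circ> k_class F n) (k_rep F n X) = (h' \<circ> k_class F n) (k_rep F n X)"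
  proof (rule free_hom_eqI[OF assms(1)])
    show "h \<circ> k_class F n \<in> hom (Free n) H" "h' \<circ> k_class F n \<in> hom (Free n) H"
      by (rule hom_compose[OF k_class_hom assms(2)] hom_compose[OF k_class_hom assms(3)])+
    show "Poly_Mapping.keys (k_rep F n X) \<subseteq> tuples (nonzero_group F) n"
      using k_rep[OF assms(4)] by simp
    show "(h \<circ> k_class F n) (frag_of s) = (h' \<circ> k_class F n) (frag_of s)"
      if "s \<in> tuples (nonzero_group F) n" for s
      using eq that by (auto simp: tuples_iff symbol_def)
  qed
  then show ?thesis using k_rep(2)[OF assms(4)] by simp
qed

text \<open>Signs are irrelevant in a group of exponent two, so every element is reached from zero by
  adding symbols.\<close>

lemma k_induct [consumes 1, case_names zero symbol]:
  assumes "X \<in> carrier (k n)" and zero: "P \<one>\<^bsub>k n\<^esub>"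
    and symbol: "\<And>as X. \<lbrakk>set as \<subseteq> nz; length as = n; X \<in> carrier (k n); P X\<rbrakk> \<Longrightarrow> P (symbol F as \<otimes>\<^bsub>k n\<^esub> X)"
  shows "P X"
proof -
  interpret K: comm_group "k n" by (rule k_comm_group)
  have c: "k_class F n x \<in> carrier (k n)" if "Poly_Mapping.keys x \<subseteq> tuples (nonzero_group F) n" for x
    by (rule hom_in_carrier[OF k_class_hom]) (use that in simp)
  have "P (k_class F n x \<otimes>\<^bsub>k n\<^esub> Y)"
    if "Poly_Mapping.keys x \<subseteq> tuples (nonzero_group F) n" "Y \<in> carrier (k n)" "P Y" for x Y
    using that
  proof (induction x arbitrary: Y rule: free_Abelian_group_induct[consumes 1, case_names zero diff of])
    case zero
    have "k_class F n 0 = \<one>\<^bsub>k n\<^esub>"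
      using hom_one[OF k_class_hom group_free_Abelian_group k_group] by simp
    then show ?case using zero by simp
  next
    case (diff x y)
    then have "k_class F n (x - y) \<otimes>\<^bsub>k n\<^esub> Y = k_class F n x \<otimes>\<^bsub>k n\<^esub> (k_class F n y \<otimes>\<^bsub>k n\<^esub> Y)"
      by (simp add: k_class_diff c K.m_assoc)
    then show ?case using diff c by (metis K.m_closed)
  next
    case (of as)
    then show ?case using symbol[of as Y] by (simp add: tuples_iff symbol_def)
  qed
  from this[of "k_rep F n X" "\<one>\<^bsub>k n\<^esub>"] show ?thesis
    using zero k_rep[OF assms(1)] assms(1) by simp
qed

end

section \<open>Products of symbols\<close>

lemma frag_concat_of [simp]: "frag_concat (frag_of as) (frag_of bs) = frag_of (as @ bs)"
  by (simp add: frag_concat_def)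

lemma frag_concat_diff_left: "frag_concat (x - y) z = frag_concat x z - frag_concat y z"
  by (simp add: frag_concat_def frag_extend_diff)

lemma frag_concat_diff_right: "frag_concat x (y - z) = frag_concat x y - frag_concat x z"
proof (induction x rule: frag_induction[OF subset_UNIV])
  case (2 as)
  show ?case by (simp add: frag_concat_def frag_extend_diff)
qed (simp_all add: frag_concat_diff_left, simp add: frag_concat_def)

lemma frag_concat_zero [simp]: "frag_concat 0 y = 0" "frag_concat x 0 = 0"
  using frag_concat_diff_left[of 0 0 y] frag_concat_diff_right[of x 0 0] by simp_all

lemma frag_concat_add_left: "frag_concat (x + y) z = frag_concat x z + frag_concat y z"
  by (simp add: frag_concat_def frag_extend_add)

lemma frag_concat_add_right: "frag_concat x (y + z) = frag_concat x y + frag_concat x z"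
  using frag_concat_diff_right[of x "y + z" z] by (simp add: algebra_simps)

lemma frag_concat_assoc: "frag_concat (frag_concat x y) z = frag_concat x (frag_concat y z)"
proof (induction x rule: frag_induction[OF subset_UNIV])
  case (2 as)
  show ?case
  proof (induction y rule: frag_induction[OF subset_UNIV])
    case (2 bs)
    show ?case
      by (induction z rule: frag_induction[OF subset_UNIV]) (simp_all add: frag_concat_diff_right)
  qed (simp_all add: frag_concat_diff_left frag_concat_diff_right)
qed (simp_all add: frag_concat_diff_left)

context psmf
begin

lemma frag_concat_in [simp]:
  assumes "Poly_Mapping.keys x \<subseteq> tuples (nonzero_group F) n" "Poly_Mapping.keys y \<subseteq> tuples (nonzero_group F) m"
  shows "Poly_Mapping.keys (frag_concat x y) \<subseteq> tuples (nonzero_group F) (n + m)"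
proof -
  have "Poly_Mapping.keys (frag_extend (\<lambda>bs. frag_of (as @ bs)) y) \<subseteq> tuples (nonzero_group F) (n + m)"
    if "as \<in> tuples (nonzero_group F) n" for as
    using hom_in_carrier[OF frag_extend_hom, of "tuples (nonzero_group F) m" _ "tuples (nonzero_group F) (n + m)" y] that assms
    by (simp add: tuples_iff)
  then show ?thesis
    using hom_in_carrier[OF frag_extend_hom, of "tuples (nonzero_group F) n" _ "tuples (nonzero_group F) (n + m)" x] assms
    unfolding frag_concat_def by simp
qed

text \<open>Juxtaposition with a fixed tuple respects the relations, as a relation for a tuple
  remains one for the longer tuple. These two homomorphisms show that the product of the
  reduced K-groups is well defined.\<close>

lemma append_hom:
  assumes "set bs \<subseteq> nz" "length bs = m"
  obtains g where "g \<in> hom (k n) (k (n + m))"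
    "\<And>as. \<lbrakk>set as \<subseteq> nz; length as = n\<rbrakk> \<Longrightarrow> g (symbol F as) = symbol F (as @ bs)"
proof (rule k_universal[OF k_comm_group[of "n + m"], of n "\<lambda>as. symbol F (as @ bs)"])
  fix as i assume "set as \<subseteq> nz" "length as = n" "Suc i < n" "as ! Suc i \<in> hdiff F \<one> (as ! i)"
  then show "symbol F (as @ bs) = \<one>\<^bsub>k (n + m)\<^esub>"
    using assms by (intro symbol_steinberg[of _ i]) (auto simp: nth_append)
next
  fix us x y vs assume "set us \<subseteq> nz" "set vs \<subseteq> nz" "x \<in> nz" "y \<in> nz" "length us + 1 + length vs = n"
  then show "symbol F ((us @ x \<otimes> y # vs) @ bs) =
      symbol F ((us @ x # vs) @ bs) \<otimes>\<^bsub>k (n + m)\<^esub> symbol F ((us @ y # vs) @ bs)"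
    using symbol_mult[of us "vs @ bs" x y "n + m"] assms by simp
qed (use assms k_exponent_two in auto)

lemma prepend_hom:
  assumes "set as \<subseteq> nz" "length as = n"
  obtains g where "g \<in> hom (k m) (k (n + m))"
    "\<And>bs. \<lbrakk>set bs \<subseteq> nz; length bs = m\<rbrakk> \<Longrightarrow> g (symbol F bs) = symbol F (as @ bs)"
proof (rule k_universal[OF k_comm_group[of "n + m"], of m "\<lambda>bs. symbol F (as @ bs)"])
  fix bs i assume "set bs \<subseteq> nz" "length bs = m" "Suc i < m" "bs ! Suc i \<in> hdiff F \<one> (bs ! i)"
  then show "symbol F (as @ bs) = \<one>\<^bsub>k (n + m)\<^esub>"
    using assms by (intro symbol_steinberg[of _ "n + i"]) (auto simp: nth_append)
next
  fix us x y vs assume "set us \<subseteq> nz" "set vs \<subseteq> nz" "x \<in> nz" "y \<in> nz" "length us + 1 + length vs = m"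
  then show "symbol F (as @ us @ x \<otimes> y # vs) =
      symbol F (as @ us @ x # vs) \<otimes>\<^bsub>k (n + m)\<^esub> symbol F (as @ us @ y # vs)"
    using symbol_mult[of "as @ us" vs x y "n + m"] assms by simp
qed (use assms k_exponent_two in auto)

lemma k_class_of: "as \<in> tuples (nonzero_group F) n \<Longrightarrow> k_class F n (frag_of as) = symbol F as"
  by (auto simp: symbol_def tuples_iff)

lemma concat_left_hom:
  assumes "Poly_Mapping.keys y \<subseteq> tuples (nonzero_group F) m"
  shows "(\<lambda>x. k_class F (n + m) (frag_concat x y)) \<in> hom (Free n) (k (n + m))"
  using hom_compose[of "\<lambda>x. frag_concat x y", OF _ k_class_hom, of "Free n" "n + m"] assms
  by (simp add: o_def) (auto simp: hom_def frag_concat_add_left)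

lemma concat_right_hom:
  assumes "Poly_Mapping.keys x \<subseteq> tuples (nonzero_group F) n"
  shows "(\<lambda>y. k_class F (n + m) (frag_concat x y)) \<in> hom (Free m) (k (n + m))"
  using hom_compose[of "\<lambda>y. frag_concat x y", OF _ k_class_hom, of "Free m" "n + m"] assms
  by (simp add: o_def) (auto simp: hom_def frag_concat_add_right)

text \<open>In the second argument both sides are homomorphisms, so it may be taken to be a tuple; then
  \<open>append_hom\<close> computes the class of the product from the class of the first factor.\<close>

lemma concat_cong_left:
  assumes x: "Poly_Mapping.keys x \<subseteq> tuples (nonzero_group F) n" "Poly_Mapping.keys x' \<subseteq> tuples (nonzero_group F) n"
    and eq: "k_class F n x = k_class F n x'" and y: "Poly_Mapping.keys y \<subseteq> tuples (nonzero_group F) m"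
  shows "k_class F (n + m) (frag_concat x y) = k_class F (n + m) (frag_concat x' y)"
proof (rule free_hom_eqI[OF k_group concat_right_hom[OF x(1)] concat_right_hom[OF x(2)] _ y])
  fix bs assume bs: "bs \<in> tuples (nonzero_group F) m"
  then obtain g where g: "g \<in> hom (k n) (k (n + m))"
    "\<And>as. \<lbrakk>set as \<subseteq> nz; length as = n\<rbrakk> \<Longrightarrow> g (symbol F as) = symbol F (as @ bs)"
    using append_hom[of bs m n] by (auto simp: tuples_iff)
  have "k_class F (n + m) (frag_concat z (frag_of bs)) = (g \<circ> k_class F n) z"
    if z: "Poly_Mapping.keys z \<subseteq> tuples (nonzero_group F) n" for z
  proof (rule free_hom_eqI[OF k_group concat_left_hom hom_compose[OF k_class_hom g(1)] _ z])
    fix as assume as: "as \<in> tuples (nonzero_group F) n"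
    then show "k_class F (n + m) (frag_concat (frag_of as) (frag_of bs)) = (g \<circ> k_class F n) (frag_of as)"
      using bs g(2)[of as] by (simp add: k_class_of) (simp add: tuples_iff k_class_of)
  qed (use bs in simp)
  then show "k_class F (n + m) (frag_concat x (frag_of bs)) = k_class F (n + m) (frag_concat x' (frag_of bs))"
    using x eq by simp
qed

lemma concat_cong_right:
  assumes y: "Poly_Mapping.keys y \<subseteq> tuples (nonzero_group F) m" "Poly_Mapping.keys y' \<subseteq> tuples (nonzero_group F) m"
    and eq: "k_class F m y = k_class F m y'" and x: "Poly_Mapping.keys x \<subseteq> tuples (nonzero_group F) n"
  shows "k_class F (n + m) (frag_concat x y) = k_class F (n + m) (frag_concat x y')"
proof (rule free_hom_eqI[OF k_group concat_left_hom[OF y(1)] concat_left_hom[OF y(2)] _ x])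
  fix as assume as: "as \<in> tuples (nonzero_group F) n"
  then obtain g where g: "g \<in> hom (k m) (k (n + m))"
    "\<And>bs. \<lbrakk>set bs \<subseteq> nz; length bs = m\<rbrakk> \<Longrightarrow> g (symbol F bs) = symbol F (as @ bs)"
    using prepend_hom[of as n m] by (auto simp: tuples_iff)
  have "k_class F (n + m) (frag_concat (frag_of as) z) = (g \<circ> k_class F m) z"
    if z: "Poly_Mapping.keys z \<subseteq> tuples (nonzero_group F) m" for z
  proof (rule free_hom_eqI[OF k_group concat_right_hom hom_compose[OF k_class_hom g(1)] _ z])
    fix bs assume bs: "bs \<in> tuples (nonzero_group F) m"
    then show "k_class F (n + m) (frag_concat (frag_of as) (frag_of bs)) = (g \<circ> k_class F m) (frag_of bs)"
      using as g(2)[of bs] by (simp add: k_class_of) (simp add: tuples_iff k_class_of)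
  qed (use as in simp)
  then show "k_class F (n + m) (frag_concat (frag_of as) y) = k_class F (n + m) (frag_concat (frag_of as) y')"
    using y eq by simp
qed

lemma k_class_in [simp]: "Poly_Mapping.keys x \<subseteq> tuples (nonzero_group F) n \<Longrightarrow> k_class F n x \<in> carrier (k n)"
  by (rule hom_in_carrier[OF k_class_hom]) simp

lemma k_rep_in [simp]: "X \<in> carrier (k n) \<Longrightarrow> Poly_Mapping.keys (k_rep F n X) \<subseteq> tuples (nonzero_group F) n"
  using k_rep(1) by simp

text \<open>The defining formula of the product holds for arbitrary representatives, not only for the
  chosen ones.\<close>

lemma k_mult_class:
  assumes "Poly_Mapping.keys x \<subseteq> tuples (nonzero_group F) n" "Poly_Mapping.keys y \<subseteq> tuples (nonzero_group F) m"
  shows "k_mult F n m (k_class F n x) (k_class F m y) = k_class F (n + m) (frag_concat x y)"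
proof -
  have "k_class F (n + m) (frag_concat (k_rep F n (k_class F n x)) (k_rep F m (k_class F m y)))
      = k_class F (n + m) (frag_concat x (k_rep F m (k_class F m y)))"
    using assms by (intro concat_cong_left) (simp_all add: k_rep)
  also have "\<dots> = k_class F (n + m) (frag_concat x y)"
    using assms by (intro concat_cong_right) (simp_all add: k_rep)
  finally show ?thesis by (simp add: k_mult_def)
qed

lemma k_mult_symbol:
  assumes "set as \<subseteq> nz" "set bs \<subseteq> nz" "length as = n" "length bs = m"
  shows "k_mult F n m (symbol F as) (symbol F bs) = symbol F (as @ bs)"
  using k_mult_class[of "frag_of as" n "frag_of bs" m] assms
  by (simp add: tuples_iff k_class_of)

lemma k_elim:
  assumes "X \<in> carrier (k n)"
  obtains x where "Poly_Mapping.keys x \<subseteq> tuples (nonzero_group F) n" "X = k_class F n x"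
  using k_rep[OF assms] by (metis carrier_free_Abelian_group_iff)

lemma k_class_add:
  assumes "Poly_Mapping.keys x \<subseteq> tuples (nonzero_group F) n" "Poly_Mapping.keys y \<subseteq> tuples (nonzero_group F) n"
  shows "k_class F n (x + y) = k_class F n x \<otimes>\<^bsub>k n\<^esub> k_class F n y"
  using hom_mult[OF k_class_hom, of x n y] assms by simp

lemma keys_add_in [simp]: "\<lbrakk>Poly_Mapping.keys x \<subseteq> S; Poly_Mapping.keys y \<subseteq> S\<rbrakk> \<Longrightarrow> Poly_Mapping.keys (x + y) \<subseteq> S"
  using keys_add[of x y] by blast

lemma k_mult_hom:
  assumes "X \<in> carrier (k n)"
  shows "k_mult F n m X \<in> hom (k m) (k (n + m))" "(\<lambda>Y. k_mult F m n Y X) \<in> hom (k m) (k (n + m))"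
proof -
  obtain x where x: "Poly_Mapping.keys x \<subseteq> tuples (nonzero_group F) n" "X = k_class F n x"
    using k_elim[OF assms] .
  show "k_mult F n m X \<in> hom (k m) (k (n + m))"
  proof (rule homI)
    fix Y Z assume "Y \<in> carrier (k m)" "Z \<in> carrier (k m)"
    then obtain y z where "Poly_Mapping.keys y \<subseteq> tuples (nonzero_group F) m" "Y = k_class F m y"
      "Poly_Mapping.keys z \<subseteq> tuples (nonzero_group F) m" "Z = k_class F m z" by (metis k_elim)
    then show "k_mult F n m X (Y \<otimes>\<^bsub>k m\<^esub> Z) = k_mult F n m X Y \<otimes>\<^bsub>k (n + m)\<^esub> k_mult F n m X Z"
      by (simp add: x k_class_add[symmetric] k_mult_class frag_concat_add_right)
  next
    fix Y assume "Y \<in> carrier (k m)"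
    then show "k_mult F n m X Y \<in> carrier (k (n + m))"
      by (elim k_elim) (simp add: x k_mult_class)
  qed
  show "(\<lambda>Y. k_mult F m n Y X) \<in> hom (k m) (k (n + m))"
  proof (rule homI)
    fix Y Z assume "Y \<in> carrier (k m)" "Z \<in> carrier (k m)"
    then obtain y z where "Poly_Mapping.keys y \<subseteq> tuples (nonzero_group F) m" "Y = k_class F m y"
      "Poly_Mapping.keys z \<subseteq> tuples (nonzero_group F) m" "Z = k_class F m z" by (metis k_elim)
    then show "k_mult F m n (Y \<otimes>\<^bsub>k m\<^esub> Z) X = k_mult F m n Y X \<otimes>\<^bsub>k (n + m)\<^esub> k_mult F m n Z X"
      using x by (simp add: k_class_add[symmetric] k_mult_class frag_concat_add_left add.commute[of n m])
  next
    fix Y assume "Y \<in> carrier (k m)"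
    then show "k_mult F m n Y X \<in> carrier (k (n + m))"
      using x by (elim k_elim) (simp add: k_mult_class add.commute[of n m])
  qed
qed

end

section \<open>Commutativity\<close>

context psmf
begin

lemma symbol_neg:
  assumes "set us \<subseteq> nz" "set vs \<subseteq> nz" "x \<in> nz" "n = length us + 2 + length vs"
  shows "symbol F (us @ x # hneg F x # vs) = \<one>\<^bsub>k n\<^esub>"
  using assms neg_in_one_minus[of x] neg_nz[of x]
  by (intro symbol_steinberg[of _ "length us"]) (auto simp: nth_append)

text \<open>Expanding \<open>{ab, -ab} = 0\<close> in both places, with \<open>-ab = (-a)b = (-b)a\<close>, leaves
  \<open>{a, b} + {b, a} = 0\<close> because \<open>{a, -a}\<close> and \<open>{b, -b}\<close> vanish. In exponent two this is
  commutativity rather than anticommutativity.\<close>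

lemma symbol_swap:
  assumes us: "set us \<subseteq> nz" and vs: "set vs \<subseteq> nz" and a: "a \<in> nz" and b: "b \<in> nz"
  shows "symbol F (us @ a # b # vs) = symbol F (us @ b # a # vs)"
proof -
  define n where "n = length us + 2 + length vs"
  interpret K: comm_group "k n" by (rule k_comm_group)
  define s where "s = (\<lambda>x y. symbol F (us @ x # y # vs))"
  have s: "s x y \<in> carrier (k n)" if "x \<in> nz" "y \<in> nz" for x y
    using that us vs by (simp add: s_def n_def)
  have left: "s (x \<otimes> y) z = s x z \<otimes>\<^bsub>k n\<^esub> s y z" if "x \<in> nz" "y \<in> nz" "z \<in> nz" for x y z
    using symbol_mult[of us "z # vs" x y n] that us vs by (simp add: s_def n_def)
  have right: "s z (x \<otimes> y) = s z x \<otimes>\<^bsub>k n\<^esub> s z y" if "x \<in> nz" "y \<in> nz" "z \<in> nz" for x y z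
    using symbol_mult[of "us @ [z]" vs x y n] that us vs by (simp add: s_def n_def)
  have neg: "s x (hneg F x) = \<one>\<^bsub>k n\<^esub>" if "x \<in> nz" for x
    using symbol_neg[of us vs x n] that us vs by (simp add: s_def n_def)
  have "hneg F (a \<otimes> b) = hneg F a \<otimes> b" "hneg F (a \<otimes> b) = hneg F b \<otimes> a"
    using a b neg_mult[of a b] neg_mult[of b a] m_comm[of a b] by simp_all
  then have "\<one>\<^bsub>k n\<^esub> = s a (hneg F a \<otimes> b) \<otimes>\<^bsub>k n\<^esub> s b (hneg F b \<otimes> a)"
    using neg[of "a \<otimes> b"] left[of a b "hneg F (a \<otimes> b)"] a b nz_mult[OF a b] neg_nz[of "a \<otimes> b"] by simp
  also have "\<dots> = s a b \<otimes>\<^bsub>k n\<^esub> s b a"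
    using neg[OF a] neg[OF b] right[of "hneg F a" b a] right[of "hneg F b" a b] neg_nz[OF a] neg_nz[OF b] s[OF a b] s[OF b a] a b
    by simp
  finally have "inv\<^bsub>k n\<^esub> s b a = s a b"
    using s[OF a b] s[OF b a] by (intro K.inv_equality) simp_all
  then show ?thesis using s[OF b a] by (simp add: s_def)
qed

lemma symbol_rotate:
  assumes "set us \<subseteq> nz" "set bs \<subseteq> nz" "a \<in> nz"
  shows "symbol F (us @ a # bs) = symbol F (us @ bs @ [a])"
  using assms
proof (induction bs arbitrary: us)
  case (Cons b bs)
  then have "symbol F (us @ a # b # bs) = symbol F ((us @ [b]) @ a # bs)" by (simp add: symbol_swap)
  also have "\<dots> = symbol F ((us @ [b]) @ bs @ [a])" using Cons by (intro Cons.IH) auto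
  finally show ?case by simp
qed simp

lemma symbol_commute:
  assumes "set as \<subseteq> nz" "set bs \<subseteq> nz"
  shows "symbol F (as @ bs) = symbol F (bs @ as)"
  using assms
proof (induction as arbitrary: bs)
  case (Cons a as)
  then have "symbol F ((a # as) @ bs) = symbol F (as @ (bs @ [a]))" using symbol_rotate[of "[]" "as @ bs" a] by simp
  also have "\<dots> = symbol F ((bs @ [a]) @ as)" using Cons by (intro Cons.IH) auto
  finally show ?case by simp
qed simp

lemma k_mult_comm:
  assumes X: "X \<in> carrier (k n)" and Y: "Y \<in> carrier (k m)"
  shows "k_mult F n m X Y = k_mult F m n Y X"
proof (rule k_hom_eqI[OF k_group k_mult_hom(1)[OF X] k_mult_hom(2)[OF X] Y])
  fix bs assume bs: "set bs \<subseteq> nz" "length bs = m"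
  then have B: "symbol F bs \<in> carrier (k m)" by simp
  have "k_mult F n m X (symbol F bs) = k_mult F m n (symbol F bs) X"
  proof (rule k_hom_eqI[OF k_group k_mult_hom(2)[OF B] k_mult_hom(1)[OF B] X])
    fix as assume "set as \<subseteq> nz" "length as = n"
    then show "k_mult F n m (symbol F as) (symbol F bs) = k_mult F m n (symbol F bs) (symbol F as)"
      using bs by (simp add: k_mult_symbol symbol_commute)
  qed
  then show "k_mult F n m X (symbol F bs) = k_mult F m n (symbol F bs) X" .
qed

end

section \<open>The inductive graded ring of a pre-special hyperfield\<close>

context psmf
begin

lemma igrp_k [simp]: "igrp (k_obj F) = k" and imult_k [simp]: "imult (k_obj F) = k_mult F"
  and itop_k: "itop (k_obj F) n = symbol F (replicate n (hneg F \<one>))"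
  and rho_eq: "rho F a = symbol F [a]"
  by (simp_all add: k_obj_def symbol_def rho_def)

lemma minus_one_nz [simp]: "set (replicate n (hneg F \<one>)) \<subseteq> nz"
  using neg_nz[OF one_nz] by (auto simp: set_replicate_conv_if)

text \<open>Associativity is inherited from concatenation of tuples.\<close>

lemma k_obj_graded: "graded_products (k_obj F)"
proof (rule graded_products.intro)
  fix n m p X Y Z
  assume X: "X \<in> carrier (igrp (k_obj F) n)"
  show "imult (k_obj F) n m X \<in> hom (igrp (k_obj F) m) (igrp (k_obj F) (n + m))"
    using k_mult_hom(1)[of X n] X by simp
  show "imult (k_obj F) 0 n (itop (k_obj F) 0) X = X"
  proof -
    have "k_mult F 0 n (symbol F []) X = (\<lambda>X. X) X"
    proof (rule k_hom_eqI[where n = n and H = "k n"])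
      show "k_mult F 0 n (symbol F []) \<in> hom (k n) (k n)"
        using k_mult_hom(1)[of "symbol F []" 0 n] by simp
      show "(\<lambda>X. X) \<in> hom (k n) (k n)" by (auto simp: hom_def)
      show "k_mult F 0 n (symbol F []) (symbol F as) = symbol F as" if "set as \<subseteq> nz" "length as = n" for as
        using k_mult_symbol[of "[]" as 0 n] that by simp
    qed (use X in auto)
    then show ?thesis by (simp add: itop_k)
  qed
  assume Y: "Y \<in> carrier (igrp (k_obj F) m)"
  show "imult (k_obj F) n m X Y = imult (k_obj F) m n Y X"
    using k_mult_comm X Y by simp
  assume Z: "Z \<in> carrier (igrp (k_obj F) p)"
  show "imult (k_obj F) (n + m) p (imult (k_obj F) n m X Y) Z = imult (k_obj F) n (m + p) X (imult (k_obj F) m p Y Z)"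
    using X Y Z by (auto elim!: k_elim simp: k_mult_class frag_concat_assoc add.assoc)
qed (simp_all add: k_comm_group itop_k)

sublocale K: graded_products "k_obj F" by (rule k_obj_graded)

lemma iprod_k:
  assumes "set as \<subseteq> nz" shows "iprod (k_obj F) (map (rho F) as) = symbol F as"
  using assms
proof (induction as)
  case (Cons a as)
  then show ?case using k_mult_symbol[of "[a]" as 1 "length as"] by (simp add: rho_eq)
qed (simp add: itop_k)

lemma rho_mult: "\<lbrakk>a \<in> nz; b \<in> nz\<rbrakk> \<Longrightarrow> rho F (a \<otimes> b) = rho F a \<otimes>\<^bsub>k 1\<^esub> rho F b"
  using symbol_mult[of "[]" "[]" a b 1] by (simp add: rho_eq)

lemma rho_in [simp]: "a \<in> nz \<Longrightarrow> rho F a \<in> carrier (k 1)" "a \<in> nz \<Longrightarrow> rho F a \<in> carrier (k (Suc 0))"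
  by (simp_all add: rho_eq)

lemma rho_one: "rho F \<one> = \<one>\<^bsub>k 1\<^esub>"
proof -
  have "rho F \<one> \<otimes>\<^bsub>k 1\<^esub> rho F \<one> = rho F \<one>" using rho_mult[OF one_nz one_nz] by simp
  then show ?thesis using k_exponent_two[OF rho_in(1)[OF one_nz]] by simp
qed

lemma k1_elim:
  assumes "X \<in> carrier (k 1)" obtains a where "a \<in> nz" "X = rho F a"
proof -
  have "\<exists>a\<in>nz. X = rho F a"
    using assms
  proof (induction rule: k_induct)
    case zero
    show ?case using rho_one one_nz by metis
  next
    case (symbol as X)
    then obtain a where a: "a \<in> nz" "X = rho F a" by blast
    obtain b where b: "as = [b]" using symbol(2) by (auto simp: length_Suc_conv)
    then have "b \<in> nz" using symbol(1) by simp
    note ab = a b this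
    then have "symbol F as \<otimes>\<^bsub>k 1\<^esub> X = rho F (b \<otimes> a)" using rho_mult[of b a] by (simp add: rho_eq)
    then show ?case using nz_mult[of b a] ab by blast
  qed
  then show thesis using that by blast
qed

text \<open>In degree 0 there are no multilinear and no Steinberg relations, so the universal property allows the empty tuple
  to be sent to the generator of \<open>\<int>/2\<close>.\<close>

lemma k0_nontrivial: "symbol F [] \<noteq> \<one>\<^bsub>k 0\<^esub>"
proof -
  interpret Z: comm_group "integer_mod_group 2" by (rule abelian_integer_mod_group)
  obtain g where g: "g \<in> hom (k 0) (integer_mod_group 2)"
    "\<And>as. \<lbrakk>set as \<subseteq> nz; length as = 0\<rbrakk> \<Longrightarrow> g (symbol F as) = 1"
  proof (rule k_universal[OF Z.comm_group_axioms, of 0 "\<lambda>_. 1"])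
    fix x assume "x \<in> carrier (integer_mod_group 2)"
    then show "x \<otimes>\<^bsub>integer_mod_group 2\<^esub> x = \<one>\<^bsub>integer_mod_group 2\<^esub>"
      by (auto simp: carrier_integer_mod_group)
  qed (auto simp: carrier_integer_mod_group)
  have "g \<one>\<^bsub>k 0\<^esub> = 0" using hom_one[OF g(1)] by simp
  then show ?thesis using g(2)[of "[]"] by auto
qed

lemma k0_cases:
  assumes "X \<in> carrier (k 0)" shows "X = \<one>\<^bsub>k 0\<^esub> \<or> X = symbol F []"
  using assms
proof (induction rule: k_induct)
  case (symbol as X)
  interpret K0: comm_group "k 0" by (rule k_comm_group)
  show ?case using symbol k_exponent_two[of "symbol F []" 0] by auto
qed simp

lemma k0_iso: "igr_ring0 (k_obj F) \<simeq> residue_ring 2"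
proof -
  interpret K0: comm_group "k 0" by (rule k_comm_group)
  let ?z = "\<one>\<^bsub>k 0\<^esub>" and ?e = "symbol F []"
  have ce: "carrier (k 0) = {?z, ?e}" using k0_cases by auto
  have e: "?e \<otimes>\<^bsub>k 0\<^esub> ?e = ?z" "k_mult F 0 0 ?e ?e = ?e"
    using k_exponent_two[of ?e 0] k_mult_symbol[of "[]" "[]" 0 0] by simp_all
  have z: "k_mult F 0 0 ?z ?z = ?z" "k_mult F 0 0 ?z ?e = ?z" "k_mult F 0 0 ?e ?z = ?z"
    using K.zero_mult[of ?z 0 0] K.zero_mult[of ?e 0 0] K.mult_zero[of ?e 0 0] by simp_all
  have "(\<lambda>X. if X = ?z then 0 else 1) \<in> ring_iso (igr_ring0 (k_obj F)) (residue_ring 2)"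
  proof (rule ring_iso_memI)
    show "bij_betw (\<lambda>X. if X = ?z then 0 else 1) (carrier (igr_ring0 (k_obj F))) (carrier (residue_ring 2))"
      using k0_nontrivial by (auto simp: bij_betw_def inj_on_def igr_ring0_def residue_ring_def ce)
  qed (use k0_nontrivial e z in \<open>auto simp: igr_ring0_def residue_ring_def ce itop_k\<close>)
  then show ?thesis by (auto simp: is_ring_iso_def)
qed

lemma ih_k: "ih (k_obj F) n = k_mult F 1 n (itop (k_obj F) 1)"
  by (simp add: k_obj_def rho_def)

lemma itop_k_in [simp]: "itop (k_obj F) n \<in> carrier (k n)"
  by (simp add: itop_k)

lemma itop_k_mult: "k_mult F d e (itop (k_obj F) d) (itop (k_obj F) e) = itop (k_obj F) (d + e)"
  by (simp add: itop_k k_mult_symbol replicate_add)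

text \<open>All structure maps are multiplication by a power of \<open>\<rho>(-1)\<close>; their compatibility
  with products is therefore a consequence of associativity and commutativity.\<close>

lemma ih_iter_k:
  assumes "X \<in> carrier (k n)"
  shows "ih_iter (k_obj F) n d X = k_mult F d n (itop (k_obj F) d) X"
proof (induction d)
  case 0
  show ?case using K.mult_one[of X n] assms by simp
next
  case (Suc d)
  show ?case
    using K.mult_assoc[of "itop (k_obj F) 1" 1 "itop (k_obj F) d" d X n] assms itop_k_mult[of 1 d]
    by (simp add: Suc ih_k add.commute)
qed

lemma ih_iter_k_mult:
  assumes X: "X \<in> carrier (k n)" and Y: "Y \<in> carrier (k m)"
  shows "k_mult F (n + d) (m + e) (ih_iter (k_obj F) n d X) (ih_iter (k_obj F) m e Y)
    = ih_iter (k_obj F) (n + m) (d + e) (k_mult F n m X Y)"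
proof -
  let ?T = "itop (k_obj F)"
  have Z: "k_mult F n m X Y \<in> carrier (k (n + m))" using K.mult_in[of X n Y m] X Y by simp
  have eY: "k_mult F e m (?T e) Y \<in> carrier (k (e + m))" using K.mult_in[of "?T e" e Y m] Y by simp
  have "k_mult F n (e + m) X (k_mult F e m (?T e) Y) = k_mult F (n + e) m (k_mult F n e X (?T e)) Y"
    using K.mult_assoc[of X n "?T e" e Y m] X Y by simp
  also have "\<dots> = k_mult F (e + n) m (k_mult F e n (?T e) X) Y"
    using K.mult_comm[of X n "?T e" e] X by (simp add: add.commute)
  also have "\<dots> = k_mult F e (n + m) (?T e) (k_mult F n m X Y)"
    using K.mult_assoc[of "?T e" e X n Y m] X Y by simp
  finally have inner: "k_mult F n (e + m) X (k_mult F e m (?T e) Y) = k_mult F e (n + m) (?T e) (k_mult F n m X Y)" .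
  have "k_mult F (d + n) (e + m) (k_mult F d n (?T d) X) (k_mult F e m (?T e) Y)
    = k_mult F d (n + (e + m)) (?T d) (k_mult F n (e + m) X (k_mult F e m (?T e) Y))"
    using K.mult_assoc[of "?T d" d X n "k_mult F e m (?T e) Y" "e + m"] X eY by simp
  also have "\<dots> = k_mult F d (e + (n + m)) (?T d) (k_mult F e (n + m) (?T e) (k_mult F n m X Y))"
    unfolding inner by (simp only: add.left_commute)
  also have "\<dots> = k_mult F (d + e) (n + m) (k_mult F d e (?T d) (?T e)) (k_mult F n m X Y)"
    using K.mult_assoc[of "?T d" d "?T e" e "k_mult F n m X Y" "n + m"] Z by simp
  finally show ?thesis
    using X Y Z by (simp add: ih_iter_k itop_k_mult add.commute)
qed

lemma k_obj_igr: "igr (k_obj F)"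
proof (rule igr.intro)
  fix n m p q x y
  show "ih (k_obj F) n \<in> hom (igrp (k_obj F) n) (igrp (k_obj F) (n + 1))"
    using k_mult_hom(1)[of "itop (k_obj F) 1" 1 n] by (simp add: ih_k)
  show "ih (k_obj F) n (itop (k_obj F) n) = itop (k_obj F) (n + 1)"
    using itop_k_mult[of 1 n] by (simp add: ih_k)
  assume x: "x \<in> carrier (igrp (k_obj F) n)"
  show "ih (k_obj F) n x = imult (k_obj F) 1 n (itop (k_obj F) 1) x"
    by (simp add: ih_k)
  show "x \<otimes>\<^bsub>igrp (k_obj F) n\<^esub> x = \<one>\<^bsub>igrp (k_obj F) n\<^esub>"
    using x k_exponent_two by simp
  assume y: "y \<in> carrier (igrp (k_obj F) m)"
  show "imult (k_obj F) n m x y \<in> carrier (igrp (k_obj F) (n + m))"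
    using x y by (rule K.mult_in)
  assume "n \<le> p" "m \<le> q"
  then show "imult (k_obj F) p q (ih_iter (k_obj F) n (p - n) x) (ih_iter (k_obj F) m (q - m) y)
      = ih_iter (k_obj F) (n + m) (p + q - (n + m)) (imult (k_obj F) n m x y)"
    using ih_iter_k_mult[of x n y m "p - n" "q - m"] x y by simp
qed (simp_all add: k0_iso k_comm_group K.igr_ring_cring)

lemma k_generated:
  assumes "X \<in> carrier (k n)"
  shows "\<exists>(m::nat) c. (\<forall>i<m. length (c i) = n \<and> set (c i) \<subseteq> carrier (k 1)) \<and>
        X = finprod (k n) (\<lambda>i. iprod (k_obj F) (c i)) {..<m}"
  using assms
proof (induction rule: k_induct)
  interpret Kn: comm_group "k n" by (rule k_comm_group)
  case zero
  show ?case by (intro exI[of _ 0]) simp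
next
  interpret Kn: comm_group "k n" by (rule k_comm_group)
  case (symbol as X)
  then obtain m :: nat and c where c: "\<forall>i<m. length (c i) = n \<and> set (c i) \<subseteq> carrier (k 1)"
    "X = finprod (k n) (\<lambda>i. iprod (k_obj F) (c i)) {..<m}" by blast
  \<comment> \<open>The new word is appended as the summand with index \<open>m\<close>.\<close>
  define c' where "c' = c(m := map (rho F) as)"
  have in_n: "iprod (k_obj F) bs \<in> carrier (k (length bs))" if "set bs \<subseteq> carrier (k 1)" for bs
    using that
  proof (induction bs)
    case (Cons b bs)
    then show ?case using K.mult_in[of b 1 "iprod (k_obj F) bs" "length bs"] by simp
  qed (simp add: itop_k)
  have new: "\<forall>i<Suc m. length (c' i) = n \<and> set (c' i) \<subseteq> carrier (k 1)"
  proof -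
    have "rho F a \<in> carrier (k 1)" if "a \<in> set as" for a
      using that symbol(1) rho_in(1)[of a] by blast
    then have "set (map (rho F) as) \<subseteq> carrier (k 1)" by (auto simp only: set_map)
    then show ?thesis using c(1) symbol(2) by (simp add: c'_def less_Suc_eq)
  qed
  have "finprod (k n) (\<lambda>i. iprod (k_obj F) (c' i)) {..<Suc m}
     = iprod (k_obj F) (c' m) \<otimes>\<^bsub>k n\<^esub> finprod (k n) (\<lambda>i. iprod (k_obj F) (c' i)) {..<m}"
    unfolding lessThan_Suc using new in_n[of "c' _"] by (intro Kn.finprod_insert) (auto simp: less_Suc_eq)
  also have "finprod (k n) (\<lambda>i. iprod (k_obj F) (c' i)) {..<m} = X"
    unfolding c(2) using c(1) in_n by (intro Kn.finprod_cong') (auto simp: c'_def)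
  also have "iprod (k_obj F) (c' m) = symbol F as" using symbol by (simp add: c'_def iprod_k)
  finally have "symbol F as \<otimes>\<^bsub>k n\<^esub> X = finprod (k n) (\<lambda>i. iprod (k_obj F) (c' i)) {..<Suc m}" by simp
  then show ?case using new by blast
qed

text \<open>The relation \<open>(\<top>\<^sub>1 + a)a = 0\<close> says that \<open>{-b, b} = 0\<close> for \<open>a = \<rho>(b)\<close>.\<close>

theorem k_obj_igr_plus: "igr_plus (k_obj F)"
proof (rule igr_plus.intro[OF k_obj_igr], rule igr_plus_axioms.intro)
  fix n x assume "x \<in> carrier (igrp (k_obj F) n)"
  then show "\<exists>(m::nat) c. (\<forall>i<m. length (c i) = n \<and> set (c i) \<subseteq> carrier (igrp (k_obj F) 1)) \<and>
        x = finprod (igrp (k_obj F) n) (\<lambda>i. iprod (k_obj F) (c i)) {..<m}"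
    using k_generated[of x n] by simp
next
  fix a assume "a \<in> carrier (igrp (k_obj F) 1)"
  then obtain b where b: "b \<in> nz" "a = rho F b" using k1_elim by auto
  have m1: "hneg F \<one> \<in> nz" using neg_nz[OF one_nz] .
  have "itop (k_obj F) 1 \<otimes>\<^bsub>k 1\<^esub> a = rho F (hneg F b)"
    using rho_mult[OF m1 b(1)] neg_eq[of b] b by (simp add: itop_k rho_eq)
  moreover have "k_mult F 1 1 (rho F (hneg F b)) (rho F b) = symbol F [hneg F b, b]"
    using k_mult_symbol[of "[hneg F b]" "[b]" 1 1] b neg_nz[OF b(1)] by (simp add: rho_eq)
  moreover have "symbol F [hneg F b, b] = \<one>\<^bsub>k 2\<^esub>"
    using symbol_neg[of "[]" "[]" "hneg F b" 2] neg_nz[OF b(1)] b by simp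
  ultimately show "imult (k_obj F) 1 1 (itop (k_obj F) 1 \<otimes>\<^bsub>igrp (k_obj F) 1\<^esub> a) a = \<one>\<^bsub>igrp (k_obj F) 2\<^esub>"
    using b by simp
qed

end

section \<open>The hyperfield of an inductive graded ring\<close>

text \<open>From here on the degree 1 stays written as \<open>1\<close>, so that the group laws of degree 1, stated with
  that numeral, keep matching during simplification.\<close>

declare One_nat_def [simp del]

lemma (in comm_group) exponent_two_cancel:
  assumes "\<And>x. x \<in> carrier G \<Longrightarrow> x \<otimes> x = \<one>" "x \<in> carrier G" "y \<in> carrier G"
  shows "x \<otimes> (x \<otimes> y) = y"
  using assms by (simp add: m_assoc[symmetric])

sublocale igr \<subseteq> gr: graded_products R by (rule graded_products)

sublocale igr \<subseteq> A: comm_group "igrp R 1" by (rule grp)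

sublocale igr \<subseteq> B: comm_group "igrp R 2" by (rule grp)

context igr_plus
begin

abbreviation R1 where "R1 \<equiv> carrier (igrp R 1)"
abbreviation R2 where "R2 \<equiv> carrier (igrp R 2)"
abbreviation plus1 (infixl "+\<^sub>1" 65) where "a +\<^sub>1 b \<equiv> a \<otimes>\<^bsub>igrp R 1\<^esub> b"
abbreviation plus2 (infixl "+\<^sub>2" 65) where "x +\<^sub>2 y \<equiv> x \<otimes>\<^bsub>igrp R 2\<^esub> y"
abbreviation times (infixl "*\<^sub>1" 70) where "a *\<^sub>1 b \<equiv> imult R 1 1 a b"
abbreviation t where "t \<equiv> itop R 1"

lemmas cancel1 = A.exponent_two_cancel[OF exponent_two]
lemmas cancel2 = B.exponent_two_cancel[OF exponent_two]

lemma times_in [simp]: "\<lbrakk>a \<in> R1; b \<in> R1\<rbrakk> \<Longrightarrow> a *\<^sub>1 b \<in> R2"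
  using gr.mult_in[of a 1 b 1] by (simp only: one_add_one)

lemma times_plus: "\<lbrakk>a \<in> R1; b \<in> R1; c \<in> R1\<rbrakk> \<Longrightarrow> a *\<^sub>1 (b +\<^sub>1 c) = a *\<^sub>1 b +\<^sub>2 a *\<^sub>1 c"
  using gr.distrib_left[of a 1 b 1 c] by (simp only: one_add_one)

lemma plus_times: "\<lbrakk>a \<in> R1; b \<in> R1; c \<in> R1\<rbrakk> \<Longrightarrow> (a +\<^sub>1 b) *\<^sub>1 c = a *\<^sub>1 c +\<^sub>2 b *\<^sub>1 c"
  using gr.distrib_right[of a 1 b c 1] by (simp only: one_add_one)

lemma times_zero [simp]: "a \<in> R1 \<Longrightarrow> a *\<^sub>1 \<one>\<^bsub>igrp R 1\<^esub> = \<one>\<^bsub>igrp R 2\<^esub>"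
  using gr.mult_zero[of a 1 1] by (simp only: one_add_one)

lemma zero_times [simp]: "a \<in> R1 \<Longrightarrow> \<one>\<^bsub>igrp R 1\<^esub> *\<^sub>1 a = \<one>\<^bsub>igrp R 2\<^esub>"
  using gr.zero_mult[of a 1 1] by (simp only: one_add_one)

lemma times_comm: "\<lbrakk>a \<in> R1; b \<in> R1\<rbrakk> \<Longrightarrow> a *\<^sub>1 b = b *\<^sub>1 a"
  by (rule gr.mult_comm)

text \<open>The second axiom of \<open>Igr\<^sub>+\<close>, solved for the square.\<close>

lemma times_self: "a \<in> R1 \<Longrightarrow> a *\<^sub>1 a = t *\<^sub>1 a"
  using top_plus[of a] plus_times[of t a a] top_closed[of 1] cancel2[of "t *\<^sub>1 a" "a *\<^sub>1 a"]
    times_in[of t a] times_in[of a a] by (metis B.r_one)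

lemma plus_eq_zero_iff2: "\<lbrakk>x \<in> R2; y \<in> R2\<rbrakk> \<Longrightarrow> x +\<^sub>2 y = \<one>\<^bsub>igrp R 2\<^esub> \<longleftrightarrow> x = y"
  using cancel2[of x y] exponent_two[of x 2] by (metis B.r_one)

lemma Gamma_simps [simp]:
  "carrier (Gamma R) = insert GZero (G_set R)" "\<one>\<^bsub>Gamma R\<^esub> = e_of \<one>\<^bsub>igrp R 1\<^esub>"
  "hzero (Gamma R) = GZero" "hneg (Gamma R) = G_neg R" "hadd (Gamma R) = G_add R"
  "monoid.mult (Gamma R) = G_mult R"
  by (simp_all add: Gamma_def)

lemma e_of_in [simp]: "e_of a \<in> G_set R \<longleftrightarrow> a \<in> R1" "GZero \<notin> G_set R"
  by (auto simp: G_set_def)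

lemma Gamma_cases:
  assumes "x \<in> carrier (Gamma R)"
  obtains (zero) "x = GZero" | (unit) a where "a \<in> R1" "x = e_of a"
  using assms by (auto simp: G_set_def)

lemma G_mult_simps [simp]:
  "G_mult R GZero x = GZero" "G_mult R x GZero = GZero" "G_mult R (e_of a) (e_of b) = e_of (a +\<^sub>1 b)"
  by (simp_all add: G_mult_def)

lemma G_neg_simps [simp]: "G_neg R GZero = GZero" "G_neg R (e_of a) = e_of (t +\<^sub>1 a)"
  by (simp_all add: G_neg_def)

lemma G_add_zero [simp]: "G_add R GZero x = {x}" "G_add R x GZero = {x}"
  by (auto simp: G_add_def)

lemma zero_in_G_add_iff [simp]: "GZero \<in> G_add R (e_of a) (e_of b) \<longleftrightarrow> a = t +\<^sub>1 b"
  by (auto simp: G_add_def)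

text \<open>The second witness in the definition of the sum is forced to be \<open>d = a + b + c\<close>, and
  \<open>cd = c(a + b + \<top>\<^sub>1)\<close> because \<open>cc = \<top>\<^sub>1c\<close>. If \<open>a = \<top>\<^sub>1 + b\<close>, both sides of the equation are zero, in
  accordance with the convention that \<open>e(b) - e(b)\<close> is everything.\<close>

lemma e_of_in_G_add_iff:
  assumes a: "a \<in> R1" and b: "b \<in> R1"
  shows "e_of c \<in> G_add R (e_of a) (e_of b) \<longleftrightarrow> c \<in> R1 \<and> a *\<^sub>1 b = c *\<^sub>1 (a +\<^sub>1 b +\<^sub>1 t)"
proof (cases "a = t +\<^sub>1 b")
  case True
  have "(t +\<^sub>1 b) *\<^sub>1 b = \<one>\<^bsub>igrp R 2\<^esub>" by (rule top_plus[OF b])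
  moreover have "t +\<^sub>1 b +\<^sub>1 b +\<^sub>1 t = \<one>\<^bsub>igrp R 1\<^esub>"
    using b top_closed[of 1] exponent_two[of b 1] exponent_two[of t 1] by (simp add: A.m_assoc)
  ultimately show ?thesis using True by (auto simp: G_add_def)
next
  case False
  have *: "(a +\<^sub>1 b = c +\<^sub>1 d \<and> a *\<^sub>1 b = c *\<^sub>1 d) \<longleftrightarrow> (d = a +\<^sub>1 b +\<^sub>1 c \<and> a *\<^sub>1 b = c *\<^sub>1 (a +\<^sub>1 b +\<^sub>1 t))"
    if c: "c \<in> R1" and d: "d \<in> R1" for d
  proof -
    have "a +\<^sub>1 b = c +\<^sub>1 d \<longleftrightarrow> d = a +\<^sub>1 b +\<^sub>1 c"
    proof
      assume "a +\<^sub>1 b = c +\<^sub>1 d"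
      then show "d = a +\<^sub>1 b +\<^sub>1 c" using c d cancel1[of c d] by (simp add: A.m_comm)
    next
      assume "d = a +\<^sub>1 b +\<^sub>1 c"
      then show "a +\<^sub>1 b = c +\<^sub>1 d" using c a b cancel1[of c "a +\<^sub>1 b"] by (simp add: A.m_comm)
    qed
    moreover have "c *\<^sub>1 (a +\<^sub>1 b +\<^sub>1 c) = c *\<^sub>1 (a +\<^sub>1 b +\<^sub>1 t)"
      using a b c top_closed[of 1] times_self[OF c] times_comm[of t c] by (simp add: times_plus)
    ultimately show ?thesis by auto
  qed
  show ?thesis
  proof
    assume "e_of c \<in> G_add R (e_of a) (e_of b)"
    then show "c \<in> R1 \<and> a *\<^sub>1 b = c *\<^sub>1 (a +\<^sub>1 b +\<^sub>1 t)"
      using False * by (auto simp: G_add_def G_set_def)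
  next
    assume "c \<in> R1 \<and> a *\<^sub>1 b = c *\<^sub>1 (a +\<^sub>1 b +\<^sub>1 t)"
    then show "e_of c \<in> G_add R (e_of a) (e_of b)"
      using False *[of "a +\<^sub>1 b +\<^sub>1 c"] a b by (auto simp: G_add_def intro!: bexI[of _ "e_of (a +\<^sub>1 b +\<^sub>1 c)"])
  qed
qed

lemma G_add_closed: "\<lbrakk>x \<in> carrier (Gamma R); y \<in> carrier (Gamma R)\<rbrakk> \<Longrightarrow> G_add R x y \<subseteq> carrier (Gamma R)"
  by (auto simp: G_add_def G_set_def)

lemma G_add_eqI:
  assumes "x \<in> carrier (Gamma R)" "y \<in> carrier (Gamma R)" "x' \<in> carrier (Gamma R)" "y' \<in> carrier (Gamma R)"
    and "GZero \<in> G_add R x y \<longleftrightarrow> GZero \<in> G_add R x' y'"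
    and "\<And>c. c \<in> R1 \<Longrightarrow> e_of c \<in> G_add R x y \<longleftrightarrow> e_of c \<in> G_add R x' y'"
  shows "G_add R x y = G_add R x' y'"
  using G_add_closed[OF assms(1,2)] G_add_closed[OF assms(3,4)] assms(5,6)
  by (auto simp: G_set_def subset_iff)

text \<open>In coordinates, reversibility says that \<open>ab = ca + cb + c\<top>\<^sub>1\<close> implies
  \<open>c(\<top>\<^sub>1 + b) = a(c + b)\<close>, which is the same equation with its terms regrouped.\<close>

lemma Gamma_multigroup: "comm_multigroup_no_assoc (Gamma R)"
proof (rule comm_multigroup_no_assoc.intro)
  fix x y z assume x: "x \<in> carrier (Gamma R)"
  show "hneg (Gamma R) x \<in> carrier (Gamma R)"
    using x top_closed[of 1] by (cases rule: Gamma_cases) auto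
  show "hadd (Gamma R) x (hzero (Gamma R)) = {x}" by simp
  assume y: "y \<in> carrier (Gamma R)"
  show "hadd (Gamma R) x y \<subseteq> carrier (Gamma R)" using G_add_closed x y by simp
  from x show "hadd (Gamma R) x y \<noteq> {}"
  proof (cases rule: Gamma_cases)
    case (unit a)
    from y show ?thesis
    proof (cases rule: Gamma_cases)
      case (unit b)
      have "a *\<^sub>1 b = a *\<^sub>1 (a +\<^sub>1 b +\<^sub>1 t)"
        using \<open>a \<in> R1\<close> unit top_closed[of 1] times_self[of a] times_comm[of a t] cancel2[of "t *\<^sub>1 a" "a *\<^sub>1 b"]
        by (simp add: times_plus B.m_ac)
      then have "e_of a \<in> G_add R (e_of a) (e_of b)" using \<open>a \<in> R1\<close> unit by (simp add: e_of_in_G_add_iff)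
      then show ?thesis using \<open>x = e_of a\<close> unit by auto
    qed simp
  qed simp
  from x y show "hadd (Gamma R) x y = hadd (Gamma R) y x"
  proof (cases x rule: Gamma_cases[case_product Gamma_cases[where x = y]])
    case (unit_unit a b)
    show ?thesis
      unfolding Gamma_simps
    proof (rule G_add_eqI[OF x y y x])
      show "GZero \<in> G_add R x y \<longleftrightarrow> GZero \<in> G_add R y x"
        using unit_unit top_closed[of 1] cancel1[of t a] cancel1[of t b] by auto
      show "e_of c \<in> G_add R x y \<longleftrightarrow> e_of c \<in> G_add R y x" for c
        using unit_unit by (simp add: e_of_in_G_add_iff times_comm[of a b] A.m_comm[of a b])
    qed
  qed simp_all
  assume z: "z \<in> hadd (Gamma R) x y"
  have zc: "z \<in> carrier (Gamma R)" using z G_add_closed[OF x y] by auto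
  have rev: "x \<in> G_add R z (G_neg R y)" if x: "x \<in> carrier (Gamma R)" and y: "y \<in> carrier (Gamma R)"
    and z: "z \<in> G_add R x y" for x y
    using x
  proof (cases rule: Gamma_cases)
    case zero
    then show ?thesis
      using y z top_closed[of 1] by (cases rule: Gamma_cases[OF y]) (simp_all add: cancel1 exponent_two)
  next
    case (unit a)
    note a = unit
    from y show ?thesis
    proof (cases rule: Gamma_cases)
      case (unit b)
      note b = unit
      from zc show ?thesis
      proof (cases rule: Gamma_cases)
        case zero
        then show ?thesis using z a b by simp
      next
        case (unit c)
        have hyp: "a *\<^sub>1 b = c *\<^sub>1 a +\<^sub>2 c *\<^sub>1 b +\<^sub>2 c *\<^sub>1 t"
          using z a b unit top_closed[of 1] by (simp add: e_of_in_G_add_iff times_plus)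
        have "a *\<^sub>1 (c +\<^sub>1 (t +\<^sub>1 b) +\<^sub>1 t) = a *\<^sub>1 (c +\<^sub>1 b)"
          using a b unit top_closed[of 1] by (simp add: A.m_ac cancel1 exponent_two)
        also have "\<dots> = c *\<^sub>1 a +\<^sub>2 a *\<^sub>1 b" using a b unit by (simp add: times_plus times_comm[of a c])
        also have "\<dots> = c *\<^sub>1 (t +\<^sub>1 b)"
          unfolding hyp using a b unit top_closed[of 1] by (simp add: times_plus B.m_ac cancel2 exponent_two)
        finally show ?thesis using a b unit top_closed[of 1] by (simp add: e_of_in_G_add_iff)
      qed
    qed (use z a in simp)
  qed
  have "z \<in> G_add R y x" using z \<open>hadd (Gamma R) x y = hadd (Gamma R) y x\<close> by simp
  then show "x \<in> hadd (Gamma R) z (hneg (Gamma R) y) \<and> y \<in> hadd (Gamma R) z (hneg (Gamma R) x)"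
    using rev[OF x y] rev[OF y x] z by simp
qed simp

lemma Gamma_comm_monoid: "comm_monoid (Gamma R)"
proof (rule comm_monoidI)
  fix x y z
  assume "x \<in> carrier (Gamma R)" "y \<in> carrier (Gamma R)" "z \<in> carrier (Gamma R)"
  then show "x \<otimes>\<^bsub>Gamma R\<^esub> y \<otimes>\<^bsub>Gamma R\<^esub> z = x \<otimes>\<^bsub>Gamma R\<^esub> (y \<otimes>\<^bsub>Gamma R\<^esub> z)"
    by (auto simp: G_set_def A.m_assoc)
next
  fix x y
  assume "x \<in> carrier (Gamma R)" "y \<in> carrier (Gamma R)"
  then show "x \<otimes>\<^bsub>Gamma R\<^esub> y = y \<otimes>\<^bsub>Gamma R\<^esub> x" "x \<otimes>\<^bsub>Gamma R\<^esub> y \<in> carrier (Gamma R)"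
    by (auto simp: G_set_def A.m_comm)
qed (auto simp: G_set_def)

text \<open>For nonzero arguments, replacing \<open>a\<close>, \<open>b\<close>, \<open>c\<close> by \<open>a + d\<close>, \<open>b + d\<close>, \<open>c + d\<close> leaves \<open>a + b + \<top>\<^sub>1\<close> fixed
  and adds \<open>d(a + b + \<top>\<^sub>1)\<close> to both sides of the equation \<open>ab = c(a + b + \<top>\<^sub>1)\<close>.\<close>

lemma G_add_mult:
  assumes "x \<in> carrier (Gamma R)" "y \<in> carrier (Gamma R)" "w \<in> carrier (Gamma R)" "z \<in> G_add R x y"
  shows "G_mult R z w \<in> G_add R (G_mult R x w) (G_mult R y w)"
proof -
  have z: "z \<in> carrier (Gamma R)" using G_add_closed[OF assms(1,2)] assms(4) by blast
  show ?thesis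
  proof (cases "w = GZero \<or> x = GZero \<or> y = GZero")
    case True
    then show ?thesis using assms by auto
  next
    case False
    then obtain a b d where abd: "a \<in> R1" "b \<in> R1" "d \<in> R1" "x = e_of a" "y = e_of b" "w = e_of d"
      using assms by (auto simp: G_set_def)
    have add: "a +\<^sub>1 d +\<^sub>1 (b +\<^sub>1 d) = a +\<^sub>1 b" using abd by (simp add: A.m_ac cancel1 exponent_two)
    from z show ?thesis
    proof (cases rule: Gamma_cases)
      case zero
      then show ?thesis using assms abd top_closed[of 1] by (simp add: A.m_assoc)
    next
      case (unit c)
      then have hyp: "a *\<^sub>1 b = c *\<^sub>1 (a +\<^sub>1 b +\<^sub>1 t)"
        using assms(4) abd by (simp add: e_of_in_G_add_iff)
      have "(a +\<^sub>1 d) *\<^sub>1 (b +\<^sub>1 d) = a *\<^sub>1 b +\<^sub>2 d *\<^sub>1 (a +\<^sub>1 b +\<^sub>1 t)"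
        using abd top_closed[of 1] times_self[of d]
        by (simp add: times_plus plus_times times_comm[of a d] times_comm[of d t] B.m_ac)
      also have "\<dots> = (c +\<^sub>1 d) *\<^sub>1 (a +\<^sub>1 b +\<^sub>1 t)"
        unfolding hyp using abd unit top_closed[of 1] by (simp add: plus_times)
      finally show ?thesis using abd unit by (simp add: e_of_in_G_add_iff add)
    qed
  qed
qed

text \<open>The dictionary between \<open>1 - e(a)\<close> and the annihilator of \<open>a\<close>. It gives the closure of \<open>1 - e(a)\<close> under
  products, and later the Steinberg relation for maps into \<open>\<Gamma>(R)\<close>.\<close>

lemma G_one_minus_iff:
  assumes "a \<in> R1"
  shows "x \<in> G_add R (e_of \<one>\<^bsub>igrp R 1\<^esub>) (e_of (t +\<^sub>1 a)) \<longleftrightarrow>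
    (x = GZero \<and> a = \<one>\<^bsub>igrp R 1\<^esub>) \<or> (\<exists>c\<in>R1. x = e_of c \<and> c *\<^sub>1 a = \<one>\<^bsub>igrp R 2\<^esub>)"
proof -
  have "\<one>\<^bsub>igrp R 1\<^esub> +\<^sub>1 (t +\<^sub>1 a) +\<^sub>1 t = a"
    using assms top_closed[of 1] by (simp add: A.m_ac cancel1 exponent_two)
  then show ?thesis
    using assms top_closed[of 1] by (cases x) (auto simp: e_of_in_G_add_iff cancel1 exponent_two)
qed

theorem Gamma_pre_special: "pre_special_up_to_assoc (Gamma R)"
  unfolding pre_special_up_to_assoc_def
proof (intro conjI)
  show "multiring_axioms (Gamma R)"
  proof
    fix a b c d
    assume abd: "a \<in> carrier (Gamma R)" "b \<in> carrier (Gamma R)" "d \<in> carrier (Gamma R)" "c \<in> hadd (Gamma R) a b"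
    have c: "c \<in> carrier (Gamma R)" using G_add_closed[OF abd(1,2)] abd(4) by auto
    have "c \<otimes>\<^bsub>Gamma R\<^esub> d \<in> hadd (Gamma R) (a \<otimes>\<^bsub>Gamma R\<^esub> d) (b \<otimes>\<^bsub>Gamma R\<^esub> d)"
      using G_add_mult[OF abd(1,2,3)] abd(4) by simp
    then show "c \<otimes>\<^bsub>Gamma R\<^esub> d \<in> hadd (Gamma R) (a \<otimes>\<^bsub>Gamma R\<^esub> d) (b \<otimes>\<^bsub>Gamma R\<^esub> d) \<and>
        d \<otimes>\<^bsub>Gamma R\<^esub> c \<in> hadd (Gamma R) (d \<otimes>\<^bsub>Gamma R\<^esub> a) (d \<otimes>\<^bsub>Gamma R\<^esub> b)"
      using comm_monoid.m_comm[OF Gamma_comm_monoid] abd c by metis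
  qed simp
  show "hyperfield_axioms (Gamma R)"
  proof
    fix a assume "a \<in> carrier (Gamma R)" "a \<noteq> hzero (Gamma R)"
    then obtain b where "b \<in> R1" "a = e_of b" by (auto simp: G_set_def)
    then show "a \<in> Units (Gamma R)"
      using exponent_two[of b 1] by (auto simp: Units_def G_set_def intro!: bexI[of _ "e_of b"])
  qed simp
  show "pre_special_hyperfield_axioms (Gamma R)"
  proof
    show "hdiff (Gamma R) \<one>\<^bsub>Gamma R\<^esub> \<one>\<^bsub>Gamma R\<^esub> = carrier (Gamma R)"
      using G_one_minus_iff[of "\<one>\<^bsub>igrp R 1\<^esub>"] by (auto simp: hdiff_def G_set_def)
    fix a assume "a \<in> carrier (Gamma R)" "a \<noteq> hzero (Gamma R)"
    then obtain b where b: "b \<in> R1" "a = e_of b" by (auto simp: G_set_def)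
    show "a \<otimes>\<^bsub>Gamma R\<^esub> a = \<one>\<^bsub>Gamma R\<^esub>" using b exponent_two[of b 1] by simp
    show "hdiff (Gamma R) \<one>\<^bsub>Gamma R\<^esub> a <#>\<^bsub>Gamma R\<^esub> hdiff (Gamma R) \<one>\<^bsub>Gamma R\<^esub> a \<subseteq> hdiff (Gamma R) \<one>\<^bsub>Gamma R\<^esub> a"
      using b by (auto simp: hdiff_def set_mult_def G_one_minus_iff plus_times)
  qed
qed (rule Gamma_multigroup Gamma_comm_monoid)+

end

lemma Gamma_map_simps:
  "Gamma_map R f GZero = GZero" "a \<in> carrier (igrp R 1) \<Longrightarrow> Gamma_map R f (e_of a) = e_of (f 1 a)"
  by (auto simp: Gamma_map_def Gamma_def G_set_def)

lemma Gamma_map_hom: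
  assumes "igr_plus R" "igr_plus S" "f \<in> hom_igr R S"
  shows "Gamma_map R f \<in> hom_psmf (Gamma R) (Gamma S)"
proof -
  interpret R: igr_plus R by fact
  interpret S: igr_plus S by fact
  have f: "f n \<in> hom (igrp R n) (igrp S n)" "f n (itop R n) = itop S n"
    "\<And>m x y. \<lbrakk>x \<in> carrier (igrp R n); y \<in> carrier (igrp R m)\<rbrakk> \<Longrightarrow> f (n + m) (imult R n m x y) = imult S n m (f n x) (f m y)" for n
    using assms(3) unfolding hom_igr_iff[OF R.graded_products S.graded_products] by blast+
  have f_in [simp]: "f n x \<in> carrier (igrp S n)" if "x \<in> carrier (igrp R n)" for n x
    using f(1) that by (rule hom_in_carrier)
  have f_add [simp]: "f 1 (R.plus1 a b) = S.plus1 (f 1 a) (f 1 b)" if "a \<in> R.R1" "b \<in> R.R1" for a b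
    using f(1) that by (rule hom_mult)
  have f_zero [simp]: "f 1 \<one>\<^bsub>igrp R 1\<^esub> = \<one>\<^bsub>igrp S 1\<^esub>" using hom_one[OF f(1)] by simp
  have f_mult: "f 2 (R.times a b) = S.times (f 1 a) (f 1 b)" if "a \<in> R.R1" "b \<in> R.R1" for a b
    using f(3)[OF that] by (simp only: one_add_one)
  note simps = Gamma_map_simps R.Gamma_simps S.Gamma_simps
  have add: "Gamma_map R f z \<in> G_add S (Gamma_map R f x) (Gamma_map R f y)"
    if x: "x \<in> carrier (Gamma R)" and y: "y \<in> carrier (Gamma R)" and z: "z \<in> G_add R x y" for x y z
  proof (cases "x = GZero \<or> y = GZero")
    case True
    then show ?thesis using z by (auto simp: Gamma_map_simps)
  next
    case False
    then obtain a b where ab: "a \<in> R.R1" "b \<in> R.R1" "x = e_of a" "y = e_of b"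
      using x y by (auto simp: G_set_def)
    have "z \<in> carrier (Gamma R)" using R.G_add_closed[OF x y] z by blast
    then show ?thesis
    proof (cases rule: R.Gamma_cases)
      case zero
      then show ?thesis using z ab R.top_closed[of 1] f(2)[of 1] f_add[of "itop R 1" b]
        by (simp add: Gamma_map_simps)
    next
      case (unit c)
      then have "f 2 (R.times a b) = f 2 (R.times c (R.plus1 (R.plus1 a b) (itop R 1)))"
        using z ab by (simp add: R.e_of_in_G_add_iff)
      then have "S.times (f 1 a) (f 1 b) = S.times (f 1 c) (S.plus1 (S.plus1 (f 1 a) (f 1 b)) (itop S 1))"
        using ab unit R.top_closed[of 1] f(2)[of 1] R.A.m_closed by (simp only: f_mult f_add)
      then show ?thesis
        using ab unit f_in[of _ 1] by (simp add: Gamma_map_simps S.e_of_in_G_add_iff)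
    qed
  qed
  show ?thesis
    unfolding hom_psmf_def
  proof (intro CollectI conjI ballI)
    show "Gamma_map R f \<in> carrier (Gamma R) \<rightarrow>\<^sub>E carrier (Gamma S)"
      using f_in[of _ 1] by (auto simp: Gamma_map_def G_set_def)
    show "Gamma_map R f \<one>\<^bsub>Gamma R\<^esub> = \<one>\<^bsub>Gamma S\<^esub>"
      using f_zero by (simp add: Gamma_map_simps)
    fix x assume x: "x \<in> carrier (Gamma R)"
    then show "Gamma_map R f (hneg (Gamma R) x) = hneg (Gamma S) (Gamma_map R f x)"
      using R.top_closed[of 1] f(2)[of 1] f_add[of "itop R 1"]
      by (cases rule: R.Gamma_cases) (simp_all add: Gamma_map_simps)
    fix y assume y: "y \<in> carrier (Gamma R)"
    show "Gamma_map R f (x \<otimes>\<^bsub>Gamma R\<^esub> y) = Gamma_map R f x \<otimes>\<^bsub>Gamma S\<^esub> Gamma_map R f y"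
      using x y f_add by (auto simp: Gamma_map_simps G_set_def)
    show "Gamma_map R f ` hadd (Gamma R) x y \<subseteq> hadd (Gamma S) (Gamma_map R f x) (Gamma_map R f y)"
      using add[OF x y] by auto
  qed (simp add: Gamma_map_simps)
qed

lemma Gamma_map_id: "Gamma_map R (id_igr R) = id_psmf (Gamma R)"
  by (auto simp: Gamma_map_def id_igr_def id_psmf_def Gamma_def G_set_def fun_eq_iff restrict_def)

lemma Gamma_map_comp:
  assumes "f \<in> hom_igr R S"
  shows "Gamma_map R (comp_igr R g f) = compose (carrier (Gamma R)) (Gamma_map S g) (Gamma_map R f)"
proof -
  have "f 1 \<in> hom (igrp R 1) (igrp S 1)" using assms by (simp add: hom_igr_def)
  then have "f 1 a \<in> carrier (igrp S 1)" if "a \<in> carrier (igrp R 1)" for a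
    using that by (rule hom_in_carrier)
  then show ?thesis
    by (auto simp: Gamma_map_def comp_igr_def compose_def Gamma_def G_set_def fun_eq_iff restrict_def)
qed

section \<open>Composition of morphisms\<close>

lemma hom_igr_mult:
  assumes "graded_products R" "graded_products S" "f \<in> hom_igr R S"
    and "x \<in> carrier (igrp R n)" "y \<in> carrier (igrp R m)"
  shows "f (n + m) (imult R n m x y) = imult S n m (f n x) (f m y)"
  using assms(3-5) unfolding hom_igr_iff[OF assms(1,2)] by blast

lemma id_igr_hom:
  assumes R: "graded_products R" and top: "\<And>n. itop R n \<in> carrier (igrp R n)"
  shows "id_igr R \<in> hom_igr R R"
proof -
  interpret graded_products R by fact
  show ?thesis
    unfolding hom_igr_iff[OF R R] using top by (auto simp: id_igr_def hom_def)
qed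

lemma comp_igr_hom:
  assumes "graded_products R" "graded_products S" "graded_products T" "\<And>n. itop R n \<in> carrier (igrp R n)"
    and f: "f \<in> hom_igr R S" and g: "g \<in> hom_igr S T"
  shows "comp_igr R g f \<in> hom_igr R T"
proof -
  interpret R: graded_products R by fact
  note f = f[unfolded hom_igr_iff[OF assms(1,2)]] and g = g[unfolded hom_igr_iff[OF assms(2,3)]]
  have fh: "f n \<in> hom (igrp R n) (igrp S n)" and gh: "g n \<in> hom (igrp S n) (igrp T n)" for n
    using f g by blast+
  have f_in: "f n x \<in> carrier (igrp S n)" if "x \<in> carrier (igrp R n)" for n x
    using hom_in_carrier[OF fh that] .
  have "compose (carrier (igrp R n)) (g n) (f n) \<in> hom (igrp R n) (igrp T n)" for n
  proof (rule homI)
    fix x y assume xy: "x \<in> carrier (igrp R n)" "y \<in> carrier (igrp R n)"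
    then show "compose (carrier (igrp R n)) (g n) (f n) (x \<otimes>\<^bsub>igrp R n\<^esub> y) =
        compose (carrier (igrp R n)) (g n) (f n) x \<otimes>\<^bsub>igrp T n\<^esub> compose (carrier (igrp R n)) (g n) (f n) y"
      using hom_mult[OF fh xy] hom_mult[OF gh f_in[OF xy(1)] f_in[OF xy(2)]] by (simp add: compose_def)
  qed (auto simp: compose_def intro!: hom_in_carrier[OF gh] f_in)
  moreover have "g (n + m) (f (n + m) (imult R n m x y)) = imult T n m (g n (f n x)) (g m (f m y))"
    if "x \<in> carrier (igrp R n)" "y \<in> carrier (igrp R m)" for n m x y
    using f g f_in that by metis
  ultimately show ?thesis
    unfolding hom_igr_iff[OF assms(1,3)] using f g assms(4) by (auto simp: comp_igr_def compose_def)
qed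

lemma hom_psmfD:
  assumes "u \<in> hom_psmf F L"
  shows "x \<in> carrier F \<Longrightarrow> u x \<in> carrier L" "u (hzero F) = hzero L" "u \<one>\<^bsub>F\<^esub> = \<one>\<^bsub>L\<^esub>"
    "x \<in> carrier F \<Longrightarrow> u (hneg F x) = hneg L (u x)"
    "\<lbrakk>x \<in> carrier F; y \<in> carrier F\<rbrakk> \<Longrightarrow> u (x \<otimes>\<^bsub>F\<^esub> y) = u x \<otimes>\<^bsub>L\<^esub> u y"
    "\<lbrakk>x \<in> carrier F; y \<in> carrier F; z \<in> hadd F x y\<rbrakk> \<Longrightarrow> u z \<in> hadd L (u x) (u y)"
    "u \<in> extensional (carrier F)"
proof -
  have u: "u \<in> carrier F \<rightarrow>\<^sub>E carrier L"
    "\<forall>x\<in>carrier F. \<forall>y\<in>carrier F. u ` hadd F x y \<subseteq> hadd L (u x) (u y)"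
    using assms unfolding hom_psmf_def by blast+
  show "x \<in> carrier F \<Longrightarrow> u x \<in> carrier L" "u \<in> extensional (carrier F)"
    using u(1) by (auto simp: PiE_iff)
  show "\<lbrakk>x \<in> carrier F; y \<in> carrier F; z \<in> hadd F x y\<rbrakk> \<Longrightarrow> u z \<in> hadd L (u x) (u y)"
    using u(2) by blast
qed (use assms in \<open>simp_all add: hom_psmf_def\<close>)

lemma comp_psmf_hom:
  assumes u: "u \<in> hom_psmf F L" and v: "v \<in> hom_psmf L M" and F: "psmf F"
  shows "compose (carrier F) v u \<in> hom_psmf F M"
proof -
  interpret psmf F by fact
  note u' = hom_psmfD[OF u] and v' = hom_psmfD[OF v]
  have c: "compose (carrier F) v u x = v (u x)" if "x \<in> carrier F" for x
    using that by (simp add: compose_def)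
  show ?thesis
    unfolding hom_psmf_def
  proof (intro CollectI conjI ballI)
    show "compose (carrier F) v u \<in> carrier F \<rightarrow>\<^sub>E carrier M"
      by (auto simp: compose_def PiE_iff intro: u'(1) v'(1))
    show "compose (carrier F) v u (hzero F) = hzero M" "compose (carrier F) v u \<one>\<^bsub>F\<^esub> = \<one>\<^bsub>M\<^esub>"
      by (simp_all only: c zero_closed one_closed u'(2,3) v'(2,3))
    fix x assume x: "x \<in> carrier F"
    show "compose (carrier F) v u (hneg F x) = hneg M (compose (carrier F) v u x)"
      by (simp only: c x neg_closed u'(1,4) v'(4))
    fix y assume y: "y \<in> carrier F"
    show "compose (carrier F) v u (x \<otimes>\<^bsub>F\<^esub> y) = compose (carrier F) v u x \<otimes>\<^bsub>M\<^esub> compose (carrier F) v u y"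
      by (simp only: c x y m_closed u'(1,5) v'(5))
    show "compose (carrier F) v u ` hadd F x y \<subseteq> hadd M (compose (carrier F) v u x) (compose (carrier F) v u y)"
    proof (rule image_subsetI)
      fix z assume z: "z \<in> hadd F x y"
      then have "z \<in> carrier F" using add_closed[OF x y] by blast
      then show "compose (carrier F) v u z \<in> hadd M (compose (carrier F) v u x) (compose (carrier F) v u y)"
        unfolding c[OF x] c[OF y] using v'(6)[OF u'(1)[OF x] u'(1)[OF y] u'(6)[OF x y z]] by (simp only: c)
    qed
  qed
qed

lemma id_psmf_hom:
  assumes "psmf F" shows "id_psmf F \<in> hom_psmf F F"
proof -
  interpret psmf F by fact
  have c: "id_psmf F x = x" if "x \<in> carrier F" for x using that by (simp add: id_psmf_def)
  show ?thesis
    unfolding hom_psmf_def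
  proof (intro CollectI conjI ballI image_subsetI)
    show "id_psmf F \<in> carrier F \<rightarrow>\<^sub>E carrier F" by (auto simp: id_psmf_def)
    fix x y z assume xyz: "x \<in> carrier F" "y \<in> carrier F" "z \<in> hadd F x y"
    then have "z \<in> carrier F" using add_closed[of x y] by blast
    then show "id_psmf F z \<in> hadd F (id_psmf F x) (id_psmf F y)"
      using xyz by (simp only: c)
  qed (simp_all only: c zero_closed one_closed neg_closed m_closed)
qed

lemma hom_psmf_nz:
  assumes "psmf F" "psmf L" "u \<in> hom_psmf F L" "x \<in> carrier F - {hzero F}"
  shows "u x \<in> carrier L - {hzero L}"
proof -
  interpret F: psmf F by fact
  interpret L: psmf L by fact
  have "u x \<otimes>\<^bsub>L\<^esub> u x = \<one>\<^bsub>L\<^esub>"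
    using hom_psmfD(3,5)[OF assms(3)] F.square_one[of x] assms(4) by (metis Diff_iff insertI1)
  then show ?thesis
    using hom_psmfD(1)[OF assms(3), of x] assms(4) L.mult_zero[OF L.zero_closed] L.one_not_zero by auto
qed

text \<open>Since \<open>u(x)\<close> squares to 1, it is not zero and has a logarithm in \<open>R\<^sub>1\<close>.\<close>

lemma hom_Gamma_unit:
  assumes "psmf F" "u \<in> hom_psmf F (Gamma R)" "x \<in> carrier F - {hzero F}"
  shows "u x = e_of (l_of (u x))" "l_of (u x) \<in> carrier (igrp R 1)"
proof -
  interpret F: psmf F by fact
  have "u x \<otimes>\<^bsub>Gamma R\<^esub> u x = \<one>\<^bsub>Gamma R\<^esub>"
    using hom_psmfD(3,5)[OF assms(2)] F.square_one[of x] assms(3) by (metis Diff_iff insertI1)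
  then have "u x \<noteq> GZero" by (auto simp: Gamma_def G_mult_def)
  then show "u x = e_of (l_of (u x))" "l_of (u x) \<in> carrier (igrp R 1)"
    using hom_psmfD(1)[OF assms(2), of x] assms(3) by (auto simp: Gamma_def G_set_def)
qed

section \<open>Morphisms out of the reduced K-theory ring\<close>

lemma (in igr) itop_iprod: "itop R n = iprod R (replicate n (itop R 1))"
proof (induction n)
  case (Suc n)
  show ?case
  proof (cases "n = 0")
    case True
    then show ?thesis using gr.mult_one_right[of "itop R 1" 1] top_closed[of 1] by (simp add: One_nat_def)
  next
    case False
    then have "itop R (Suc n) = imult R 1 n (itop R 1) (itop R n)"
      using h_top[of n] h_eq[of n "itop R n"] top_closed[of n] by (simp add: One_nat_def)
    then show ?thesis using Suc by simp
  qed
qed simp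

context psmf
begin

lemma hom_igr_symbol:
  assumes R: "graded_products R" and g: "g \<in> hom_igr (k_obj F) R" and as: "set as \<subseteq> nz"
  shows "g (length as) (symbol F as) = iprod R (map (\<lambda>a. g 1 (rho F a)) as)"
  using as
proof (induction as)
  case Nil
  have "g 0 (itop (k_obj F) 0) = itop R 0" using g by (simp add: hom_igr_def)
  then show ?case by (simp add: itop_k)
next
  case (Cons a as)
  have "symbol F (a # as) = k_mult F 1 (length as) (rho F a) (symbol F as)"
    using Cons k_mult_symbol[of "[a]" as 1 "length as"] by (simp add: rho_eq)
  moreover have "g (1 + length as) (k_mult F 1 (length as) (rho F a) (symbol F as))
      = imult R 1 (length as) (g 1 (rho F a)) (g (length as) (symbol F as))"
    using hom_igr_mult[OF k_obj_graded R g, of "rho F a" 1 "symbol F as" "length as"] Cons.prems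
    by (simp add: rho_in(1))
  ultimately show ?case using Cons by (simp add: plus_1_eq_Suc)
qed

text \<open>The ring \<open>k(F)\<close> is generated by degree 1.\<close>

lemma hom_igr_eqI:
  assumes R: "graded_products R" and g: "g \<in> hom_igr (k_obj F) R" and h: "h \<in> hom_igr (k_obj F) R"
    and eq: "\<And>a. a \<in> nz \<Longrightarrow> g 1 (rho F a) = h 1 (rho F a)"
  shows "g = h"
proof (rule ext, rule extensionalityI)
  fix n
  show "g n \<in> extensional (carrier (k n))" "h n \<in> extensional (carrier (k n))"
    using g h by (auto simp: hom_igr_def)
  have gh: "g n \<in> hom (k n) (igrp R n)" "h n \<in> hom (k n) (igrp R n)"
    using g h by (auto simp: hom_igr_def)
  show "g n X = h n X" if "X \<in> carrier (k n)" for X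
  proof (rule k_hom_eqI[OF graded_products.is_group[OF R] gh that])
    fix as assume as: "set as \<subseteq> nz" "length as = n"
    have "iprod R (map (\<lambda>a. g 1 (rho F a)) as) = iprod R (map (\<lambda>a. h 1 (rho F a)) as)"
      using as by (intro arg_cong[where f = "iprod R"] map_cong refl eq) blast
    then show "g n (symbol F as) = h n (symbol F as)"
      using hom_igr_symbol[OF R g as(1)] hom_igr_symbol[OF R h as(1)] as(2) by simp
  qed
qed

text \<open>The other half of the universal property of \<open>k(F)\<close>. Write \<open>f(a)\<close> for the logarithm of \<open>u(a)\<close> and send a
  symbol \<open>{a\<^sub>1, \<dots>, a\<^sub>n}\<close> to \<open>f(a\<^sub>1) \<cdots> f(a\<^sub>n)\<close>. The Steinberg relation is respected because \<open>b \<in> 1 - a\<close>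
  gives \<open>u(b) \<in> 1 - u(a)\<close>, that is \<open>f(a)f(b) = 0\<close>.\<close>

lemma lift_exists:
  assumes "igr_plus R" and u: "u \<in> hom_psmf F (Gamma R)"
  obtains g where "g \<in> hom_igr (k_obj F) R" "\<And>a. a \<in> nz \<Longrightarrow> g 1 (rho F a) = l_of (u a)"
proof -
  interpret R: igr_plus R by fact
  define f where "f a = l_of (u a)" for a
  have f: "u a = e_of (f a)" "f a \<in> R.R1" if "a \<in> nz" for a
    unfolding f_def by (rule hom_Gamma_unit[OF psmf_axioms u that])+
  have f_mult: "f (a \<otimes> b) = R.plus1 (f a) (f b)" if "a \<in> nz" "b \<in> nz" for a b
  proof -
    have "u (a \<otimes> b) = e_of (R.plus1 (f a) (f b))"
      using hom_psmfD(5)[OF u, of a b] f(1)[OF that(1)] f(1)[OF that(2)] that by simp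
    then show ?thesis unfolding f_def[of "a \<otimes> b"] by simp
  qed
  have f_top: "f (hneg F \<one>) = itop R 1"
    using hom_psmfD(3)[OF u] hom_psmfD(4)[OF u, of \<one>] R.top_closed[of 1] by (simp add: f_def)
  have f_steinberg: "R.times (f a) (f b) = \<one>\<^bsub>igrp R 2\<^esub>" if a: "a \<in> nz" and b: "b \<in> nz" and ab: "b \<in> hdiff F \<one> a" for a b
  proof -
    have "u b \<in> G_add R (u \<one>) (u (hneg F a))"
      using hom_psmfD(6)[OF u, of \<one> "hneg F a" b] ab a neg_closed by (simp add: hdiff_def)
    then have "e_of (f b) \<in> G_add R (e_of \<one>\<^bsub>igrp R 1\<^esub>) (e_of (R.plus1 (itop R 1) (f a)))"
      using hom_psmfD(3)[OF u] hom_psmfD(4)[OF u, of a] f[OF a] f[OF b] a by simp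
    then have "R.times (f b) (f a) = \<one>\<^bsub>igrp R 2\<^esub>"
      using R.G_one_minus_iff[OF f(2)[OF a]] by auto
    then show ?thesis using R.times_comm[OF f(2)[OF a] f(2)[OF b]] by simp
  qed
  have fs: "set (map f as) \<subseteq> R.R1" if "set as \<subseteq> nz" for as
    using that f(2) by (auto simp only: set_map)
  have "\<exists>g. g \<in> hom (k n) (igrp R n) \<and>
      (\<forall>as. set as \<subseteq> nz \<and> length as = n \<longrightarrow> g (symbol F as) = iprod R (map f as))" for n
  proof (rule k_universal[OF R.grp R.exponent_two, of n n "\<lambda>as. iprod R (map f as)"])
    fix as assume "set as \<subseteq> nz" "length as = n"
    then show "iprod R (map f as) \<in> carrier (igrp R n)" using R.gr.iprod_in[OF fs] by auto
  next
    fix us x y vs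
    assume *: "set us \<subseteq> nz" "set vs \<subseteq> nz" "x \<in> nz" "y \<in> nz" "length us + 1 + length vs = n"
    then show "iprod R (map f (us @ x \<otimes> y # vs)) =
      iprod R (map f (us @ x # vs)) \<otimes>\<^bsub>igrp R n\<^esub> iprod R (map f (us @ y # vs))"
      using R.gr.iprod_add[OF fs fs f(2) f(2), of us vs x y n] f_mult[of x y] by simp
  next
    fix as i
    assume *: "set as \<subseteq> nz" "length as = n" "Suc i < n" "as ! Suc i \<in> hdiff F \<one> (as ! i)"
    define us vs where "us = take i as" and "vs = drop (Suc (Suc i)) as"
    have as: "as = us @ as ! i # as ! Suc i # vs"
      using * by (simp add: us_def vs_def Cons_nth_drop_Suc)
    have "set (us @ as ! i # as ! Suc i # vs) \<subseteq> nz" using *(1) as by metis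
    then have sub: "set us \<subseteq> nz" "set vs \<subseteq> nz" "as ! i \<in> nz" "as ! Suc i \<in> nz"
      by simp_all
    have len: "n = length us + 2 + length vs" using * by (simp add: us_def vs_def)
    show "iprod R (map f as) = \<one>\<^bsub>igrp R n\<^esub>"
      using R.gr.iprod_eq_zero[OF fs[OF sub(1)] fs[OF sub(2)] f(2)[OF sub(3)] f(2)[OF sub(4)] f_steinberg[OF sub(3,4) *(4)]] len
      by (subst as) simp
  next
    fix g assume "g \<in> hom (k n) (igrp R n)"
      "\<And>as. \<lbrakk>set as \<subseteq> nz; length as = n\<rbrakk> \<Longrightarrow> g (symbol F as) = iprod R (map f as)"
    then show "\<exists>g. g \<in> hom (k n) (igrp R n) \<and>
      (\<forall>as. set as \<subseteq> nz \<and> length as = n \<longrightarrow> g (symbol F as) = iprod R (map f as))"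
      by (intro exI[of _ g] conjI allI impI) simp_all
  qed
  then obtain g0 where g0: "\<And>n. g0 n \<in> hom (k n) (igrp R n)"
      "\<And>n as. \<lbrakk>set as \<subseteq> nz; length as = n\<rbrakk> \<Longrightarrow> g0 n (symbol F as) = iprod R (map f as)"
    by metis
  \<comment> \<open>Both sides are additive in \<open>X\<close> and in \<open>Y\<close>, so it suffices to compare them on symbols.\<close>
  have g0_mult: "g0 (n + m) (k_mult F n m X Y) = imult R n m (g0 n X) (g0 m Y)"
    if X: "X \<in> carrier (k n)" and Y: "Y \<in> carrier (k m)" for n m X Y
  proof -
    note g0_in = hom_in_carrier[OF g0(1)]
    have right: "(g0 (n + m) \<circ> k_mult F n m X) Y = (imult R n m (g0 n X) \<circ> g0 m) Y"
      if eq: "\<And>bs. \<lbrakk>set bs \<subseteq> nz; length bs = m\<rbrakk> \<Longrightarrow> (g0 (n + m) \<circ> k_mult F n m X) (symbol F bs)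
          = (imult R n m (g0 n X) \<circ> g0 m) (symbol F bs)"
      by (rule k_hom_eqI[OF R.gr.is_group hom_compose[OF k_mult_hom(1)[OF X] g0(1)]
           hom_compose[OF g0(1) R.gr.mult_hom[OF g0_in[OF X]]] Y eq])
    have left: "(g0 (n + m) \<circ> (\<lambda>X. k_mult F n m X Z)) X = ((\<lambda>x. imult R n m x (g0 m Z)) \<circ> g0 n) X"
      if Z: "Z \<in> carrier (k m)" and
        eq: "\<And>as. \<lbrakk>set as \<subseteq> nz; length as = n\<rbrakk> \<Longrightarrow> (g0 (n + m) \<circ> (\<lambda>X. k_mult F n m X Z)) (symbol F as)
          = ((\<lambda>x. imult R n m x (g0 m Z)) \<circ> g0 n) (symbol F as)" for Z
      by (rule k_hom_eqI[OF R.gr.is_group hom_compose[OF K.mult_hom_left[of Z m n, unfolded igrp_k imult_k, OF Z] g0(1)]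
           hom_compose[OF g0(1) R.gr.mult_hom_left[OF g0_in[OF Z]]] X eq])
    have "g0 (n + m) (k_mult F n m X (symbol F bs)) = imult R n m (g0 n X) (g0 m (symbol F bs))"
      if bs: "set bs \<subseteq> nz" "length bs = m" for bs
    proof -
      have "g0 (n + m) (k_mult F n m (symbol F as) (symbol F bs)) = imult R n m (g0 n (symbol F as)) (g0 m (symbol F bs))"
        if as: "set as \<subseteq> nz" "length as = n" for as
        using k_mult_symbol[OF as(1) bs(1) as(2) bs(2)] R.gr.iprod_append[OF fs[OF as(1)] fs[OF bs(1)]] as bs
          g0(2)[of "as @ bs" "n + m"] by (simp add: g0(2))
      then show ?thesis using left[of "symbol F bs"] bs by simp
    qed
    then show ?thesis using right by simp
  qed
  define g where "g = (\<lambda>n. restrict (g0 n) (carrier (k n)))"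
  have "g \<in> hom_igr (k_obj F) R"
    unfolding hom_igr_iff[OF k_obj_graded R.graded_products]
  proof (intro conjI allI ballI)
    fix n
    show "g n \<in> hom (igrp (k_obj F) n) (igrp R n) \<inter> extensional (carrier (igrp (k_obj F) n))"
      using g0(1)[of n] K.add_in[of _ n] by (auto simp: g_def hom_def)
    show "g n (itop (k_obj F) n) = itop R n"
      using g0(2)[of "replicate n (hneg F \<one>)" n] R.itop_iprod[of n] f_top by (simp add: g_def itop_k map_replicate)
  next
    fix n m X Y assume XY: "X \<in> carrier (igrp (k_obj F) n)" "Y \<in> carrier (igrp (k_obj F) m)"
    then show "g (n + m) (imult (k_obj F) n m X Y) = imult R n m (g n X) (g m Y)"
      using g0_mult[of X n Y m] K.mult_in[OF XY] by (simp add: g_def)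
  qed
  moreover have "g 1 (rho F a) = l_of (u a)" if a: "a \<in> nz" for a
    using g0(2)[of "[a]" 1] a R.gr.mult_one_right[of "f a" 1] f(2)[OF a] by (simp add: g_def rho_eq) (simp add: f_def)
  ultimately show thesis using that by blast
qed

end

section \<open>The unit\<close>

text \<open>With \<open>n = \<top>\<^sub>1 + a + b\<close> one has \<open>na = ab\<close>, so that \<open>n(c + a) = 0\<close> becomes
  the equation of \<open>e_of_in_G_add_iff\<close>. It translates \<open>zx \<in> 1 - (-xy)\<close> back into \<open>z \<in> x + y\<close>.\<close>

lemma (in igr_plus) in_G_add_of_times_eq_zero:
  assumes a: "a \<in> R1" and b: "b \<in> R1" and c: "c \<in> R1"
    and eq: "(t +\<^sub>1 (a +\<^sub>1 b)) *\<^sub>1 (c +\<^sub>1 a) = \<one>\<^bsub>igrp R 2\<^esub>"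
  shows "e_of c \<in> G_add R (e_of a) (e_of b)"
proof -
  let ?n = "t +\<^sub>1 (a +\<^sub>1 b)"
  have n: "?n \<in> R1" using a b top_closed[of 1] by simp
  have "?n *\<^sub>1 a = a *\<^sub>1 b"
    using a b top_closed[of 1] times_self[OF a] times_comm[OF b a] cancel2[of "t *\<^sub>1 a" "a *\<^sub>1 b"]
    by (simp add: plus_times)
  moreover have "?n *\<^sub>1 c = c *\<^sub>1 (a +\<^sub>1 b +\<^sub>1 t)"
    using a b c n times_comm[OF n c] A.m_comm[of t "a +\<^sub>1 b"] top_closed[of 1] by simp
  ultimately have "c *\<^sub>1 (a +\<^sub>1 b +\<^sub>1 t) +\<^sub>2 a *\<^sub>1 b = \<one>\<^bsub>igrp R 2\<^esub>"
    using eq times_plus[OF n c a] by simp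
  then have "c *\<^sub>1 (a +\<^sub>1 b +\<^sub>1 t) = a *\<^sub>1 b"
    using plus_eq_zero_iff2[of "c *\<^sub>1 (a +\<^sub>1 b +\<^sub>1 t)" "a *\<^sub>1 b"] a b c top_closed[of 1] by simp
  then show ?thesis using a b c by (simp add: e_of_in_G_add_iff)
qed

context psmf
begin

lemma rho_neg: "a \<in> nz \<Longrightarrow> rho F (hneg F a) = itop (k_obj F) 1 \<otimes>\<^bsub>k 1\<^esub> rho F a"
  using rho_mult[OF neg_nz[OF one_nz], of a] neg_eq[of a] by (simp add: itop_k rho_eq One_nat_def)

lemma phi_simps: "phi F (hzero F) = GZero" "a \<in> nz \<Longrightarrow> phi F a = e_of (rho F a)"
  using zero_closed by (auto simp: phi_def)

lemma rho_times:
  assumes "a \<in> nz" "b \<in> nz" shows "k_mult F 1 1 (rho F a) (rho F b) = symbol F [a, b]"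
  using k_mult_symbol[of "[a]" "[b]" 1 1] assms by (simp add: rho_eq)

text \<open>Multiplying \<open>z \<in> x + y\<close> by \<open>x\<close> gives \<open>zx \<in> 1 + xy = 1 - (-xy)\<close>, since \<open>x\<^sup>2 = 1\<close>. The
  Steinberg relation \<open>{-xy, zx} = 0\<close>, expanded in degree 1, is the hypothesis of
  \<open>in_G_add_of_times_eq_zero\<close>.\<close>

lemma rho_add:
  assumes x: "x \<in> nz" and y: "y \<in> nz" and z: "z \<in> nz" and xyz: "z \<in> hadd F x y"
  shows "e_of (rho F z) \<in> G_add (k_obj F) (e_of (rho F x)) (e_of (rho F y))"
proof -
  interpret k: igr_plus "k_obj F" by (rule k_obj_igr_plus)
  let ?t = "itop (k_obj F) 1"
  note in1 = rho_in(1)[OF x] rho_in(1)[OF y] rho_in(1)[OF z] itop_k_in[of 1]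
  have xy: "x \<otimes> y \<in> nz" and zx: "z \<otimes> x \<in> nz" using nz_mult x y z by blast+
  have "z \<otimes> x \<in> hadd F (x \<otimes> x) (y \<otimes> x)" using distrib[of x y x z] x y xyz by simp
  then have "z \<otimes> x \<in> hdiff F \<one> (hneg F (x \<otimes> y))"
    using square_one[of x] m_comm[of x y] x y xy by (simp add: hdiff_def)
  then have "symbol F [hneg F (x \<otimes> y), z \<otimes> x] = \<one>\<^bsub>k 2\<^esub>"
    using neg_nz[OF xy] zx by (intro symbol_steinberg[of _ 0]) auto
  then have "k.times (rho F (hneg F (x \<otimes> y))) (rho F (z \<otimes> x)) = \<one>\<^bsub>k 2\<^esub>"
    using rho_times[OF neg_nz[OF xy] zx] by simp
  then have "k.times (k.plus1 ?t (k.plus1 (rho F x) (rho F y))) (k.plus1 (rho F z) (rho F x)) = \<one>\<^bsub>k 2\<^esub>"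
    using rho_neg[OF xy] rho_mult[OF x y] rho_mult[OF z x] by simp
  then show ?thesis using in1 k.in_G_add_of_times_eq_zero[of "rho F x" "rho F y" "rho F z"] by simp
qed

theorem phi_hom: "phi F \<in> hom_psmf F (Gamma (k_obj F))"
proof -
  interpret k: igr_plus "k_obj F" by (rule k_obj_igr_plus)
  have cases: "x = hzero F \<or> x \<in> nz" if "x \<in> carrier F" for x using that by blast
  show ?thesis
    unfolding hom_psmf_def
  proof (intro CollectI conjI ballI)
    show "phi F \<in> carrier F \<rightarrow>\<^sub>E carrier (Gamma (k_obj F))"
      using rho_in(1) by (auto simp: phi_def G_set_def)
    show "phi F \<one> = \<one>\<^bsub>Gamma (k_obj F)\<^esub>" using phi_simps(2)[OF one_nz] rho_one by simp
    fix x assume x: "x \<in> carrier F"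
    from cases[OF x] show "phi F (hneg F x) = hneg (Gamma (k_obj F)) (phi F x)"
    proof
      assume x: "x \<in> nz"
      show ?thesis using phi_simps(2)[OF x] phi_simps(2)[OF neg_nz[OF x]] rho_neg[OF x] by simp
    qed (simp add: phi_simps)
    fix y assume y: "y \<in> carrier F"
    show "phi F (x \<otimes> y) = phi F x \<otimes>\<^bsub>Gamma (k_obj F)\<^esub> phi F y"
    proof (cases "x \<in> nz \<and> y \<in> nz")
      case True
      then show ?thesis using phi_simps(2)[of x] phi_simps(2)[of y] phi_simps(2)[OF nz_mult[of x y]] rho_mult[of x y] by simp
    next
      case False
      then have "x = hzero F \<or> y = hzero F" using x y by blast
      then show ?thesis
        using mult_zero[OF x] mult_zero[OF y] m_comm[OF zero_closed y] phi_simps(1) by auto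
    qed
    show "phi F ` hadd F x y \<subseteq> hadd (Gamma (k_obj F)) (phi F x) (phi F y)"
    proof clarify
      fix z assume z: "z \<in> hadd F x y"
      then have zc: "z \<in> carrier F" using add_closed[OF x y] by blast
      show "phi F z \<in> hadd (Gamma (k_obj F)) (phi F x) (phi F y)"
      proof (cases "x \<in> nz \<and> y \<in> nz")
        case True
        from cases[OF zc] show ?thesis
        proof
          assume "z = hzero F"
          then have "x = hneg F y" using zero_in_add_iff[OF y x] add_comm[OF x y] z by simp
          then have "rho F x = itop (k_obj F) 1 \<otimes>\<^bsub>k 1\<^esub> rho F y" using rho_neg True by simp
          then show ?thesis using \<open>z = hzero F\<close> True phi_simps by simp
        next
          assume "z \<in> nz"
          then show ?thesis using rho_add[of x y z] z True phi_simps(2) by simp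
        qed
      next
        case False
        then have "(x = hzero F \<and> z = y) \<or> (y = hzero F \<and> z = x)"
          using z add_zero[OF x] add_zero[OF y] add_comm[OF x y] x y by auto
        then show ?thesis using phi_simps(1) by auto
      qed
    qed
  qed (simp add: phi_simps)
qed

end

section \<open>The adjunction\<close>

context psmf
begin

lemma transpose_simps:
  assumes "g \<in> hom_igr (k_obj F) R"
  shows "transpose_mor F g (hzero F) = GZero" "a \<in> nz \<Longrightarrow> transpose_mor F g a = e_of (g 1 (rho F a))"
  using zero_closed rho_in(1)[of a] by (auto simp: transpose_mor_def compose_def phi_simps Gamma_map_simps)

lemma transpose_hom:
  assumes "igr_plus R" "g \<in> hom_igr (k_obj F) R"
  shows "transpose_mor F g \<in> hom_psmf F (Gamma R)"
  unfolding transpose_mor_def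
  by (rule comp_psmf_hom[OF phi_hom Gamma_map_hom[OF k_obj_igr_plus assms] psmf_axioms])

text \<open>A morphism and its transpose determine each other through \<open>g\<^sub>1(\<rho>(a))\<close>, so injectivity
  is \<open>hom_igr_eqI\<close> and surjectivity is \<open>lift_exists\<close>.\<close>

theorem transpose_bij:
  assumes R: "igr_plus R"
  shows "bij_betw (transpose_mor F) (hom_igr (k_obj F) R) (hom_psmf F (Gamma R))"
proof -
  interpret R: igr_plus R by fact
  have "g = h" if g: "g \<in> hom_igr (k_obj F) R" and h: "h \<in> hom_igr (k_obj F) R"
    and eq: "transpose_mor F g = transpose_mor F h" for g h
    using hom_igr_eqI[OF R.graded_products g h] transpose_simps(2)[OF g] transpose_simps(2)[OF h] eq
    by (metis gamma.inject)
  moreover have "u \<in> transpose_mor F ` hom_igr (k_obj F) R" if u: "u \<in> hom_psmf F (Gamma R)" for u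
  proof -
    obtain g where g: "g \<in> hom_igr (k_obj F) R" "\<And>a. a \<in> nz \<Longrightarrow> g 1 (rho F a) = l_of (u a)"
      using lift_exists[OF R u] by blast
    have "u = transpose_mor F g"
    proof (rule extensionalityI[OF hom_psmfD(7)[OF u] hom_psmfD(7)[OF transpose_hom[OF R g(1)]]])
      fix x assume "x \<in> carrier F"
      then consider "x = hzero F" | "x \<in> nz" by blast
      then show "u x = transpose_mor F g x"
      proof cases
        case 1
        then show ?thesis using hom_psmfD(2)[OF u] transpose_simps(1)[OF g(1)] by simp
      next
        case 2
        then show ?thesis using hom_Gamma_unit(1)[OF psmf_axioms u 2] transpose_simps(2)[OF g(1) 2] g(2)[OF 2] by simp
      qed
    qed
    then show ?thesis using g(1) by blast
  qed
  ultimately show ?thesis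
    using transpose_hom[OF R] by (auto simp: bij_betw_def inj_on_def)
qed

end

text \<open>The map \<open>k(u)\<close>, defined on representatives, is identified with the morphism whose transpose is \<open>\<phi>\<^sub>L \<circ> u\<close>, both
  being determined by \<open>{a\<^sub>1, \<dots>, a\<^sub>n} \<mapsto> {u(a\<^sub>1), \<dots>, u(a\<^sub>n)}\<close>. Well-definedness and multiplicativity
  are thereby inherited from \<open>lift_exists\<close>.\<close>

theorem k_map_hom:
  assumes F: "psmf F" and L: "psmf L" and u: "u \<in> hom_psmf F L"
  shows "k_map F L u \<in> hom_igr (k_obj F) (k_obj L)"
    and "a \<in> carrier F - {hzero F} \<Longrightarrow> k_map F L u 1 (rho F a) = rho L (u a)"
proof -
  interpret F: psmf F by fact
  interpret L: psmf L by fact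
  note u_nz = hom_psmf_nz[OF F L u]
  obtain g where g: "g \<in> hom_igr (k_obj F) (k_obj L)"
      "\<And>a. a \<in> F.nz \<Longrightarrow> g 1 (rho F a) = l_of (compose (carrier F) (phi L) u a)"
    using F.lift_exists[OF L.k_obj_igr_plus comp_psmf_hom[OF u L.phi_hom F]] by blast
  have g_rho: "g 1 (rho F a) = rho L (u a)" if "a \<in> F.nz" for a
    using g(2)[OF that] L.phi_simps(2)[OF u_nz[OF that]] that by (simp add: compose_def)
  have g_hom: "g n \<in> hom (F.k n) (L.k n)" "g n \<in> extensional (carrier (F.k n))" for n
    using g(1) by (auto simp: hom_igr_def)
  have u_tuple: "set (map u as) \<subseteq> L.nz" if "set as \<subseteq> F.nz" for as
    using that u_nz by (auto simp only: set_map)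
  have g_symbol: "g (length as) (symbol F as) = symbol L (map u as)" if as: "set as \<subseteq> F.nz" for as
  proof -
    have "iprod (k_obj L) (map (\<lambda>a. g 1 (rho F a)) as) = iprod (k_obj L) (map (rho L) (map u as))"
      unfolding map_map using as g_rho by (intro arg_cong[where f = "iprod (k_obj L)"] map_cong) auto
    then show ?thesis
      using F.hom_igr_symbol[OF L.k_obj_graded g(1) as] L.iprod_k[OF u_tuple[OF as]] by simp
  qed
  have "k_map F L u = g"
  proof (rule ext, rule extensionalityI)
    fix n
    show "k_map F L u n \<in> extensional (carrier (F.k n))" by (simp add: k_map_def)
    show "g n \<in> extensional (carrier (F.k n))" by (rule g_hom)
    fix X assume X: "X \<in> carrier (F.k n)"
    let ?u = "frag_extend (\<lambda>as. frag_of (map u as))"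
    have "(k_class L n \<circ> ?u) (k_rep F n X) = (g n \<circ> k_class F n) (k_rep F n X)"
    proof (rule free_hom_eqI[OF L.k_group])
      show "k_class L n \<circ> ?u \<in> hom (F.Free n) (L.k n)"
      proof (rule hom_compose[OF frag_extend_hom L.k_class_hom])
        fix as assume "as \<in> tuples (nonzero_group F) n"
        then show "Poly_Mapping.keys (frag_of (map u as)) \<subseteq> tuples (nonzero_group L) n"
          using u_tuple[of as] by (simp add: F.tuples_iff L.tuples_iff)
      qed
      show "g n \<circ> k_class F n \<in> hom (F.Free n) (L.k n)"
        by (rule hom_compose[OF F.k_class_hom g_hom(1)])
      show "Poly_Mapping.keys (k_rep F n X) \<subseteq> tuples (nonzero_group F) n" using X by simp
      fix as assume as: "as \<in> tuples (nonzero_group F) n"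
      then have "map u as \<in> tuples (nonzero_group L) n"
        using u_tuple[of as] by (simp add: F.tuples_iff L.tuples_iff)
      then show "(k_class L n \<circ> ?u) (frag_of as) = (g n \<circ> k_class F n) (frag_of as)"
        using as g_symbol[of as] F.k_class_of[OF as] L.k_class_of by (auto simp: F.tuples_iff)
    qed
    then show "k_map F L u n X = g n X"
      using X F.k_rep(2)[OF X] by (simp add: k_map_def)
  qed
  then show "k_map F L u \<in> hom_igr (k_obj F) (k_obj L)"
    "a \<in> carrier F - {hzero F} \<Longrightarrow> k_map F L u 1 (rho F a) = rho L (u a)"
    using g(1) g_rho by blast+
qed

lemma k_map_id:
  assumes F: "psmf F" shows "k_map F F (id_psmf F) = id_igr (k_obj F)"
proof -
  interpret psmf F by fact
  show ?thesis
  proof (rule hom_igr_eqI[OF k_obj_graded k_map_hom(1)[OF F F id_psmf_hom[OF F]] id_igr_hom[OF k_obj_graded]])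
    fix a assume a: "a \<in> nz"
    then show "k_map F F (id_psmf F) 1 (rho F a) = id_igr (k_obj F) 1 (rho F a)"
      using k_map_hom(2)[OF F F id_psmf_hom[OF F] a] rho_in(1)[OF a] by (simp add: id_psmf_def id_igr_def)
  qed simp
qed

lemma k_map_comp:
  assumes F: "psmf F" and L: "psmf L" and M: "psmf M" and u: "u \<in> hom_psmf F L" and v: "v \<in> hom_psmf L M"
  shows "k_map F M (compose (carrier F) v u) = comp_igr (k_obj F) (k_map L M v) (k_map F L u)"
proof -
  interpret F: psmf F by fact
  note graded = psmf.k_obj_graded[OF F] psmf.k_obj_graded[OF L] psmf.k_obj_graded[OF M]
  note vu = comp_psmf_hom[OF u v F]
  show ?thesis
  proof (rule F.hom_igr_eqI[OF graded(3) k_map_hom(1)[OF F M vu]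
        comp_igr_hom[OF graded _ k_map_hom(1)[OF F L u] k_map_hom(1)[OF L M v]]])
    fix a assume a: "a \<in> F.nz"
    show "k_map F M (compose (carrier F) v u) 1 (rho F a) = comp_igr (k_obj F) (k_map L M v) (k_map F L u) 1 (rho F a)"
      using k_map_hom(2)[OF F M vu a] k_map_hom(2)[OF F L u a] k_map_hom(2)[OF L M v hom_psmf_nz[OF F L u a]]
        F.rho_in(1)[OF a] a by (simp add: comp_igr_def compose_def)
  qed simp
qed

lemma (in psmf) ext_nz:
  assumes "f \<in> extensional (carrier F)" "g \<in> extensional (carrier F)"
    and "f (hzero F) = g (hzero F)" "\<And>a. a \<in> nz \<Longrightarrow> f a = g a"
  shows "f = g"
  using assms by (intro extensionalityI[of f "carrier F" g]) (auto intro: case_split)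

lemma phi_natural:
  assumes F: "psmf F" and L: "psmf L" and u: "u \<in> hom_psmf F L"
  shows "compose (carrier F) (phi L) u = compose (carrier F) (Gamma_map (k_obj F) (k_map F L u)) (phi F)"
proof -
  interpret F: psmf F by fact
  interpret L: psmf L by fact
  show ?thesis
  proof (rule F.ext_nz)
    show "compose (carrier F) (phi L) u (hzero F)
        = compose (carrier F) (Gamma_map (k_obj F) (k_map F L u)) (phi F) (hzero F)"
      using hom_psmfD(2)[OF u] F.zero_closed
      by (simp add: compose_def F.phi_simps L.phi_simps Gamma_map_simps)
    fix a assume a: "a \<in> F.nz"
    show "compose (carrier F) (phi L) u a = compose (carrier F) (Gamma_map (k_obj F) (k_map F L u)) (phi F) a"
      using L.phi_simps(2)[OF hom_psmf_nz[OF F L u a]] F.phi_simps(2)[OF a] F.rho_in(1)[OF a]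
        k_map_hom(2)[OF F L u a] a by (simp add: compose_def Gamma_map_simps)
  qed simp_all
qed

lemma transpose_natural_left:
  assumes F: "psmf F" and L: "psmf L" and R: "igr_plus R"
    and u: "u \<in> hom_psmf F L" and g: "g \<in> hom_igr (k_obj L) R"
  shows "transpose_mor F (comp_igr (k_obj F) g (k_map F L u)) = compose (carrier F) (transpose_mor L g) u"
proof -
  interpret F: psmf F by fact
  interpret L: psmf L by fact
  interpret R: igr_plus R by fact
  have gu: "comp_igr (k_obj F) g (k_map F L u) \<in> hom_igr (k_obj F) R"
    by (rule comp_igr_hom[OF F.k_obj_graded L.k_obj_graded R.graded_products _ k_map_hom(1)[OF F L u] g]) simp
  show ?thesis
  proof (rule F.ext_nz)
    show "transpose_mor F (comp_igr (k_obj F) g (k_map F L u)) \<in> extensional (carrier F)"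
      by (simp add: transpose_mor_def)
    show "transpose_mor F (comp_igr (k_obj F) g (k_map F L u)) (hzero F) = compose (carrier F) (transpose_mor L g) u (hzero F)"
      using hom_psmfD(2)[OF u] F.zero_closed F.transpose_simps(1)[OF gu] L.transpose_simps(1)[OF g]
      by (simp add: compose_def)
    fix a assume a: "a \<in> F.nz"
    show "transpose_mor F (comp_igr (k_obj F) g (k_map F L u)) a = compose (carrier F) (transpose_mor L g) u a"
      using F.transpose_simps(2)[OF gu a] L.transpose_simps(2)[OF g hom_psmf_nz[OF F L u a]]
        k_map_hom(2)[OF F L u a] F.rho_in(1)[OF a] a by (simp add: comp_igr_def compose_def)
  qed simp
qed

lemma transpose_natural_right:
  assumes F: "psmf F" and R: "igr_plus R" and S: "igr_plus S"
    and f: "f \<in> hom_igr R S" and g: "g \<in> hom_igr (k_obj F) R"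
  shows "transpose_mor F (comp_igr (k_obj F) f g) = compose (carrier F) (Gamma_map R f) (transpose_mor F g)"
proof -
  interpret F: psmf F by fact
  interpret R: igr_plus R by fact
  interpret S: igr_plus S by fact
  have fg: "comp_igr (k_obj F) f g \<in> hom_igr (k_obj F) S"
    by (rule comp_igr_hom[OF F.k_obj_graded R.graded_products S.graded_products _ g f]) simp
  have g1: "g 1 \<in> hom (F.k 1) (igrp R 1)" using g by (auto simp: hom_igr_def)
  show ?thesis
  proof (rule F.ext_nz)
    show "transpose_mor F (comp_igr (k_obj F) f g) \<in> extensional (carrier F)"
      by (simp add: transpose_mor_def)
    show "transpose_mor F (comp_igr (k_obj F) f g) (hzero F) = compose (carrier F) (Gamma_map R f) (transpose_mor F g) (hzero F)"
      using F.zero_closed F.transpose_simps(1)[OF fg] F.transpose_simps(1)[OF g]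
      by (simp add: compose_def Gamma_map_simps)
    fix a assume a: "a \<in> F.nz"
    show "transpose_mor F (comp_igr (k_obj F) f g) a = compose (carrier F) (Gamma_map R f) (transpose_mor F g) a"
      using F.transpose_simps(2)[OF fg a] F.transpose_simps(2)[OF g a] hom_in_carrier[OF g1 F.rho_in(1)[OF a]]
        F.rho_in(1)[OF a] a by (simp add: comp_igr_def compose_def Gamma_map_simps)
  qed simp
qed

lemma transpose_id:
  assumes F: "psmf F" shows "transpose_mor F (id_igr (k_obj F)) = phi F"
proof -
  interpret F: psmf F by fact
  have id: "id_igr (k_obj F) \<in> hom_igr (k_obj F) (k_obj F)" by (rule id_igr_hom[OF F.k_obj_graded]) simp
  show ?thesis
  proof (rule F.ext_nz)
    fix a assume a: "a \<in> F.nz"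
    show "transpose_mor F (id_igr (k_obj F)) a = phi F a"
      using F.transpose_simps(2)[OF id a] F.phi_simps(2)[OF a] F.rho_in(1)[OF a] by (simp add: id_igr_def)
  next
    show "transpose_mor F (id_igr (k_obj F)) (hzero F) = phi F (hzero F)"
      using F.transpose_simps(1)[OF id] F.phi_simps(1) by simp
  qed (simp_all add: transpose_mor_def phi_def)
qed

theorem theorem6p4:
  fixes F :: "'a hyper" and L :: "'b hyper" and M :: "'c hyper"
    and R :: "'d igr" and S :: "'e igr" and T :: "'f igr"
  assumes "pre_special_hyperfield F" and "pre_special_hyperfield L" and "pre_special_hyperfield M"
    and "igr_plus R" and "igr_plus S" and "igr_plus T"
  (* The four groups of conjuncts say: k is a functor; Gamma is a functor; phi is a natural
     transformation from the identity to Gamma o k; and g |-> Gamma(g) o phi_F is a bijection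
     Hom(k(F), R) -> Hom(F, Gamma(R)), natural in F and in R, sending the identity of k(F)
     to phi_F. *)
  shows
    "(igr_plus (k_obj F) \<and>
      (\<forall>u\<in>hom_psmf F L. k_map F L u \<in> hom_igr (k_obj F) (k_obj L)) \<and>
      k_map F F (id_psmf F) = id_igr (k_obj F) \<and>
      (\<forall>u\<in>hom_psmf F L. \<forall>v\<in>hom_psmf L M.
         k_map F M (compose (carrier F) v u) = comp_igr (k_obj F) (k_map L M v) (k_map F L u))) \<and>
     (pre_special_up_to_assoc (Gamma R) \<and>
      (\<forall>f\<in>hom_igr R S. Gamma_map R f \<in> hom_psmf (Gamma R) (Gamma S)) \<and>
      Gamma_map R (id_igr R) = id_psmf (Gamma R) \<and>
      (\<forall>f\<in>hom_igr R S. \<forall>g\<in>hom_igr S T.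
         Gamma_map R (comp_igr R g f)
           = compose (carrier (Gamma R)) (Gamma_map S g) (Gamma_map R f))) \<and>
     (phi F \<in> hom_psmf F (Gamma (k_obj F)) \<and>
      (\<forall>u\<in>hom_psmf F L.
         compose (carrier F) (phi L) u
           = compose (carrier F) (Gamma_map (k_obj F) (k_map F L u)) (phi F))) \<and>
     (bij_betw (transpose_mor F) (hom_igr (k_obj F) R) (hom_psmf F (Gamma R)) \<and>
      (\<forall>u\<in>hom_psmf F L. \<forall>g\<in>hom_igr (k_obj L) R.
         transpose_mor F (comp_igr (k_obj F) g (k_map F L u)) = compose (carrier F) (transpose_mor L g) u) \<and>
      (\<forall>f\<in>hom_igr R S. \<forall>g\<in>hom_igr (k_obj F) R.
         transpose_mor F (comp_igr (k_obj F) f g)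
           = compose (carrier F) (Gamma_map R f) (transpose_mor F g)) \<and>
      transpose_mor F (id_igr (k_obj F)) = phi F)"
proof -
  have F: "psmf F" and L: "psmf L" and M: "psmf M"
    using assms by (simp_all add: psmf_def)
  note R = \<open>igr_plus R\<close> and S = \<open>igr_plus S\<close>
  show ?thesis
  proof (intro conjI ballI)
    show "igr_plus (k_obj F)" by (rule psmf.k_obj_igr_plus[OF F])
    show "k_map F F (id_psmf F) = id_igr (k_obj F)" by (rule k_map_id[OF F])
    show "pre_special_up_to_assoc (Gamma R)" by (rule igr_plus.Gamma_pre_special[OF R])
    show "Gamma_map R (id_igr R) = id_psmf (Gamma R)" by (rule Gamma_map_id)
    show "phi F \<in> hom_psmf F (Gamma (k_obj F))" by (rule psmf.phi_hom[OF F])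
    show "bij_betw (transpose_mor F) (hom_igr (k_obj F) R) (hom_psmf F (Gamma R))"
      by (rule psmf.transpose_bij[OF F R])
    show "transpose_mor F (id_igr (k_obj F)) = phi F" by (rule transpose_id[OF F])
  next
    fix u assume u: "u \<in> hom_psmf F L"
    show "k_map F L u \<in> hom_igr (k_obj F) (k_obj L)" by (rule k_map_hom(1)[OF F L u])
    show "compose (carrier F) (phi L) u = compose (carrier F) (Gamma_map (k_obj F) (k_map F L u)) (phi F)"
      by (rule phi_natural[OF F L u])
    show "k_map F M (compose (carrier F) v u) = comp_igr (k_obj F) (k_map L M v) (k_map F L u)"
      if "v \<in> hom_psmf L M" for v
      by (rule k_map_comp[OF F L M u that])
    show "transpose_mor F (comp_igr (k_obj F) g (k_map F L u)) = compose (carrier F) (transpose_mor L g) u"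
      if "g \<in> hom_igr (k_obj L) R" for g
      by (rule transpose_natural_left[OF F L R u that])
  next
    fix f assume f: "f \<in> hom_igr R S"
    show "Gamma_map R f \<in> hom_psmf (Gamma R) (Gamma S)" by (rule Gamma_map_hom[OF R S f])
    show "Gamma_map R (comp_igr R g f) = compose (carrier (Gamma R)) (Gamma_map S g) (Gamma_map R f)" for g
      by (rule Gamma_map_comp[OF f])
    show "transpose_mor F (comp_igr (k_obj F) f g) = compose (carrier F) (Gamma_map R f) (transpose_mor F g)"
      if "g \<in> hom_igr (k_obj F) R" for g
      by (rule transpose_natural_right[OF F R S f that])
  qed
qed

end
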